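(* Let $(M^4,[g],I)$ be a (directed) almost Einstein manifold in Riemannian signature. Then the tractor curvature satisfies the conformally invariant Yang–Mills equations $$\nabla^a\Omega_{ab}{}^C{}_D=0.$$ If $I$ is scalar negative, then along any singularity hypersurface $\Sigma$ of $I$ we have $$C_{abcd}=0\quad\text{and}\quad\Omega(u,v)=\Omega^\Sigma(u,v)\quad\text{along }\Sigma,$$ for all $u,v\in\Gamma(T\Sigma)$, where $C$ is the Weyl tensor of $[g]$ and $\Omega^\Sigma$ is the tractor curvature of the induced conformal structure $(\Sigma^3,[g_\Sigma])$.
   Context: Conventions. $M$ is connected, of dimension $d=4$, metrics are Riemannian, $\mathrm{Ric}=(d-2)P+Jg$ with $J=\mathrm{tr}P$. $\mathcal{E}[w]$ is the density bundle of weight $w$: sections are functions on the bundle of metrics in $[g]$ with $f(x,s^2g_x)=s^wf(x,g_x)$; each $g\in[g]$ trivialises it and gives it a connection. $\boldsymbol{g}$ is the conformal metric (tautological section of $S^2T^*M\otimes\mathcal{E}[2]$), used to raise/lower indices. Tractors. The standard tractor bundle $\mathcal{T}$ is the rank $d+2$ bundle which, for each $g\in[g]$, is identified with $\mathcal{E}[1]\oplus T^*M[1]\oplus\mathcal{E}[-1]$, where for $\hat g=e^{2\omega}g$, $\Upsilon=d\omega$, triples transform by $(\sigma,\mu_b,\rho)\mapsto(\sigma,\mu_b+\sigma\Upsilon_b,\rho-\Upsilon^b\mu_b-\frac12\sigma\Upsilon^b\Upsilon_b)$. It has the tractor metric $h$, with quadratic form $\boldsymbol{g}^{-1}(\mu,\mu)+2\sigma\rho$,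 and the tractor connection $\nabla_a(\sigma,\mu_b,\rho)=(\nabla_a\sigma-\mu_a,\ \nabla_a\mu_b+\boldsymbol{g}_{ab}\rho+P_{ab}\sigma,\ \nabla_a\rho-P_{ab}\mu^b)$, with curvature $[\nabla_a,\nabla_b]V^C=\Omega_{ab}{}^C{}_EV^E$. In the Yang–Mills equation $\nabla$ is the tractor connection coupled to the Levi-Civita connection of any $g\in[g]$. $X=(0,0,1)\in\Gamma(\mathcal{T}[1])$ is the canonical section. Almost Einstein. A (directed) almost Einstein manifold $(M,[g],I)$ is a conformal manifold with a non-zero parallel section $I$ of $\mathcal{T}$. $\sigma:=h(X,I)$, and the scale singularity set is $\Sigma=\{\sigma=0\}$. $S(I):=-h(I,I)$ is constant; $I$ is scalar negative if $S(I)<0$, and then $\Sigma$, if non-empty, is a hypersurface. Hypersurface. $[g_\Sigma]$ is the conformal class of the pullbacks of metrics in $[g]$. Let $n_a$ be the conormal of weight 1 along $\Sigma$ with $\boldsymbol{g}^{ab}n_an_b=1$, let $H^g=\frac1{d-1}(\nabla_an^a-n^an^b\nabla_an_b)$ be the mean curvature, and let $N=(0,n_a,-H^g)$ be the normal tractor. The intrinsic tractor bundle $\mathcal{T}_\Sigma$ of $(\Sigma,[g_\Sigma])$ is identified with $N^\perp\subset\mathcal{T}|_\Sigma$ by $(\sigma,\mu_b,\rho)\mapsto(\sigma,\mu_b-Hn_b\sigma,\rho+\frac12H^2\sigma)$ (in terms of $g$ and $g_\Sigma$). $\Omega^\Sigma(u,v)$ is extended by zero on $N$ to an endomorphism of $\mathcal{T}|_\Sigma$.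 *)

theory Defs
  imports "HOL-Analysis.Analysis"
begin

section \<open>Smooth maps on open subsets of Euclidean space\<close>

definition pd :: "'n \<Rightarrow> (real^'n::finite \<Rightarrow> 'b::real_normed_vector) \<Rightarrow> real^'n \<Rightarrow> 'b" where
  "pd i f x = frechet_derivative f (at x) (axis i 1)"

fun iter_pd :: "'n list \<Rightarrow> (real^'n::finite \<Rightarrow> 'b::real_normed_vector) \<Rightarrow> real^'n \<Rightarrow> 'b" where
  "iter_pd [] f = f"
| "iter_pd (i # js) f = pd i (iter_pd js f)"

text \<open>Only used for open \<open>D\<close>: differentiability of all iterated partial derivatives is
  \<open>C\<^sup>\<infinity>\<close>.\<close>

definition smooth_on :: "(real^'n::finite) set \<Rightarrow> (real^'n \<Rightarrow> 'b::real_normed_vector) \<Rightarrow> bool" where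
  "smooth_on D f \<longleftrightarrow> (\<forall>js. iter_pd js f differentiable_on D)"


section \<open>Smooth manifolds\<close>

text \<open>A chart is a coordinate domain together with a coordinate map; only the values of the map
  on the domain matter.\<close>

type_synonym ('a, 'n) chart = "'a set \<times> ('a \<Rightarrow> real^'n)"

definition cim :: "('a, 'n::finite) chart \<Rightarrow> (real^'n) set" where
  "cim c = snd c ` fst c"

definition cinv :: "('a, 'n::finite) chart \<Rightarrow> real^'n \<Rightarrow> 'a" where
  "cinv c = inv_into (fst c) (snd c)"

definition chart_on :: "'a topology \<Rightarrow> ('a, 'n::finite) chart \<Rightarrow> bool" where
  "chart_on X c \<longleftrightarrow> openin X (fst c) \<and> open (cim c) \<and>
     homeomorphic_map (subtopology X (fst c)) (top_of_set (cim c)) (snd c)"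

definition smooth_manifold :: "'a topology \<Rightarrow> ('a, 'n::finite) chart set \<Rightarrow> bool" where
  "smooth_manifold X A \<longleftrightarrow> Hausdorff_space X \<and> second_countable X \<and>
     (\<forall>c\<in>A. chart_on X c) \<and> (\<Union>c\<in>A. fst c) = topspace X \<and>
     (\<forall>c\<in>A. \<forall>c'\<in>A. smooth_on (snd c ` (fst c \<inter> fst c')) (snd c' \<circ> cinv c))"

text \<open>\<open>jac c c' p $ j $ i\<close> is the derivative of the \<open>j\<close>-th coordinate of \<open>c'\<close> with
  respect to the \<open>i\<close>-th coordinate of \<open>c\<close> at \<open>p\<close>.  The dimensions may differ: the first chart
  may belong to a submanifold.\<close>

definition jac :: "('a, 'm::finite) chart \<Rightarrow> ('a, 'n::finite) chart \<Rightarrow> 'a \<Rightarrow> real^'m^'n" where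
  "jac c c' p = matrix (frechet_derivative (snd c' \<circ> cinv c) (at (snd c p)))"

definition smooth_fun :: "('a, 'n::finite) chart set \<Rightarrow> 'a set \<Rightarrow> ('a \<Rightarrow> real) \<Rightarrow> bool" where
  "smooth_fun A W f \<longleftrightarrow> (\<forall>c\<in>A. smooth_on (snd c ` (fst c \<inter> W)) (f \<circ> cinv c))"

definition differential :: "('a, 'n::finite) chart \<Rightarrow> ('a \<Rightarrow> real) \<Rightarrow> 'a \<Rightarrow> real^'n" where
  "differential c f p = (\<chi> i. pd i (f \<circ> cinv c) (snd c p))"


section \<open>Metrics and conformal structures\<close>

text \<open>Tensors at a point are given by their components in every chart around that point.\<close>

type_synonym ('a, 'n) covector = "('a, 'n) chart \<Rightarrow> real^'n"
type_synonym ('a, 'n) form2 = "('a, 'n) chart \<Rightarrow> real^'n^'n"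
type_synonym ('a, 'n) metric = "'a \<Rightarrow> ('a, 'n) form2"

definition local_rep :: "('a, 'n::finite) metric \<Rightarrow> ('a, 'n) chart \<Rightarrow> real^'n \<Rightarrow> real^'n^'n" where
  "local_rep g c x = g (cinv c x) c"

text \<open>The first clause makes two metrics equal as functions exactly when they are equal as
  tensor fields.\<close>

definition riemannian_metric :: "('a, 'n::finite) chart set \<Rightarrow> ('a, 'n) metric \<Rightarrow> bool" where
  "riemannian_metric A g \<longleftrightarrow>
     (\<forall>p c. c \<notin> A \<or> p \<notin> fst c \<longrightarrow> g p c = 0) \<and>
     (\<forall>c\<in>A. \<forall>c'\<in>A. \<forall>p\<in>fst c \<inter> fst c'.
        g p c = transpose (jac c c' p) ** g p c' ** jac c c' p) \<and>
     (\<forall>c\<in>A. \<forall>p\<in>fst c. transpose (g p c) = g p c \<and> (\<forall>v. v \<noteq> 0 \<longrightarrow> v \<bullet> (g p c *v v) > 0)) \<and>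
     (\<forall>c\<in>A. smooth_on (cim c) (local_rep g c))"

definition rescale :: "('a \<Rightarrow> real) \<Rightarrow> ('a, 'n::finite) metric \<Rightarrow> ('a, 'n) metric" where
  "rescale \<omega> g p c = exp (2 * \<omega> p) *\<^sub>R g p c"

definition conformal_class ::
  "'a topology \<Rightarrow> ('a, 'n::finite) chart set \<Rightarrow> ('a, 'n) metric set \<Rightarrow> bool" where
  "conformal_class X A K \<longleftrightarrow>
     (\<exists>g. riemannian_metric A g \<and> K = {rescale \<omega> g |\<omega>. smooth_fun A (topspace X) \<omega>})"


section \<open>Conformal densities\<close>

text \<open>The bundle of metrics of the class \<open>K\<close> has fibre \<open>{g p |g. g \<in> K}\<close> over \<open>p\<close>.  Sections
  of the density bundle and of its product with the cotangent bundle are functions on the bundle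
  of metrics; \<open>g \<in> K\<close> trivialises a density \<open>f\<close> to the function \<open>f p (g p)\<close>.\<close>

type_synonym ('a, 'n) density = "'a \<Rightarrow> ('a, 'n) form2 \<Rightarrow> real"
type_synonym ('a, 'n) codensity = "'a \<Rightarrow> ('a, 'n) form2 \<Rightarrow> ('a, 'n) covector"

definition density_on ::
  "('a, 'n::finite) chart set \<Rightarrow> ('a, 'n) metric set \<Rightarrow> 'a set \<Rightarrow> real \<Rightarrow> ('a, 'n) density \<Rightarrow> bool" where
  "density_on A K W w f \<longleftrightarrow> (\<forall>g\<in>K.
     (\<forall>p\<in>W. \<forall>s>0. f p (\<lambda>c. s\<^sup>2 *\<^sub>R g p c) = s powr w * f p (g p)) \<and>
     smooth_fun A W (\<lambda>p. f p (g p)))"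

definition codensity_on ::
  "('a, 'n::finite) chart set \<Rightarrow> ('a, 'n) metric set \<Rightarrow> 'a set \<Rightarrow> real \<Rightarrow> ('a, 'n) codensity \<Rightarrow> bool" where
  "codensity_on A K W w \<mu> \<longleftrightarrow> (\<forall>g\<in>K. \<forall>c\<in>A.
     (\<forall>p\<in>fst c \<inter> W. \<forall>s>0. \<mu> p (\<lambda>c. s\<^sup>2 *\<^sub>R g p c) c = s powr w *\<^sub>R \<mu> p (g p) c) \<and>
     (\<forall>c'\<in>A. \<forall>p\<in>fst c \<inter> fst c' \<inter> W. \<mu> p (g p) c = \<mu> p (g p) c' v* jac c c' p) \<and>
     smooth_on (snd c ` (fst c \<inter> W)) (\<lambda>x. \<mu> (cinv c x) (g (cinv c x)) c))"


section \<open>Local Riemannian geometry\<close>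

text \<open>Below, \<open>G\<close> is the component matrix of a metric as a function of the coordinates.  Indices
  are listed in the order in which they are written in the usual notation.\<close>

definition Ginv :: "(real^'n::finite \<Rightarrow> real^'n^'n) \<Rightarrow> real^'n \<Rightarrow> real^'n^'n" where
  "Ginv G x = matrix_inv (G x)"

text \<open>\<open>christoffel G x k i j\<close> is \<open>\<Gamma>\<^sup>k\<^sub>i\<^sub>j\<close>.\<close>

definition christoffel :: "(real^'n::finite \<Rightarrow> real^'n^'n) \<Rightarrow> real^'n \<Rightarrow> 'n \<Rightarrow> 'n \<Rightarrow> 'n \<Rightarrow> real" where
  "christoffel G x k i j =
     (\<Sum>l\<in>UNIV. Ginv G x $ k $ l * (pd i G x $ l $ j + pd j G x $ l $ i - pd l G x $ i $ j)) / 2"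

text \<open>\<open>riemann G x a b c d\<close> is \<open>R\<^sub>a\<^sub>b\<^sup>c\<^sub>d\<close> in the convention
  \<open>[\<nabla>\<^sub>a, \<nabla>\<^sub>b] v\<^sup>c = R\<^sub>a\<^sub>b\<^sup>c\<^sub>d v\<^sup>d\<close>, and \<open>Ric\<^sub>b\<^sub>d = R\<^sub>a\<^sub>b\<^sup>a\<^sub>d\<close>.\<close>

definition riemann ::
  "(real^'n::finite \<Rightarrow> real^'n^'n) \<Rightarrow> real^'n \<Rightarrow> 'n \<Rightarrow> 'n \<Rightarrow> 'n \<Rightarrow> 'n \<Rightarrow> real" where
  "riemann G x a b c d =
     pd a (\<lambda>y. christoffel G y c b d) x - pd b (\<lambda>y. christoffel G y c a d) x
     + (\<Sum>e\<in>UNIV. christoffel G x c a e * christoffel G x e b d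
               - christoffel G x c b e * christoffel G x e a d)"

definition ricci :: "(real^'n::finite \<Rightarrow> real^'n^'n) \<Rightarrow> real^'n \<Rightarrow> real^'n^'n" where
  "ricci G x = (\<chi> b d. \<Sum>a\<in>UNIV. riemann G x a b a d)"

definition gtrace :: "(real^'n::finite \<Rightarrow> real^'n^'n) \<Rightarrow> real^'n \<Rightarrow> real^'n^'n \<Rightarrow> real" where
  "gtrace G x T = (\<Sum>a\<in>UNIV. \<Sum>b\<in>UNIV. Ginv G x $ a $ b * T $ a $ b)"

text \<open>\<open>P\<close> and \<open>J\<close> are the solution of \<open>Ric = (d - 2) P + J g\<close>, \<open>J = tr P\<close>; see the lemmas
  below.\<close>

definition schoutenJ :: "(real^'n::finite \<Rightarrow> real^'n^'n) \<Rightarrow> real^'n \<Rightarrow> real" where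
  "schoutenJ G x = gtrace G x (ricci G x) / (2 * (real CARD('n) - 1))"

definition schouten :: "(real^'n::finite \<Rightarrow> real^'n^'n) \<Rightarrow> real^'n \<Rightarrow> real^'n^'n" where
  "schouten G x = (1 / (real CARD('n) - 2)) *\<^sub>R (ricci G x - schoutenJ G x *\<^sub>R G x)"

lemma ricci_schouten:
  fixes G :: "real^'n::finite \<Rightarrow> real^'n^'n"
  assumes "CARD('n) \<ge> 3"
  shows "ricci G x = (real CARD('n) - 2) *\<^sub>R schouten G x + schoutenJ G x *\<^sub>R G x"
  using assms by (simp add: schouten_def)

lemma schoutenJ_trace:
  fixes G :: "real^'n::finite \<Rightarrow> real^'n^'n"
  assumes "CARD('n) \<ge> 3" "invertible (G x)" "transpose (G x) = G x"
  shows "schoutenJ G x = gtrace G x (schouten G x)"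
proof -
  have "Ginv G x ** G x = mat 1"
    using someI_ex[OF assms(2)[unfolded invertible_def]] by (simp add: Ginv_def matrix_inv_def)
  then have "(\<Sum>b\<in>UNIV. Ginv G x $ a $ b * G x $ b $ a) = 1" for a
    by (simp add: matrix_matrix_mult_def mat_def vec_eq_iff)
  moreover have "G x $ a $ b = G x $ b $ a" for a b
    using assms(3) by (metis transpose_def vec_lambda_beta)
  ultimately have tr: "gtrace G x (G x) = real CARD('n)"
    by (simp add: gtrace_def)
  have lin: "gtrace G x (k *\<^sub>R (S - m *\<^sub>R T)) = k * (gtrace G x S - m * gtrace G x T)" for k m S T
    by (simp add: gtrace_def sum_distrib_left sum_subtractf[symmetric] algebra_simps)
  show ?thesis
    using assms(1) unfolding schouten_def lin tr schoutenJ_def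
    by (simp add: divide_simps) (simp add: algebra_simps)
qed

text \<open>\<open>weyl G x a b c d\<close> is \<open>C\<^sub>a\<^sub>b\<^sub>c\<^sub>d\<close>.\<close>

definition weyl ::
  "(real^'n::finite \<Rightarrow> real^'n^'n) \<Rightarrow> real^'n \<Rightarrow> 'n \<Rightarrow> 'n \<Rightarrow> 'n \<Rightarrow> 'n \<Rightarrow> real" where
  "weyl G x a b c d =
     (\<Sum>e\<in>UNIV. G x $ c $ e * riemann G x a b e d)
     - (G x $ a $ c * schouten G x $ b $ d - G x $ b $ c * schouten G x $ a $ d
        + G x $ b $ d * schouten G x $ a $ c - G x $ a $ d * schouten G x $ b $ c)"


section \<open>Local tractor calculus\<close>

text \<open>A tractor at a point, in the presence of a scale (which splits the tractor bundle and
  trivialises the density bundles) and of a chart.\<close>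

type_synonym 'n tractor = "real \<times> (real^'n) \<times> real"

fun tractor_h :: "real^'n::finite^'n \<Rightarrow> 'n tractor \<Rightarrow> 'n tractor \<Rightarrow> real" where
  "tractor_h m (\<sigma>, \<mu>, \<rho>) (\<sigma>', \<mu>', \<rho>') = \<mu> \<bullet> (matrix_inv m *v \<mu>') + \<sigma> * \<rho>' + \<rho> * \<sigma>'"

definition tconn ::
  "(real^'n::finite \<Rightarrow> real^'n^'n) \<Rightarrow> 'n \<Rightarrow> (real^'n \<Rightarrow> 'n tractor) \<Rightarrow> real^'n \<Rightarrow> 'n tractor" where
  "tconn G a V x = (case V x of (\<sigma>, \<mu>, \<rho>) \<Rightarrow> case pd a V x of (d\<sigma>, d\<mu>, d\<rho>) \<Rightarrow>
     (d\<sigma> - \<mu> $ a,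
      (\<chi> b. d\<mu> $ b - (\<Sum>e\<in>UNIV. christoffel G x e a b * \<mu> $ e)
            + G x $ a $ b * \<rho> + schouten G x $ a $ b * \<sigma>),
      d\<rho> - (\<Sum>b\<in>UNIV. schouten G x $ a $ b * (Ginv G x *v \<mu>) $ b)))"

text \<open>\<open>tconn2 G a b\<close> is \<open>\<nabla>\<^sub>a \<nabla>\<^sub>b\<close> on tractors, with \<open>\<nabla>\<close> coupled to the Levi-Civita
  connection.\<close>

definition tconn2 ::
  "(real^'n::finite \<Rightarrow> real^'n^'n) \<Rightarrow> 'n \<Rightarrow> 'n \<Rightarrow> (real^'n \<Rightarrow> 'n tractor) \<Rightarrow> real^'n \<Rightarrow> 'n tractor" where
  "tconn2 G a b V x =
     tconn G a (tconn G b V) x - (\<Sum>e\<in>UNIV. christoffel G x e a b *\<^sub>R tconn G e V x)"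

text \<open>\<open>tcurv G a b x w\<close> is \<open>\<Omega>\<^sub>a\<^sub>b w\<close> at \<open>x\<close>.  As \<open>\<Omega>\<close> is tensorial, the commutator may be
  evaluated on the local section with constant components \<open>w\<close>.\<close>

definition tcurv ::
  "(real^'n::finite \<Rightarrow> real^'n^'n) \<Rightarrow> 'n \<Rightarrow> 'n \<Rightarrow> real^'n \<Rightarrow> 'n tractor \<Rightarrow> 'n tractor" where
  "tcurv G a b x w = tconn2 G a b (\<lambda>_. w) x - tconn2 G b a (\<lambda>_. w) x"

definition tcurv_vec ::
  "(real^'n::finite \<Rightarrow> real^'n^'n) \<Rightarrow> real^'n \<Rightarrow> real^'n \<Rightarrow> real^'n \<Rightarrow> 'n tractor \<Rightarrow> 'n tractor" where
  "tcurv_vec G x u v w = (\<Sum>a\<in>UNIV. \<Sum>b\<in>UNIV. (u $ a * v $ b) *\<^sub>R tcurv G a b x w)"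

text \<open>\<open>dtcurv G e a b x w\<close> is \<open>(\<nabla>\<^sub>e \<Omega>\<^sub>a\<^sub>b) w\<close>: the Leibniz rule for the endomorphism
  \<open>\<Omega>\<^sub>a\<^sub>b\<close> on the section with constant components \<open>w\<close>, and Levi-Civita terms for \<open>a\<close> and
  \<open>b\<close>.\<close>

definition dtcurv ::
  "(real^'n::finite \<Rightarrow> real^'n^'n) \<Rightarrow> 'n \<Rightarrow> 'n \<Rightarrow> 'n \<Rightarrow> real^'n \<Rightarrow> 'n tractor \<Rightarrow> 'n tractor" where
  "dtcurv G e a b x w =
     tconn G e (\<lambda>y. tcurv G a b y w) x - tcurv G a b x (tconn G e (\<lambda>_. w) x)
     - (\<Sum>f\<in>UNIV. christoffel G x f e a *\<^sub>R tcurv G f b x w)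
     - (\<Sum>f\<in>UNIV. christoffel G x f e b *\<^sub>R tcurv G a f x w)"

definition yang_mills_at :: "(real^'n::finite \<Rightarrow> real^'n^'n) \<Rightarrow> real^'n \<Rightarrow> bool" where
  "yang_mills_at G x \<longleftrightarrow>
     (\<forall>b w. (\<Sum>e\<in>UNIV. \<Sum>a\<in>UNIV. Ginv G x $ e $ a *\<^sub>R dtcurv G e a b x w) = 0)"


section \<open>The standard tractor bundle and almost Einstein structures\<close>

text \<open>A section of the standard tractor bundle assigns to each \<open>g \<in> K\<close> a triple, and the triples
  of different metrics are related by the transformation law.  There, \<open>m\<close> runs over the bundle of
  metrics at \<open>p\<close>, and \<open>matrix_inv (m c)\<close> is the inverse conformal metric, trivialised by \<open>m\<close>.\<close>

type_synonym ('a, 'n) tractor_field =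
  "('a, 'n) metric \<Rightarrow> ('a, 'n) density \<times> ('a, 'n) codensity \<times> ('a, 'n) density"

definition tractor_section ::
  "'a topology \<Rightarrow> ('a, 'n::finite) chart set \<Rightarrow> ('a, 'n) metric set \<Rightarrow> ('a, 'n) tractor_field \<Rightarrow> bool" where
  "tractor_section X A K V \<longleftrightarrow>
     (\<forall>g\<in>K. case V g of (\<sigma>, \<mu>, \<rho>) \<Rightarrow>
        density_on A K (topspace X) 1 \<sigma> \<and> codensity_on A K (topspace X) 1 \<mu> \<and>
        density_on A K (topspace X) (-1) \<rho>) \<and>
     (\<forall>g\<in>K. \<forall>\<omega>. smooth_fun A (topspace X) \<omega> \<longrightarrow>
        (case V g of (\<sigma>, \<mu>, \<rho>) \<Rightarrow> case V (rescale \<omega> g) of (\<sigma>', \<mu>', \<rho>') \<Rightarrow>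
           \<forall>c\<in>A. \<forall>p\<in>fst c. \<forall>m\<in>{k p |k. k \<in> K}. let \<Upsilon> = differential c \<omega> p in
             \<sigma>' p m = \<sigma> p m \<and>
             \<mu>' p m c = \<mu> p m c + \<sigma> p m *\<^sub>R \<Upsilon> \<and>
             \<rho>' p m = \<rho> p m - \<Upsilon> \<bullet> (matrix_inv (m c) *v \<mu> p m c)
                       - (1/2) * \<sigma> p m * (\<Upsilon> \<bullet> (matrix_inv (m c) *v \<Upsilon>))))"

definition triv ::
  "('a, 'n::finite) tractor_field \<Rightarrow> ('a, 'n) metric \<Rightarrow> ('a, 'n) chart \<Rightarrow> 'a \<Rightarrow> 'n tractor" where
  "triv V g c p = (case V g of (\<sigma>, \<mu>, \<rho>) \<Rightarrow> (\<sigma> p (g p), \<mu> p (g p) c, \<rho> p (g p)))"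

definition parallel_tractor ::
  "('a, 'n::finite) chart set \<Rightarrow> ('a, 'n) metric set \<Rightarrow> ('a, 'n) tractor_field \<Rightarrow> bool" where
  "parallel_tractor A K V \<longleftrightarrow> (\<forall>g\<in>K. \<forall>c\<in>A. \<forall>x\<in>cim c. \<forall>a.
     tconn (local_rep g c) a (\<lambda>y. triv V g c (cinv c y)) x = 0)"

definition almost_einstein ::
  "'a topology \<Rightarrow> ('a, 'n::finite) chart set \<Rightarrow> ('a, 'n) metric set \<Rightarrow> ('a, 'n) tractor_field \<Rightarrow> bool" where
  "almost_einstein X A K I \<longleftrightarrow> tractor_section X A K I \<and> parallel_tractor A K I \<and>
     (\<exists>g\<in>K. \<exists>c\<in>A. \<exists>p\<in>fst c. triv I g c p \<noteq> 0)"

text \<open>\<open>(0, 0, 1)\<close> is the canonical section, so that the left-hand side is \<open>\<sigma> = h(X, I)\<close> in the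
  scale \<open>g\<close>.\<close>

definition scale_singularity_set ::
  "'a topology \<Rightarrow> ('a, 'n::finite) chart set \<Rightarrow> ('a, 'n) metric set \<Rightarrow> ('a, 'n) tractor_field \<Rightarrow> 'a set" where
  "scale_singularity_set X A K I = {p \<in> topspace X.
     \<forall>g\<in>K. \<forall>c\<in>A. p \<in> fst c \<longrightarrow> tractor_h (g p c) (0, 0, 1) (triv I g c p) = 0}"

definition scalar_negative ::
  "('a, 'n::finite) chart set \<Rightarrow> ('a, 'n) metric set \<Rightarrow> ('a, 'n) tractor_field \<Rightarrow> bool" where
  "scalar_negative A K I \<longleftrightarrow> (\<forall>g\<in>K. \<forall>c\<in>A. \<forall>p\<in>fst c.
     - tractor_h (g p c) (triv I g c p) (triv I g c p) < 0)"


section \<open>Hypersurfaces\<close>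

text \<open>The charts of \<open>S\<close> (with the subspace topology) whose inverse is a smooth immersion into
  the manifold.  If \<open>S\<close> is an embedded submanifold whose dimension is the number of elements of
  \<open>'m\<close>, this is its maximal atlas.\<close>

definition sub_atlas ::
  "'a topology \<Rightarrow> ('a, 'n::finite) chart set \<Rightarrow> 'a set \<Rightarrow> ('a, 'm::finite) chart set" where
  "sub_atlas X A S = {b. chart_on (subtopology X S) b \<and>
     (\<forall>c\<in>A. smooth_on (snd b ` (fst b \<inter> fst c)) (snd c \<circ> cinv b) \<and>
       (\<forall>p\<in>fst b \<inter> fst c. inj (\<lambda>u. jac b c p *v u)))}"

text \<open>The value does not depend on the choice of the chart \<open>c\<close>.\<close>

definition pullback_metric ::
  "('a, 'n::finite) chart set \<Rightarrow> ('a, 'm::finite) chart set \<Rightarrow> ('a, 'n) metric \<Rightarrow> ('a, 'm) metric" where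
  "pullback_metric A B g p b =
     (if b \<in> B \<and> p \<in> fst b then
        (let c = SOME c. c \<in> A \<and> p \<in> fst c in transpose (jac b c p) ** g p c ** jac b c p)
      else 0)"

text \<open>The conormal is extended smoothly to a neighbourhood of \<open>S\<close>, so that \<open>\<nabla>\<^sub>a n\<^sub>b\<close> in the mean
  curvature makes sense; only its values along \<open>S\<close> are constrained, and along \<open>S\<close> the mean
  curvature does not depend on the extension.  \<open>B\<close> is the atlas of \<open>S\<close>.\<close>

definition unit_conormal ::
  "'a topology \<Rightarrow> ('a, 'n::finite) chart set \<Rightarrow> ('a, 'n) metric set \<Rightarrow> 'a set
    \<Rightarrow> ('a, 'm::finite) chart set \<Rightarrow> ('a, 'n) codensity \<Rightarrow> bool" where
  "unit_conormal X A K S B n \<longleftrightarrow>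
     (\<exists>W. openin X W \<and> S \<subseteq> W \<and> codensity_on A K W 1 n) \<and>
     (\<forall>g\<in>K. \<forall>c\<in>A. \<forall>p\<in>fst c \<inter> S.
        n p (g p) c \<bullet> (matrix_inv (g p c) *v n p (g p) c) = 1 \<and>
        (\<forall>b\<in>B. p \<in> fst b \<longrightarrow> n p (g p) c v* jac b c p = 0))"

definition mean_curv_local ::
  "(real^'n::finite \<Rightarrow> real^'n^'n) \<Rightarrow> (real^'n \<Rightarrow> real^'n) \<Rightarrow> real^'n \<Rightarrow> real" where
  "mean_curv_local G \<nu> x =
     (let D\<nu> = (\<lambda>a b. pd a \<nu> x $ b - (\<Sum>e\<in>UNIV. christoffel G x e a b * \<nu> x $ e));
          up = Ginv G x *v \<nu> x
      in ((\<Sum>a\<in>UNIV. \<Sum>b\<in>UNIV. Ginv G x $ a $ b * D\<nu> a b)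
          - (\<Sum>a\<in>UNIV. \<Sum>b\<in>UNIV. up $ a * up $ b * D\<nu> a b)) / (real CARD('n) - 1))"

definition mean_curv ::
  "('a, 'n::finite) metric \<Rightarrow> ('a, 'n) codensity \<Rightarrow> ('a, 'n) chart \<Rightarrow> 'a \<Rightarrow> real" where
  "mean_curv g n c p =
     mean_curv_local (local_rep g c) (\<lambda>x. n (cinv c x) (g (cinv c x)) c) (snd c p)"

definition normal_tractor ::
  "('a, 'n::finite) metric \<Rightarrow> ('a, 'n) codensity \<Rightarrow> ('a, 'n) chart \<Rightarrow> 'a \<Rightarrow> 'n tractor" where
  "normal_tractor g n c p = (0, n p (g p) c, - mean_curv g n c p)"

definition normal_perp ::
  "('a, 'n::finite) metric \<Rightarrow> ('a, 'n) codensity \<Rightarrow> ('a, 'n) chart \<Rightarrow> 'a \<Rightarrow> 'n tractor set" where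
  "normal_perp g n c p = {V. tractor_h (g p c) (normal_tractor g n c p) V = 0}"

text \<open>The identification of the orthogonal complement of the normal tractor with the intrinsic
  tractors, in the scales \<open>g\<close> and \<open>pullback_metric A B g\<close>; multiplication by the Jacobian restricts
  covectors to the hypersurface.\<close>

fun to_intrinsic ::
  "('a, 'n::finite) metric \<Rightarrow> ('a, 'n) codensity \<Rightarrow> ('a, 'n) chart \<Rightarrow> ('a, 'm::finite) chart \<Rightarrow> 'a
    \<Rightarrow> 'n tractor \<Rightarrow> 'm tractor" where
  "to_intrinsic g n c b p (\<sigma>, \<mu>, \<rho>) =
     (let H = mean_curv g n c p in
      (\<sigma>, (\<mu> - (H * \<sigma>) *\<^sub>R n p (g p) c) v* jac b c p, \<rho> + (1/2) * H\<^sup>2 * \<sigma>))"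

text \<open>An endomorphism of the intrinsic tractors at \<open>p\<close>, transported to the orthogonal complement
  of the normal tractor \<open>N\<close> and extended by zero on \<open>N\<close>.\<close>

definition extend_by_zero ::
  "('a, 'n::finite) metric \<Rightarrow> ('a, 'n) codensity \<Rightarrow> ('a, 'n) chart \<Rightarrow> ('a, 'm::finite) chart \<Rightarrow> 'a
    \<Rightarrow> ('m tractor \<Rightarrow> 'm tractor) \<Rightarrow> 'n tractor \<Rightarrow> 'n tractor" where
  "extend_by_zero g n c b p E V =
     (let N = normal_tractor g n c p in
      inv_into (normal_perp g n c p) (to_intrinsic g n c b p)
        (E (to_intrinsic g n c b p (V - tractor_h (g p c) N V *\<^sub>R N))))"

end

theory Submission
  imports Defs
begin

text \<open>
  The tractor curvature \<open>\<Omega>\<close> satisfies the Bianchi identity, is skew for the tractor metric and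
  annihilates the canonical section \<open>X\<close>; differentiating \<open>\<Omega> X = 0\<close> and the trace-freeness of its
  middle slot shows that in dimension four \<open>\<nabla>\<^sup>a \<Omega>\<^sub>a\<^sub>b\<close> annihilates \<open>X\<close> and has vanishing middle slot.
  It also annihilates the parallel section \<open>I\<close>, and where \<open>\<sigma> \<noteq> 0\<close> these facts leave only the zero
  endomorphism.  As \<open>I\<close> vanishes nowhere, the points with \<open>\<sigma> \<noteq> 0\<close> are dense.

  Where \<open>\<sigma> = 0\<close>, \<open>\<Omega> I = 0\<close> says that the Weyl tensor annihilates a non-null vector, so in dimension
  four it is zero.  Along \<open>\<Sigma>\<close> the normal tractor \<open>N\<close> is a constant multiple of \<open>I\<close>, hence parallel,
  and the identification of \<open>N\<^sup>\<bottom>\<close> with the intrinsic tractors carries the restricted tractor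
  connection to one of the same form as the intrinsic tractor connection, with some tensor \<open>Q\<close> in place
  of the Schouten tensor.  Because the Weyl tensor vanishes, so does the middle slot of its curvature,
  and the trace of that equation says that \<open>Q\<close> is the intrinsic Schouten tensor.
\<close>

section \<open>Calculus of smooth maps\<close>

text \<open>In a chart and a scale the tractor bundle is trivial, so the analysis takes place with
  connection forms on open subsets of Euclidean space. The Weyl and Cotton tensors are not extracted
  from the Riemann tensor by hand: they are the Z-Z and Y-Z blocks of \<Omega> for the splitting by
  X, Z and Y, and their symmetries are those of \<Omega>. Dimension four enters the Yang-Mills part
  as the trace of the metric: in dimension n the Z-Z block of the divergence is (4 - n) times the
  Cotton tensor. Along \<Sigma> the obstacle is that the intrinsic Schouten tensor contains second
  derivatives of the induced metric and cannot be read off from ambient data directly. Hence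
  connection forms carry an arbitrary tensor \<open>P\<close> in the Schouten slot, and a single
  trace formula, \<open>curv_trace\<close>, both makes the ambient curvature trace-free and
  recognises the intrinsic Schouten tensor. Likewise the last slot of the normal tractor is first an
  unspecified function \<open>H\<close>, supplied by the parallel tractor, and only later recognised
  as the mean curvature.\<close>

lemma pd_eq: "(f has_derivative f') (at x) \<Longrightarrow> pd i f x = f' (axis i 1)"
  unfolding pd_def using frechet_derivative_at by metis

lemma pd_cong:
  assumes "open D" "x \<in> D" "\<And>y. y \<in> D \<Longrightarrow> f y = g y"
  shows "pd i f x = pd i g x"
proof -
  have "(f has_derivative f') (at x) \<longleftrightarrow> (g has_derivative f') (at x)" for f'
    using assms has_derivative_transform_within_open[of f f' x UNIV D g]
      has_derivative_transform_within_open[of g f' x UNIV D f] by auto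
  then show ?thesis by (simp add: pd_def frechet_derivative_def)
qed

lemma has_derivative_pd:
  fixes f :: "real^'n::finite \<Rightarrow> 'b::real_normed_vector"
  assumes "f differentiable (at x)"
  shows "(f has_derivative (\<lambda>v. \<Sum>i\<in>UNIV. (v $ i) *\<^sub>R pd i f x)) (at x)"
proof -
  obtain f' where f': "(f has_derivative f') (at x)"
    using assms by (auto simp: differentiable_def)
  then have l: "linear f'" by (rule has_derivative_linear)
  have "f' v = (\<Sum>i\<in>UNIV. (v $ i) *\<^sub>R pd i f x)" for v
  proof -
    have "f' v = f' (\<Sum>i\<in>UNIV. (v $ i) *\<^sub>R axis i 1)"
      using basis_expansion[of v] by (simp add: scalar_mult_eq_scaleR)
    also have "\<dots> = (\<Sum>i\<in>UNIV. (v $ i) *\<^sub>R pd i f x)"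
      by (simp add: linear_sum[OF l] linear_cmul[OF l] pd_eq[OF f'])
    finally show ?thesis .
  qed
  then show ?thesis using f' by (metis (no_types, lifting) ext)
qed

lemma pd_const [simp]: "pd i (\<lambda>x. c) x = 0"
  using pd_eq[OF has_derivative_const] .

lemma pd_linear:
  assumes "bounded_linear L" "f differentiable (at x)"
  shows "pd i (\<lambda>x. L (f x)) x = L (pd i f x)"
proof -
  obtain f' where f': "(f has_derivative f') (at x)"
    using assms by (auto simp: differentiable_def)
  show ?thesis
    using pd_eq[OF f'] pd_eq[OF bounded_linear.has_derivative[OF assms(1) f']] by simp
qed

lemma pd_bilinear:
  assumes "bounded_bilinear pr" "f differentiable (at x)" "g differentiable (at x)"
  shows "pd i (\<lambda>x. pr (f x) (g x)) x = pr (f x) (pd i g x) + pr (pd i f x) (g x)"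
proof -
  obtain f' g' where f': "(f has_derivative f') (at x)" and g': "(g has_derivative g') (at x)"
    using assms by (auto simp: differentiable_def)
  show ?thesis
    using pd_eq[OF f'] pd_eq[OF g'] pd_eq[OF bounded_bilinear.FDERIV[OF assms(1) f' g']] by simp
qed

lemma pd_add:
  assumes "f differentiable (at x)" "g differentiable (at x)"
  shows "pd i (\<lambda>x. f x + g x) x = pd i f x + pd i g x"
proof -
  obtain f' g' where f': "(f has_derivative f') (at x)" and g': "(g has_derivative g') (at x)"
    using assms by (auto simp: differentiable_def)
  show ?thesis
    using pd_eq[OF f'] pd_eq[OF g'] pd_eq[OF has_derivative_add[OF f' g']] by simp
qed

lemma pd_minus:
  assumes "f differentiable (at x)"
  shows "pd i (\<lambda>x. - f x) x = - pd i f x"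
  using pd_linear[OF _ assms, of uminus] by (simp add: bounded_linear_minus bounded_linear_ident)

lemma pd_diff:
  assumes "f differentiable (at x)" "g differentiable (at x)"
  shows "pd i (\<lambda>x. f x - g x) x = pd i f x - pd i g x"
proof -
  have "(\<lambda>x. - g x) differentiable (at x)" using assms by simp
  then show ?thesis
    using pd_add[OF assms(1), of "\<lambda>x. - g x"] pd_minus[OF assms(2)] by simp
qed

lemma pd_sum:
  assumes "finite S" "\<And>s. s \<in> S \<Longrightarrow> f s differentiable (at x)"
  shows "pd i (\<lambda>x. \<Sum>s\<in>S. f s x) x = (\<Sum>s\<in>S. pd i (f s) x)"
  using assms
proof (induction S)
  case (insert s S)
  have "(\<lambda>x. \<Sum>s\<in>S. f s x) differentiable (at x)"
    using insert by (intro differentiable_sum) auto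
  then show ?case using insert by (simp add: pd_add)
qed simp

lemma pd_compose:
  fixes f :: "real^'n::finite \<Rightarrow> 'b::real_normed_vector" and h :: "real^'m::finite \<Rightarrow> real^'n"
  assumes "h differentiable (at y)" "f differentiable (at (h y))"
  shows "pd i (\<lambda>y. f (h y)) y = (\<Sum>a\<in>UNIV. (pd i h y $ a) *\<^sub>R pd a f (h y))"
proof -
  have "(\<Sum>j\<in>UNIV. (axis i 1 $ j) *\<^sub>R pd j h y) = pd i h y"
    using pd_eq[OF has_derivative_pd[OF assms(1)], of i] by metis
  then show ?thesis
    by (subst pd_eq[OF has_derivative_compose[OF has_derivative_pd[OF assms(1)] has_derivative_pd[OF assms(2)]]])
      simp
qed

lemma differentiable_linear_image:
  "bounded_linear L \<Longrightarrow> f differentiable (at x) \<Longrightarrow> (\<lambda>x. L (f x)) differentiable (at x)"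
  unfolding differentiable_def by (blast intro: bounded_linear.has_derivative)

lemma differentiable_bilinear:
  "bounded_bilinear pr \<Longrightarrow> f differentiable (at x) \<Longrightarrow> g differentiable (at x)
    \<Longrightarrow> (\<lambda>x. pr (f x) (g x)) differentiable (at x)"
  unfolding differentiable_def by (blast intro: bounded_bilinear.FDERIV)

lemma differentiable_exp:
  fixes f :: "'a::real_normed_vector \<Rightarrow> real"
  shows "f differentiable (at x) \<Longrightarrow> (\<lambda>x. exp (f x)) differentiable (at x)"
  unfolding differentiable_def by (blast intro: has_derivative_exp)

lemma differentiable_compose_at:
  "h differentiable (at y) \<Longrightarrow> f differentiable (at (h y)) \<Longrightarrow> (\<lambda>y. f (h y)) differentiable (at y)"
  unfolding differentiable_def by (blast intro: has_derivative_compose)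

text \<open>The finite order version carries the inductions that prove closure properties.\<close>

primrec ck :: "nat \<Rightarrow> (real^'n::finite) set \<Rightarrow> (real^'n \<Rightarrow> 'b::real_normed_vector) \<Rightarrow> bool" where
  "ck 0 D f \<longleftrightarrow> f differentiable_on D"
| "ck (Suc k) D f \<longleftrightarrow> f differentiable_on D \<and> (\<forall>i. ck k D (pd i f))"

lemma iter_pd_snoc: "iter_pd (js @ [i]) f = iter_pd js (pd i f)"
  by (induction js) auto

lemma ck_iff: "ck k D f \<longleftrightarrow> (\<forall>js. length js \<le> k \<longrightarrow> iter_pd js f differentiable_on D)"
proof (induction k arbitrary: f)
  case (Suc k)
  show ?case
  proof
    assume f: "ck (Suc k) D f"
    show "\<forall>js. length js \<le> Suc k \<longrightarrow> iter_pd js f differentiable_on D"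
    proof (intro allI impI)
      fix js :: "'a list" assume "length js \<le> Suc k"
      then show "iter_pd js f differentiable_on D"
        using f Suc by (cases js rule: rev_cases) (auto simp: iter_pd_snoc)
    qed
  next
    assume R: "\<forall>js. length js \<le> Suc k \<longrightarrow> iter_pd js f differentiable_on D"
    have "iter_pd js (pd i f) differentiable_on D" if "length js \<le> k" for i js
      using R[rule_format, of "js @ [i]"] that by (simp add: iter_pd_snoc)
    then show "ck (Suc k) D f" using Suc R[rule_format, of "[]"] by auto
  qed
qed simp

lemma smooth_on_ck: "smooth_on D f \<longleftrightarrow> (\<forall>k. ck k D f)"
  unfolding smooth_on_def ck_iff by auto

lemma ck_le: "ck k D f \<Longrightarrow> l \<le> k \<Longrightarrow> ck l D f"
  by (auto simp: ck_iff)

lemma ck_differentiable: "ck k D f \<Longrightarrow> open D \<Longrightarrow> x \<in> D \<Longrightarrow> f differentiable (at x)"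
  using ck_le[of k D f 0] by (simp add: differentiable_on_eq_differentiable_at)

lemma differentiable_on_cong_open:
  assumes "open D" "\<And>y. y \<in> D \<Longrightarrow> f y = g y" "f differentiable_on D"
  shows "g differentiable_on D"
  by (metis assms differentiable_on_def differentiable_transform_within zero_less_one)

text \<open>The product and chain rules hold only on \<open>D\<close>. The inductions below compute
  a derivative by such a rule and transfer the regularity of the resulting formula back through this
  lemma.\<close>

lemma ck_cong:
  assumes "open D" "\<And>y. y \<in> D \<Longrightarrow> f y = g y" "ck k D f"
  shows "ck k D g"
  using assms(2,3)
proof (induction k arbitrary: f g)
  case 0
  then show ?case using differentiable_on_cong_open[OF assms(1)] by auto
next
  case (Suc k)
  have "pd i f y = pd i g y" if "y \<in> D" for i y
    using pd_cong[OF assms(1) that Suc.prems(1)] .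
  then show ?case
    using Suc.prems differentiable_on_cong_open[OF assms(1) Suc.prems(1)] Suc.IH[of "pd i f" "pd i g" for i]
    by auto
qed

lemma smooth_on_cong:
  "open D \<Longrightarrow> (\<And>y. y \<in> D \<Longrightarrow> f y = g y) \<Longrightarrow> smooth_on D f \<Longrightarrow> smooth_on D g"
  using ck_cong unfolding smooth_on_ck by blast

lemma smooth_on_differentiable: "smooth_on D f \<Longrightarrow> open D \<Longrightarrow> x \<in> D \<Longrightarrow> f differentiable (at x)"
  using ck_differentiable unfolding smooth_on_ck by blast

lemma smooth_on_continuous_on: "smooth_on D f \<Longrightarrow> continuous_on D f"
  unfolding smooth_on_ck using ck.simps(1) differentiable_imp_continuous_on by blast

lemma smooth_on_pd: "smooth_on D f \<Longrightarrow> smooth_on D (pd i f)"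
  unfolding smooth_on_ck by (meson ck.simps(2))

lemma ck_const: "ck k D (\<lambda>x. c)"
proof (induction k arbitrary: c)
  case (Suc k)
  have "pd i (\<lambda>x. c) = (\<lambda>x. 0)" for i :: 'a by (rule ext) simp
  then show ?case using Suc by simp
qed simp

lemma ck_linear:
  assumes "open D" "bounded_linear L" "ck k D f"
  shows "ck k D (\<lambda>x. L (f x))"
  using assms(3)
proof (induction k arbitrary: f)
  case 0
  then show ?case
    using assms by (auto simp: differentiable_on_eq_differentiable_at
        intro: differentiable_linear_image[OF assms(2)])
next
  case (Suc k)
  have d: "(\<lambda>x. L (f x)) differentiable_on D"
    using Suc.prems assms by (auto simp: differentiable_on_eq_differentiable_at
        intro: differentiable_linear_image[OF assms(2)])
  have "ck k D (pd i (\<lambda>x. L (f x)))" for i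
    by (rule ck_cong[OF assms(1) _ Suc.IH[of "pd i f"]])
      (use Suc.prems assms in \<open>auto intro!: pd_linear[symmetric] simp: differentiable_on_eq_differentiable_at\<close>)
  then show ?case using d by simp
qed

lemma ck_add:
  assumes "open D" "ck k D f" "ck k D g"
  shows "ck k D (\<lambda>x. f x + g x)"
  using assms(2,3)
proof (induction k arbitrary: f g)
  case 0
  then show ?case by simp
next
  case (Suc k)
  have "ck k D (pd i (\<lambda>x. f x + g x))" for i
    by (rule ck_cong[OF assms(1) _ Suc.IH[of "pd i f" "pd i g"]])
      (use Suc.prems assms in \<open>auto intro!: pd_add[symmetric] simp: differentiable_on_eq_differentiable_at\<close>)
  then show ?case using Suc.prems by simp
qed

lemma bilinear_differentiable_on:
  assumes "open D" "bounded_bilinear pr" "f differentiable_on D" "g differentiable_on D"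
  shows "(\<lambda>x. pr (f x) (g x)) differentiable_on D"
  using assms by (auto simp: differentiable_on_eq_differentiable_at intro: differentiable_bilinear[OF assms(2)])

lemma ck_bilinear:
  assumes "open D" "bounded_bilinear pr" "ck k D f" "ck k D g"
  shows "ck k D (\<lambda>x. pr (f x) (g x))"
  using assms(3,4)
proof (induction k arbitrary: f g)
  case 0
  then show ?case using bilinear_differentiable_on[OF assms(1,2)] by simp
next
  case (Suc k)
  have "ck k D (pd i (\<lambda>x. pr (f x) (g x)))" for i
  proof (rule ck_cong[OF assms(1)])
    show "pr (f y) (pd i g y) + pr (pd i f y) (g y) = pd i (\<lambda>x. pr (f x) (g x)) y" if "y \<in> D" for y
      using Suc.prems that pd_bilinear[OF assms(2), of f y g i] assms(1)
      by (auto simp: differentiable_on_eq_differentiable_at)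
    show "ck k D (\<lambda>y. pr (f y) (pd i g y) + pr (pd i f y) (g y))"
      using Suc.prems ck_le[of "Suc k" D f k] ck_le[of "Suc k" D g k]
      by (intro ck_add assms(1) Suc.IH) auto
  qed
  then show ?case using Suc.prems bilinear_differentiable_on[OF assms(1,2)] by simp
qed

text \<open>The derivative of the inverse is a product of the inverse itself, twice, with
  \<open>pd i f\<close>, so order k of the inverse yields order k + 1.\<close>

lemma ck_inverse:
  fixes f :: "real^'n::finite \<Rightarrow> real"
  assumes "open D" "ck k D f" "\<And>x. x \<in> D \<Longrightarrow> f x \<noteq> 0"
  shows "ck k D (\<lambda>x. inverse (f x))"
  using assms(2)
proof (induction k)
  case 0
  then show ?case using assms(1,3) by (auto simp: differentiable_on_eq_differentiable_at)
next
  case (Suc k)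
  have d: "(\<lambda>x. inverse (f x)) differentiable_on D"
    using Suc.prems assms(1,3) by (auto simp: differentiable_on_eq_differentiable_at)
  have IH: "ck k D (\<lambda>x. inverse (f x))" using Suc ck_le[of "Suc k" D f k] by auto
  have "ck k D (pd i (\<lambda>x. inverse (f x)))" for i
  proof (rule ck_cong[OF assms(1)])
    show "(- inverse (f y)) * (pd i f y * inverse (f y)) = pd i (\<lambda>x. inverse (f x)) y" if "y \<in> D" for y
    proof -
      have "f differentiable (at y)"
        using ck_differentiable[OF Suc.prems assms(1) that] .
      then obtain f' where f': "(f has_derivative f') (at y)"
        unfolding differentiable_def by blast
      show ?thesis
        using pd_eq[OF f', of i] pd_eq[OF Deriv.has_derivative_inverse[OF assms(3)[OF that] f'], of i]
        by simp
    qed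
    show "ck k D (\<lambda>y. (- inverse (f y)) * (pd i f y * inverse (f y)))"
      using Suc.prems IH
      by (intro ck_bilinear[OF assms(1) bounded_bilinear_mult] ck_linear[OF assms(1), of uminus])
        (auto simp: bounded_linear_minus bounded_linear_ident)
  qed
  then show ?case using d by simp
qed

lemma ck_exp:
  fixes f :: "real^'n::finite \<Rightarrow> real"
  assumes "open D" "ck k D f"
  shows "ck k D (\<lambda>x. exp (f x))"
  using assms(2)
proof (induction k)
  case 0
  then show ?case using assms(1)
    by (auto simp: differentiable_on_eq_differentiable_at intro: differentiable_exp)
next
  case (Suc k)
  have d: "(\<lambda>x. exp (f x)) differentiable_on D"
    using Suc.prems assms(1)
    by (auto simp: differentiable_on_eq_differentiable_at intro: differentiable_exp)
  have IH: "ck k D (\<lambda>x. exp (f x))" using Suc ck_le[of "Suc k" D f k] by auto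
  have "ck k D (pd i (\<lambda>x. exp (f x)))" for i
  proof (rule ck_cong[OF assms(1)])
    show "pd i f y * exp (f y) = pd i (\<lambda>x. exp (f x)) y" if "y \<in> D" for y
    proof -
      have "f differentiable (at y)"
        using ck_differentiable[OF Suc.prems assms(1) that] .
      then obtain f' where f': "(f has_derivative f') (at y)"
        unfolding differentiable_def by blast
      show ?thesis
        using pd_eq[OF f', of i] pd_eq[OF has_derivative_exp[OF f'], of i] by simp
    qed
    show "ck k D (\<lambda>y. pd i f y * exp (f y))"
      using Suc.prems IH by (intro ck_bilinear[OF assms(1) bounded_bilinear_mult]) auto
  qed
  then show ?case using d by simp
qed

section \<open>Closure properties of smooth maps\<close>

lemma smooth_const: "smooth_on D (\<lambda>x. c)"
  by (simp add: smooth_on_ck ck_const)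

lemma smooth_linear: "open D \<Longrightarrow> bounded_linear L \<Longrightarrow> smooth_on D f \<Longrightarrow> smooth_on D (\<lambda>x. L (f x))"
  by (simp add: smooth_on_ck ck_linear)

lemma smooth_bilinear:
  "open D \<Longrightarrow> bounded_bilinear pr \<Longrightarrow> smooth_on D f \<Longrightarrow> smooth_on D g \<Longrightarrow> smooth_on D (\<lambda>x. pr (f x) (g x))"
  by (simp add: smooth_on_ck ck_bilinear)

lemma smooth_add: "open D \<Longrightarrow> smooth_on D f \<Longrightarrow> smooth_on D g \<Longrightarrow> smooth_on D (\<lambda>x. f x + g x)"
  by (simp add: smooth_on_ck ck_add)

lemma smooth_minus: "open D \<Longrightarrow> smooth_on D f \<Longrightarrow> smooth_on D (\<lambda>x. - f x)"
  by (rule smooth_linear) (simp_all add: bounded_linear_minus bounded_linear_ident)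

lemma smooth_diff: "open D \<Longrightarrow> smooth_on D f \<Longrightarrow> smooth_on D g \<Longrightarrow> smooth_on D (\<lambda>x. f x - g x)"
  using smooth_add[OF _ _ smooth_minus, of D f g] by simp

lemma smooth_sum:
  "open D \<Longrightarrow> (\<And>s. s \<in> S \<Longrightarrow> smooth_on D (f s)) \<Longrightarrow> smooth_on D (\<lambda>x. \<Sum>s\<in>S. f s x)"
  by (induction S rule: infinite_finite_induct) (auto intro: smooth_const smooth_add)

lemmas smooth_scaleR = smooth_bilinear[OF _ bounded_bilinear_scaleR]
lemmas smooth_mult = smooth_bilinear[OF _ bounded_bilinear_mult]
lemmas smooth_inner = smooth_bilinear[OF _ bounded_bilinear_inner]

lemma smooth_prod:
  fixes f :: "'s \<Rightarrow> real^'n::finite \<Rightarrow> real"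
  shows "open D \<Longrightarrow> (\<And>s. s \<in> S \<Longrightarrow> smooth_on D (f s)) \<Longrightarrow> smooth_on D (\<lambda>x. \<Prod>s\<in>S. f s x)"
  by (induction S rule: infinite_finite_induct) (auto intro: smooth_const smooth_mult)

lemma smooth_power:
  fixes f :: "real^'n::finite \<Rightarrow> real"
  shows "open D \<Longrightarrow> smooth_on D f \<Longrightarrow> smooth_on D (\<lambda>x. f x ^ k)"
  by (induction k) (auto intro: smooth_const smooth_mult)

lemma smooth_inverse:
  fixes f :: "real^'n::finite \<Rightarrow> real"
  shows "open D \<Longrightarrow> smooth_on D f \<Longrightarrow> (\<And>x. x \<in> D \<Longrightarrow> f x \<noteq> 0) \<Longrightarrow> smooth_on D (\<lambda>x. inverse (f x))"
  by (simp add: smooth_on_ck ck_inverse)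

lemma smooth_divide:
  fixes f :: "real^'n::finite \<Rightarrow> real"
  shows "open D \<Longrightarrow> smooth_on D f \<Longrightarrow> smooth_on D g \<Longrightarrow> (\<And>x. x \<in> D \<Longrightarrow> g x \<noteq> 0)
    \<Longrightarrow> smooth_on D (\<lambda>x. f x / g x)"
  unfolding divide_inverse by (intro smooth_mult smooth_inverse)

lemma smooth_exp:
  fixes f :: "real^'n::finite \<Rightarrow> real"
  shows "open D \<Longrightarrow> smooth_on D f \<Longrightarrow> smooth_on D (\<lambda>x. exp (f x))"
  by (simp add: smooth_on_ck ck_exp)

lemma smooth_vec_nth: "open D \<Longrightarrow> smooth_on D f \<Longrightarrow> smooth_on D (\<lambda>x. f x $ i)"
  by (rule smooth_linear[OF _ bounded_linear_vec_nth])

lemma smooth_fst: "open D \<Longrightarrow> smooth_on D f \<Longrightarrow> smooth_on D (\<lambda>x. fst (f x))"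
  by (rule smooth_linear[OF _ bounded_linear_fst])

lemma smooth_snd: "open D \<Longrightarrow> smooth_on D f \<Longrightarrow> smooth_on D (\<lambda>x. snd (f x))"
  by (rule smooth_linear[OF _ bounded_linear_snd])

lemma smooth_Pair:
  assumes "open D" "smooth_on D f" "smooth_on D g"
  shows "smooth_on D (\<lambda>x. (f x, g x))"
proof -
  have "smooth_on D (\<lambda>x. (f x, 0))" "smooth_on D (\<lambda>x. (0, g x))"
    using assms bounded_linear_Pair[OF bounded_linear_ident bounded_linear_zero]
      bounded_linear_Pair[OF bounded_linear_zero bounded_linear_ident]
    by (auto intro: smooth_linear[of D "\<lambda>u. (u, 0)"] smooth_linear[of D "\<lambda>u. (0, u)"])
  from smooth_add[OF assms(1) this] show ?thesis by simp
qed

lemma bounded_linear_axis: "bounded_linear (\<lambda>u::'b::real_normed_vector. axis i u :: 'b^'n::finite)"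
proof (rule bounded_linear_intro[where K=1])
  show "norm (axis i u) \<le> norm u * 1" for u :: 'b
    by (simp add: norm_vec_def L2_set_def axis_def if_distrib[of norm] if_distrib[of "\<lambda>x. x\<^sup>2"] cong: if_cong)
qed (auto simp: vec_eq_iff axis_def)

lemma smooth_vec_lambda:
  fixes f :: "'m::finite \<Rightarrow> real^'n::finite \<Rightarrow> 'b::real_normed_vector"
  assumes "open D" "\<And>i. smooth_on D (f i)"
  shows "smooth_on D (\<lambda>x. \<chi> i. f i x)"
proof -
  have eq: "(\<chi> i. f i x) = (\<Sum>i\<in>UNIV. axis i (f i x))" for x
    by (simp add: vec_eq_iff axis_def)
  show ?thesis
    unfolding eq by (intro smooth_sum assms smooth_linear[OF _ bounded_linear_axis])
qed

text \<open>In the chain rule the factors coming from \<open>h\<close> are smooth of every order, so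
  the induction needs to run over \<open>f\<close> alone, replaced by its partial
  derivatives.\<close>

lemma smooth_compose:
  fixes f :: "real^'n::finite \<Rightarrow> 'b::real_normed_vector" and h :: "real^'m::finite \<Rightarrow> real^'n"
  assumes "open D" "open E" "smooth_on D f" "smooth_on E h" "h ` E \<subseteq> D"
  shows "smooth_on E (\<lambda>y. f (h y))"
proof -
  have d: "(\<lambda>y. f (h y)) differentiable_on E" if f: "smooth_on D f" for f :: "real^'n \<Rightarrow> 'b"
    unfolding differentiable_on_eq_differentiable_at[OF assms(2)]
  proof
    fix y assume y: "y \<in> E"
    then have "h y \<in> D" using assms(5) by auto
    then show "(\<lambda>y. f (h y)) differentiable (at y)"
      using smooth_on_differentiable[OF f assms(1)] smooth_on_differentiable[OF assms(4,2) y]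
      by (auto intro: differentiable_compose_at)
  qed
  have "ck k E (\<lambda>y. f (h y))" for k
    using assms(3)
  proof (induction k arbitrary: f)
    case 0
    then show ?case using d by simp
  next
    case (Suc k)
    have "ck k E (pd i (\<lambda>y. f (h y)))" for i
    proof (rule ck_cong[OF assms(2)])
      show "(\<Sum>a\<in>UNIV. (pd i h y $ a) *\<^sub>R pd a f (h y)) = pd i (\<lambda>y. f (h y)) y" if "y \<in> E" for y
        using that assms by (intro pd_compose[symmetric] smooth_on_differentiable[OF Suc.prems assms(1)]
            smooth_on_differentiable[OF assms(4,2)]) auto
      have "ck k E (\<lambda>y. pd i h y $ a)" for a
        using smooth_vec_nth[OF assms(2) smooth_on_pd[OF assms(4)]] by (simp add: smooth_on_ck)
      moreover have "ck k E (\<lambda>y. \<Sum>a\<in>S. (pd i h y $ a) *\<^sub>R pd a f (h y))" if "finite S" for S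
        using that
      proof induction
        case (insert a S)
        then show ?case using calculation Suc.IH[OF smooth_on_pd[OF Suc.prems]]
          by (auto intro!: ck_add assms ck_bilinear[OF assms(2) bounded_bilinear_scaleR])
      qed (simp add: ck_const)
      ultimately show "ck k E (\<lambda>y. \<Sum>a\<in>UNIV. (pd i h y $ a) *\<^sub>R pd a f (h y))" by simp
    qed
    then show ?case using d[OF Suc.prems] by simp
  qed
  then show ?thesis by (simp add: smooth_on_ck)
qed

lemma smooth_matrix_vector_mult:
  fixes M :: "real^'k::finite \<Rightarrow> real^'n::finite^'m::finite"
  assumes "open D" "smooth_on D M" "smooth_on D v"
  shows "smooth_on D (\<lambda>x. M x *v v x)"
  unfolding matrix_vector_mult_def
  using assms by (intro smooth_vec_lambda smooth_sum smooth_mult smooth_vec_nth) auto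

lemma smooth_det:
  fixes M :: "real^'k::finite \<Rightarrow> real^'n::finite^'n"
  assumes "open D" "smooth_on D M"
  shows "smooth_on D (\<lambda>x. det (M x))"
  unfolding det_def
  using assms by (intro smooth_sum smooth_mult[OF assms(1)] smooth_prod smooth_vec_nth smooth_const)

lemma matrix_inv:
  fixes M :: "real^'n::finite^'n"
  assumes "invertible M"
  shows "M ** matrix_inv M = mat 1" "matrix_inv M ** M = mat 1"
  using someI_ex[OF assms[unfolded invertible_def]] by (simp_all add: matrix_inv_def)

text \<open>By Cramer's rule the entries of the inverse are quotients of determinants, which are
  polynomial in the entries of the matrix.\<close>

lemma smooth_matrix_inv:
  fixes M :: "real^'k::finite \<Rightarrow> real^'n::finite^'n"
  assumes D: "open D" and M: "smooth_on D M" and inv: "\<And>x. x \<in> D \<Longrightarrow> invertible (M x)"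
  shows "smooth_on D (\<lambda>x. matrix_inv (M x))"
proof -
  define C where "C x = (\<chi> k j. det (\<chi> i l. if l = k then axis j 1 $ i else M x $ i $ l) / det (M x))" for x
  have "matrix_inv (M x) = C x" if "x \<in> D" for x
  proof -
    have "M x ** matrix_inv (M x) = mat 1"
      using matrix_inv inv[OF that] by blast
    then have "M x *v (matrix_inv (M x) *v axis j 1) = axis j 1" for j
      by (simp add: matrix_vector_mul_assoc)
    then have "matrix_inv (M x) *v axis j 1 = (\<chi> k. C x $ k $ j)" for j
      using cramer[of "M x"] inv[OF that] by (simp add: C_def invertible_det_nz)
    moreover have "(matrix_inv (M x) *v axis j 1) $ k = matrix_inv (M x) $ k $ j" for j k
      by (simp add: matrix_vector_mult_basis column_def)
    ultimately have "matrix_inv (M x) $ k $ j = C x $ k $ j" for j k by (metis vec_lambda_beta)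
    then show ?thesis by (simp add: vec_eq_iff)
  qed
  moreover have "smooth_on D C"
    unfolding C_def
  proof (intro smooth_vec_lambda smooth_divide smooth_det D M)
    show "smooth_on D (\<lambda>x. if l = k then axis j 1 $ i else M x $ i $ l)" for i j k and l :: 'n
      by (cases "l = k") (use D M in \<open>auto intro: smooth_const smooth_vec_nth\<close>)
  qed (use inv in \<open>auto simp: invertible_det_nz\<close>)
  ultimately show ?thesis using smooth_on_cong[OF D, of C] by auto
qed

section \<open>Symmetry of second partial derivatives\<close>

lemma DERIV_along_axis:
  fixes f :: "real^'n::finite \<Rightarrow> real"
  assumes "f differentiable (at (w + s *\<^sub>R axis i 1))"
  shows "((\<lambda>s. f (w + s *\<^sub>R axis i 1)) has_real_derivative pd i f (w + s *\<^sub>R axis i 1)) (at s)"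
proof -
  obtain f' where f': "(f has_derivative f') (at (w + s *\<^sub>R axis i 1))"
    using assms by (auto simp: differentiable_def)
  have l: "linear f'" using f' by (rule has_derivative_linear)
  have "((\<lambda>s. w + s *\<^sub>R axis i 1) has_derivative (\<lambda>h. h *\<^sub>R axis i (1::real))) (at s)"
    by (auto intro!: derivative_eq_intros)
  from has_derivative_compose[OF this f']
  have "((\<lambda>s. f (w + s *\<^sub>R axis i 1)) has_derivative (\<lambda>h. h * f' (axis i 1))) (at s)"
    by (simp add: linear_cmul[OF l])
  then show ?thesis
    by (simp add: has_field_derivative_def pd_eq[OF f'] mult_commute_abs)
qed

text \<open>The mean value theorem is applied along direction i to the increment
  \<open>\<psi>\<close> in direction j, and then along direction j to \<open>pd i f\<close>. The
  intermediate point is off by less than h in each of two directions, hence the radius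
  \<open>2 * h\<close>.\<close>

lemma second_difference:
  fixes f :: "real^'n::finite \<Rightarrow> real"
  assumes f: "smooth_on D f" and D: "open D" and r: "ball x r \<subseteq> D" and h: "0 < h" "2 * h < r"
  shows "\<exists>y \<in> ball x (2 * h). f (x + h *\<^sub>R axis j 1 + h *\<^sub>R axis i 1) - f (x + h *\<^sub>R axis i 1)
      - f (x + h *\<^sub>R axis j 1) + f x = h\<^sup>2 * pd j (pd i f) y"
proof -
  have n1: "x + t *\<^sub>R axis j 1 + s *\<^sub>R axis i 1 \<in> D" if "\<bar>s\<bar> \<le> h" "\<bar>t\<bar> \<le> h" for s t
  proof -
    have "norm (t *\<^sub>R axis j (1::real) + s *\<^sub>R axis i 1 :: real^'n) \<le> \<bar>t\<bar> + \<bar>s\<bar>"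
      using norm_triangle_ineq[of "t *\<^sub>R axis j (1::real) :: real^'n" "s *\<^sub>R axis i 1"] by simp
    moreover have "dist x (x + t *\<^sub>R axis j 1 + s *\<^sub>R axis i 1)
        = norm (t *\<^sub>R axis j (1::real) + s *\<^sub>R axis i 1 :: real^'n)"
      by (metis add.assoc dist_add_cancel dist_norm add.right_neutral norm_minus_commute diff_zero)
    ultimately show ?thesis using r that h by (auto simp: subset_eq)
  qed
  define \<psi> where "\<psi> s = f (x + h *\<^sub>R axis j 1 + s *\<^sub>R axis i 1) - f (x + s *\<^sub>R axis i 1)" for s
  have d1: "(\<psi> has_real_derivative pd i f (x + h *\<^sub>R axis j 1 + s *\<^sub>R axis i 1) - pd i f (x + s *\<^sub>R axis i 1)) (at s)"
    if "0 \<le> s" "s \<le> h" for s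
    unfolding \<psi>_def
    using n1[of s h] n1[of s 0] that h
    by (intro DERIV_diff DERIV_along_axis smooth_on_differentiable[OF f D]) auto
  obtain \<xi> where \<xi>: "0 < \<xi>" "\<xi> < h"
    "\<psi> h - \<psi> 0 = (h - 0) * (pd i f (x + h *\<^sub>R axis j 1 + \<xi> *\<^sub>R axis i 1) - pd i f (x + \<xi> *\<^sub>R axis i 1))"
    using MVT2[OF h(1) d1] by blast
  define \<theta> where "\<theta> t = pd i f (x + \<xi> *\<^sub>R axis i 1 + t *\<^sub>R axis j 1)" for t
  have d2: "(\<theta> has_real_derivative pd j (pd i f) (x + \<xi> *\<^sub>R axis i 1 + t *\<^sub>R axis j 1)) (at t)"
    if "0 \<le> t" "t \<le> h" for t
    unfolding \<theta>_def
    using n1[of \<xi> t] that h \<xi>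
    by (intro DERIV_along_axis smooth_on_differentiable[OF smooth_on_pd[OF f] D]) (auto simp: ac_simps)
  obtain \<eta> where \<eta>: "0 < \<eta>" "\<eta> < h"
    "\<theta> h - \<theta> 0 = (h - 0) * pd j (pd i f) (x + \<xi> *\<^sub>R axis i 1 + \<eta> *\<^sub>R axis j 1)"
    using MVT2[OF h(1) d2] by blast
  let ?y = "x + \<xi> *\<^sub>R axis i 1 + \<eta> *\<^sub>R axis j 1"
  have "norm (\<xi> *\<^sub>R axis i (1::real) + \<eta> *\<^sub>R axis j 1 :: real^'n) \<le> \<bar>\<xi>\<bar> + \<bar>\<eta>\<bar>"
    using norm_triangle_ineq[of "\<xi> *\<^sub>R axis i (1::real) :: real^'n" "\<eta> *\<^sub>R axis j 1"] by simp
  moreover have "dist x ?y = norm (\<xi> *\<^sub>R axis i (1::real) + \<eta> *\<^sub>R axis j 1 :: real^'n)"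
    by (metis add.assoc dist_add_cancel dist_norm add.right_neutral norm_minus_commute diff_zero)
  ultimately have "?y \<in> ball x (2 * h)"
    using \<xi> \<eta> by auto
  moreover have "f (x + h *\<^sub>R axis j 1 + h *\<^sub>R axis i 1) - f (x + h *\<^sub>R axis i 1)
      - f (x + h *\<^sub>R axis j 1) + f x = h\<^sup>2 * pd j (pd i f) ?y"
    using \<xi>(3) \<eta>(3) by (simp add: \<psi>_def \<theta>_def power2_eq_square ac_simps)
  ultimately show ?thesis by blast
qed

text \<open>The second difference is symmetric in i and j, so the two mixed derivatives take a
  common value at two points close to x. By continuity both values at x lie within \<epsilon> of
  that number, which contradicts a gap of 2 \<epsilon>.\<close>

lemma pd_commute_real:
  fixes f :: "real^'n::finite \<Rightarrow> real"
  assumes f: "smooth_on D f" and D: "open D" and x: "x \<in> D"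
  shows "pd i (pd j f) x = pd j (pd i f) x"
proof (rule ccontr)
  assume ne: "pd i (pd j f) x \<noteq> pd j (pd i f) x"
  define \<epsilon> where "\<epsilon> = \<bar>pd i (pd j f) x - pd j (pd i f) x\<bar> / 2"
  have \<epsilon>: "\<epsilon> > 0" using ne by (simp add: \<epsilon>_def)
  obtain r where r: "r > 0" "ball x r \<subseteq> D" using D x openE by blast
  have c: "isCont (pd k (pd l f)) x" for k l
    using smooth_on_continuous_on[OF smooth_on_pd[OF smooth_on_pd[OF f]]] D x
    by (simp add: continuous_on_eq_continuous_at)
  have "\<exists>d>0. \<forall>y. dist y x < d \<longrightarrow> dist (pd k (pd l f) y) (pd k (pd l f) x) < \<epsilon>" for k l
    using c[of k l] \<epsilon> unfolding continuous_at_eps_delta by blast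
  then obtain d1 d2 where d: "d1 > 0" "\<And>y. dist y x < d1 \<Longrightarrow> dist (pd i (pd j f) y) (pd i (pd j f) x) < \<epsilon>"
      "d2 > 0" "\<And>y. dist y x < d2 \<Longrightarrow> dist (pd j (pd i f) y) (pd j (pd i f) x) < \<epsilon>" by meson
  define h where "h = min r (min d1 d2) / 3"
  have h: "0 < h" "2 * h < r" "2 * h < d1" "2 * h < d2" using r d by (auto simp: h_def min_def)
  obtain y where y: "y \<in> ball x (2 * h)" "f (x + h *\<^sub>R axis j 1 + h *\<^sub>R axis i 1) - f (x + h *\<^sub>R axis i 1)
      - f (x + h *\<^sub>R axis j 1) + f x = h\<^sup>2 * pd j (pd i f) y"
    using second_difference[OF f D r(2) h(1,2)] by blast
  obtain z where z: "z \<in> ball x (2 * h)" "f (x + h *\<^sub>R axis i 1 + h *\<^sub>R axis j 1) - f (x + h *\<^sub>R axis j 1)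
      - f (x + h *\<^sub>R axis i 1) + f x = h\<^sup>2 * pd i (pd j f) z"
    using second_difference[OF f D r(2) h(1,2)] by blast
  have "f (x + h *\<^sub>R axis i 1 + h *\<^sub>R axis j 1) = f (x + h *\<^sub>R axis j 1 + h *\<^sub>R axis i 1)"
    by (simp add: ac_simps)
  then have "h\<^sup>2 * pd j (pd i f) y = h\<^sup>2 * pd i (pd j f) z" using y(2) z(2) by linarith
  then have "pd j (pd i f) y = pd i (pd j f) z" using h by simp
  moreover have "dist (pd i (pd j f) z) (pd i (pd j f) x) < \<epsilon>" "dist (pd j (pd i f) y) (pd j (pd i f) x) < \<epsilon>"
    using d(2)[of z] d(4)[of y] y(1) z(1) h by (simp_all add: dist_commute)
  ultimately show False by (auto simp: \<epsilon>_def dist_real_def abs_if split: if_splits)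
qed

lemma pd_commute:
  fixes f :: "real^'n::finite \<Rightarrow> 'b::euclidean_space"
  assumes f: "smooth_on D f" and D: "open D" and x: "x \<in> D"
  shows "pd i (pd j f) x = pd j (pd i f) x"
proof (rule euclidean_eqI)
  fix b :: 'b
  have s: "smooth_on D (\<lambda>x. f x \<bullet> b)" by (rule smooth_linear[OF D bounded_linear_inner_left f])
  have e: "pd k (\<lambda>x. f x \<bullet> b) y = pd k f y \<bullet> b" if "y \<in> D" for k y
    using smooth_on_differentiable[OF f D that] by (rule pd_linear[OF bounded_linear_inner_left])
  have e2: "pd l (pd k (\<lambda>x. f x \<bullet> b)) x = pd l (pd k f) x \<bullet> b" for k l
    by (subst pd_cong[OF D x e], assumption)
      (rule pd_linear[OF bounded_linear_inner_left smooth_on_differentiable[OF smooth_on_pd[OF f] D x]])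
  show "pd i (pd j f) x \<bullet> b = pd j (pd i f) x \<bullet> b"
    using pd_commute_real[OF s D x, of i j] by (simp add: e2)
qed


section \<open>Smooth families of linear maps\<close>

text \<open>Smoothness is asked for constant vectors only; linearity and a finite basis extend it to
  smooth sections in \<open>smooth_family_apply\<close>.\<close>

definition smooth_family :: "(real^'n::finite) set \<Rightarrow> (real^'n \<Rightarrow> 'e::euclidean_space \<Rightarrow> 'f::euclidean_space) \<Rightarrow> bool" where
  "smooth_family D T \<longleftrightarrow> (\<forall>x\<in>D. linear (T x)) \<and> (\<forall>w. smooth_on D (\<lambda>x. T x w))"

lemma smooth_familyI:
  "(\<And>x. x \<in> D \<Longrightarrow> linear (T x)) \<Longrightarrow> (\<And>w. smooth_on D (\<lambda>x. T x w)) \<Longrightarrow> smooth_family D T"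
  by (simp add: smooth_family_def)

lemma smooth_family_linear: "smooth_family D T \<Longrightarrow> x \<in> D \<Longrightarrow> linear (T x)"
  by (simp add: smooth_family_def)

lemma smooth_family_const: "smooth_family D T \<Longrightarrow> smooth_on D (\<lambda>x. T x w)"
  by (simp add: smooth_family_def)

lemma smooth_family_expand:
  assumes "smooth_family D T" "x \<in> D"
  shows "T x w = (\<Sum>b\<in>Basis. (w \<bullet> b) *\<^sub>R T x b)"
proof -
  have l: "linear (T x)" using assms by (simp add: smooth_family_def)
  have "T x w = T x (\<Sum>b\<in>Basis. (w \<bullet> b) *\<^sub>R b)" by (simp add: euclidean_representation)
  then show ?thesis by (simp add: linear_sum[OF l] linear_cmul[OF l])
qed

lemma smooth_family_apply:
  assumes D: "open D" and T: "smooth_family D T" and V: "smooth_on D V"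
  shows "smooth_on D (\<lambda>x. T x (V x))"
proof (rule smooth_on_cong[OF D])
  show "(\<Sum>b\<in>Basis. (V x \<bullet> b) *\<^sub>R T x b) = T x (V x)" if "x \<in> D" for x
    by (rule smooth_family_expand[OF T that, symmetric])
  show "smooth_on D (\<lambda>x. \<Sum>b\<in>Basis. (V x \<bullet> b) *\<^sub>R T x b)"
    by (intro smooth_sum[OF D] smooth_scaleR[OF D] smooth_linear[OF D bounded_linear_inner_left V]
        smooth_family_const[OF T])
qed

text \<open>The Leibniz rule without a derivative of the map-valued function \<open>T\<close>:
  differentiating \<open>T\<close> on the vector frozen at \<open>V x\<close> takes its
  place.\<close>

lemma pd_family_apply:
  assumes D: "open D" and T: "smooth_family D T" and V: "smooth_on D V" and x: "x \<in> D"
  shows "pd i (\<lambda>y. T y (V y)) x = pd i (\<lambda>y. T y (V x)) x + T x (pd i V x)"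
proof -
  have dV: "V differentiable (at x)" by (rule smooth_on_differentiable[OF V D x])
  have dT: "(\<lambda>y. T y b) differentiable (at x)" for b
    by (rule smooth_on_differentiable[OF smooth_family_const[OF T] D x])
  have dVb: "(\<lambda>y. V y \<bullet> b) differentiable (at x)" for b
    by (rule differentiable_linear_image[OF bounded_linear_inner_left dV])
  have eV: "pd i (\<lambda>y. V y \<bullet> b) x = pd i V x \<bullet> b" for b
    by (rule pd_linear[OF bounded_linear_inner_left dV])
  have "pd i (\<lambda>y. T y (V y)) x = pd i (\<lambda>y. \<Sum>b\<in>Basis. (V y \<bullet> b) *\<^sub>R T y b) x"
    by (rule pd_cong[OF D x smooth_family_expand[OF T]])
  also have "\<dots> = (\<Sum>b\<in>Basis. (V x \<bullet> b) *\<^sub>R pd i (\<lambda>y. T y b) x + (pd i V x \<bullet> b) *\<^sub>R T x b)"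
    using differentiable_bilinear[OF bounded_bilinear_scaleR dVb dT]
    by (subst pd_sum) (auto simp: pd_bilinear[OF bounded_bilinear_scaleR dVb dT] eV)
  also have "\<dots> = (\<Sum>b\<in>Basis. (V x \<bullet> b) *\<^sub>R pd i (\<lambda>y. T y b) x) + T x (pd i V x)"
    by (simp add: sum.distrib smooth_family_expand[OF T x, of "pd i V x"])
  also have "(\<Sum>b\<in>Basis. (V x \<bullet> b) *\<^sub>R pd i (\<lambda>y. T y b) x) = pd i (\<lambda>y. \<Sum>b\<in>Basis. (V x \<bullet> b) *\<^sub>R T y b) x"
  proof (subst pd_sum)
    show "(\<lambda>y. (V x \<bullet> b) *\<^sub>R T y b) differentiable (at x)" for b
      by (rule differentiable_linear_image[OF bounded_linear_scaleR_right dT])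
    show "(\<Sum>b\<in>Basis. (V x \<bullet> b) *\<^sub>R pd i (\<lambda>y. T y b) x) = (\<Sum>b\<in>Basis. pd i (\<lambda>y. (V x \<bullet> b) *\<^sub>R T y b) x)"
      by (simp add: pd_linear[OF bounded_linear_scaleR_right dT])
  qed simp
  also have "\<dots> = pd i (\<lambda>y. T y (V x)) x"
    by (rule pd_cong[OF D x, symmetric, OF smooth_family_expand[OF T]])
  finally show ?thesis .
qed

lemma smooth_family_pd:
  assumes D: "open D" and T: "smooth_family D T"
  shows "smooth_family D (\<lambda>x w. pd i (\<lambda>y. T y w) x)"
proof (rule smooth_familyI)
  fix x assume x: "x \<in> D"
  have dT: "(\<lambda>y. T y b) differentiable (at x)" for b
    by (rule smooth_on_differentiable[OF smooth_family_const[OF T] D x])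
  show "linear (\<lambda>w. pd i (\<lambda>y. T y w) x)"
  proof (rule linearI)
    fix v w
    have "pd i (\<lambda>y. T y (v + w)) x = pd i (\<lambda>y. T y v + T y w) x"
      by (rule pd_cong[OF D x]) (use T in \<open>auto simp: smooth_family_def linear_add\<close>)
    then show "pd i (\<lambda>y. T y (v + w)) x = pd i (\<lambda>y. T y v) x + pd i (\<lambda>y. T y w) x"
      by (simp add: pd_add[OF dT dT])
  next
    fix r w
    have "pd i (\<lambda>y. T y (r *\<^sub>R w)) x = pd i (\<lambda>y. r *\<^sub>R T y w) x"
      by (rule pd_cong[OF D x]) (use T in \<open>auto simp: smooth_family_def linear_cmul\<close>)
    then show "pd i (\<lambda>y. T y (r *\<^sub>R w)) x = r *\<^sub>R pd i (\<lambda>y. T y w) x"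
      by (simp add: pd_linear[OF bounded_linear_scaleR_right dT])
  qed
qed (intro smooth_on_pd smooth_family_const[OF T])

lemma smooth_family_compose:
  assumes D: "open D" and T: "smooth_family D T" and U: "smooth_family D U"
  shows "smooth_family D (\<lambda>x w. T x (U x w))"
  using T U linear_compose[of "U x" "T x" for x]
  by (intro smooth_familyI smooth_family_apply[OF D T]) (auto simp: smooth_family_def o_def)

lemma smooth_family_add:
  assumes D: "open D" and T: "smooth_family D T" and U: "smooth_family D U"
  shows "smooth_family D (\<lambda>x w. T x w + U x w)"
  using T U linear_compose_add[of "T x" "U x" for x]
  by (intro smooth_familyI smooth_add[OF D]) (auto simp: smooth_family_def)

lemma smooth_family_diff:
  assumes D: "open D" and T: "smooth_family D T" and U: "smooth_family D U"
  shows "smooth_family D (\<lambda>x w. T x w - U x w)"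
  using T U linear_compose_sub[of "T x" "U x" for x]
  by (intro smooth_familyI smooth_diff[OF D]) (auto simp: smooth_family_def)


section \<open>Connections on a trivial bundle\<close>

definition cov :: "('n \<Rightarrow> real^'n::finite \<Rightarrow> 'e::euclidean_space \<Rightarrow> 'e) \<Rightarrow> 'n \<Rightarrow> (real^'n \<Rightarrow> 'e) \<Rightarrow> real^'n \<Rightarrow> 'e" where
  "cov T a V x = pd a V x + T a x (V x)"

text \<open>The local formula dT + [T, T] for the curvature of d + T. Coordinate fields commute, so
  there is no bracket term.\<close>

definition curv :: "('n \<Rightarrow> real^'n::finite \<Rightarrow> 'e::euclidean_space \<Rightarrow> 'e) \<Rightarrow> 'n \<Rightarrow> 'n \<Rightarrow> real^'n \<Rightarrow> 'e \<Rightarrow> 'e" where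
  "curv T a b x w = pd a (\<lambda>y. T b y w) x - pd b (\<lambda>y. T a y w) x + T a x (T b x w) - T b x (T a x w)"

text \<open>This is \<open>(\<nabla>\<^sub>e F\<^sub>a\<^sub>b) w\<close> without the terms of a connection on the base, which cancel
  in the Bianchi identity.\<close>

definition dcurv :: "('n \<Rightarrow> real^'n::finite \<Rightarrow> 'e::euclidean_space \<Rightarrow> 'e) \<Rightarrow> 'n \<Rightarrow> 'n \<Rightarrow> 'n \<Rightarrow> real^'n \<Rightarrow> 'e \<Rightarrow> 'e" where
  "dcurv T e a b x w = cov T e (\<lambda>y. curv T a b y w) x - curv T a b x (T e x w)"

lemma cov_const: "cov T a (\<lambda>_. w) x = T a x w"
  by (simp add: cov_def)

locale connection =
  fixes D :: "(real^'n::finite) set" and T :: "'n \<Rightarrow> real^'n \<Rightarrow> 'e::euclidean_space \<Rightarrow> 'e"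
  assumes open_D: "open D" and family: "smooth_family D (T a)"
begin

lemma linear_T: "x \<in> D \<Longrightarrow> linear (T a x)"
  by (rule smooth_family_linear[OF family])

lemma smooth_cov: "smooth_on D V \<Longrightarrow> smooth_on D (cov T a V)"
  unfolding cov_def[abs_def]
  by (intro smooth_add[OF open_D] smooth_on_pd smooth_family_apply[OF open_D family])

lemma family_curv: "smooth_family D (curv T a b)"
  unfolding curv_def[abs_def]
  by (rule smooth_family_diff[OF open_D smooth_family_add[OF open_D smooth_family_diff[OF open_D
        smooth_family_pd[OF open_D family] smooth_family_pd[OF open_D family]]
        smooth_family_compose[OF open_D family family]] smooth_family_compose[OF open_D family family]])

lemma linear_curv: "x \<in> D \<Longrightarrow> linear (curv T a b x)"
  by (rule smooth_family_linear[OF family_curv])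

lemma curv_swap: "curv T b a x w = - curv T a b x w"
  by (simp add: curv_def)

lemma cov_cong: "x \<in> D \<Longrightarrow> (\<And>y. y \<in> D \<Longrightarrow> V y = W y) \<Longrightarrow> cov T a V x = cov T a W x"
  unfolding cov_def using pd_cong[OF open_D] by metis

lemma cov_diff:
  assumes "smooth_on D V" "smooth_on D W" "x \<in> D"
  shows "cov T a (\<lambda>y. V y - W y) x = cov T a V x - cov T a W x"
  using assms smooth_on_differentiable[OF assms(1) open_D assms(3)] smooth_on_differentiable[OF assms(2) open_D assms(3)]
  by (simp add: cov_def pd_diff linear_diff[OF linear_T])

lemma cov_sum:
  assumes "\<And>s. s \<in> S \<Longrightarrow> smooth_on D (V s)" "x \<in> D" "finite S"
  shows "cov T a (\<lambda>y. \<Sum>s\<in>S. V s y) x = (\<Sum>s\<in>S. cov T a (V s) x)"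
  using assms smooth_on_differentiable[OF assms(1) open_D assms(2)]
  by (simp add: cov_def pd_sum linear_sum[OF linear_T] sum.distrib)

lemma cov_scaleR:
  assumes "smooth_on D f" "smooth_on D V" "x \<in> D"
  shows "cov T a (\<lambda>y. f y *\<^sub>R V y) x = f x *\<^sub>R cov T a V x + pd a f x *\<^sub>R V x"
  using assms smooth_on_differentiable[OF assms(1) open_D assms(3)] smooth_on_differentiable[OF assms(2) open_D assms(3)]
  by (simp add: cov_def pd_bilinear[OF bounded_bilinear_scaleR] linear_cmul[OF linear_T] scaleR_add_right)

lemma cov_commutator:
  assumes V: "smooth_on D V" and x: "x \<in> D"
  shows "cov T a (cov T b V) x - cov T b (cov T a V) x = curv T a b x (V x)"
proof -
  have "cov T a (cov T b V) x = pd a (pd b V) x + pd a (\<lambda>y. T b y (V x)) x + T b x (pd a V x)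
      + T a x (pd b V x) + T a x (T b x (V x))" for a b
  proof -
    have "pd a (cov T b V) x = pd a (pd b V) x + pd a (\<lambda>y. T b y (V y)) x"
      unfolding cov_def[abs_def]
      using smooth_on_differentiable[OF smooth_on_pd[OF V] open_D x]
        smooth_on_differentiable[OF smooth_family_apply[OF open_D family V] open_D x]
      by (rule pd_add)
    then show ?thesis
      by (simp add: cov_def[of _ _ "cov T b V"] pd_family_apply[OF open_D family V x])
        (simp add: cov_def linear_add[OF linear_T[OF x]])
  qed
  then show ?thesis by (simp add: curv_def pd_commute[OF V open_D x, of a b])
qed

lemma cov_curv_apply:
  assumes V: "smooth_on D V" and x: "x \<in> D"
  shows "cov T e (\<lambda>y. curv T a b y (V y)) x = dcurv T e a b x (V x) + curv T a b x (cov T e V x)"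
  by (simp add: cov_def dcurv_def pd_family_apply[OF open_D family_curv V x] linear_add[OF linear_curv[OF x]])

lemma family_dcurv: "smooth_family D (dcurv T e a b)"
  unfolding dcurv_def[abs_def] cov_def[abs_def]
  by (rule smooth_family_diff[OF open_D smooth_family_add[OF open_D smooth_family_pd[OF open_D family_curv]
        smooth_family_compose[OF open_D family family_curv]] smooth_family_compose[OF open_D family_curv family]])

lemma linear_dcurv: "x \<in> D \<Longrightarrow> linear (dcurv T e a b x)"
  by (rule smooth_family_linear[OF family_dcurv])

text \<open>On a constant section each term is a nested commutator of covariant derivatives, and the
  cyclic sum of these is zero by the Jacobi identity.\<close>

lemma bianchi:
  assumes x: "x \<in> D"
  shows "dcurv T e a b x w + dcurv T a b e x w + dcurv T b e a x w = 0"
proof -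
  let ?w = "\<lambda>_. w :: 'e"
  have s: "smooth_on D ?w" by (rule smooth_const)
  have "dcurv T e a b x w = cov T e (cov T a (cov T b ?w)) x - cov T e (cov T b (cov T a ?w)) x
      - cov T a (cov T b (cov T e ?w)) x + cov T b (cov T a (cov T e ?w)) x" for e a b
  proof -
    have "cov T e (\<lambda>y. curv T a b y w) x = cov T e (\<lambda>y. cov T a (cov T b ?w) y - cov T b (cov T a ?w) y) x"
      by (rule cov_cong[OF x]) (simp add: cov_commutator[OF s])
    moreover have "curv T a b x (T e x w) = cov T a (cov T b (cov T e ?w)) x - cov T b (cov T a (cov T e ?w)) x"
      using cov_commutator[OF smooth_cov[OF s] x, of a b e] by (simp add: cov_const)
    ultimately show ?thesis
      unfolding dcurv_def by (simp add: cov_diff[OF smooth_cov[OF smooth_cov[OF s]] smooth_cov[OF smooth_cov[OF s]] x])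
  qed
  then show ?thesis by simp
qed

lemma parallel_curv:
  assumes V: "smooth_on D V" and par: "\<And>a y. y \<in> D \<Longrightarrow> cov T a V y = 0" and x: "x \<in> D"
  shows "curv T a b x (V x) = 0"
proof -
  have "cov T a (cov T b V) x = 0" for a b
  proof -
    have "cov T a (cov T b V) x = cov T a (\<lambda>_. 0) x" by (rule cov_cong[OF x par])
    then show ?thesis by (simp add: cov_const linear_0[OF linear_T[OF x]])
  qed
  then show ?thesis using cov_commutator[OF V x, of a b] by simp
qed

text \<open>A contraction estimate. If the connection form has total norm at most M on a ball of
  radius at most \<open>1 / (2 * M)\<close>, the mean value inequality from the centre, where V
  vanishes, bounds the maximum of the norm of V by half of itself.\<close>

lemma parallel_unique:
  assumes V: "smooth_on D V" and par: "\<And>a y. y \<in> D \<Longrightarrow> cov T a V y = 0" and x: "x \<in> D" and V0: "V x = 0"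
  shows "\<exists>\<delta>>0. ball x \<delta> \<subseteq> D \<and> (\<forall>y\<in>ball x \<delta>. V y = 0)"
proof -
  obtain r where r: "r > 0" "cball x r \<subseteq> D" using open_D x open_contains_cball by blast
  define B where "B y = (\<Sum>a\<in>UNIV. \<Sum>b\<in>Basis. norm (T a y b))" for y
  have "continuous_on (cball x r) B"
    unfolding B_def
    using continuous_on_subset[OF smooth_on_continuous_on[OF smooth_family_const[OF family]] r(2)]
    by (intro continuous_on_sum continuous_on_norm)
  then have "bounded (B ` cball x r)"
    using compact_continuous_image compact_imp_bounded compact_cball by blast
  then obtain M where "M > 0" "\<forall>z\<in>B ` cball x r. norm z \<le> M"
    using bounded_pos by blast
  then have M: "M > 0" "\<And>y. y \<in> cball x r \<Longrightarrow> B y \<le> M"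
    by (simp_all add: abs_le_iff)
  have Tb: "(\<Sum>a\<in>UNIV. norm (T a y w)) \<le> M * norm w" if y: "y \<in> cball x r" for y w
  proof -
    have "norm (T a y w) \<le> (\<Sum>b\<in>Basis. norm (T a y b)) * norm w" for a
    proof -
      have "norm (T a y w) \<le> (\<Sum>b\<in>Basis. norm ((w \<bullet> b) *\<^sub>R T a y b))"
        using y r(2) smooth_family_expand[OF family, of y a w] norm_sum by (metis subsetD)
      also have "\<dots> \<le> (\<Sum>b\<in>Basis. norm w * norm (T a y b))"
        by (intro sum_mono) (auto intro!: mult_right_mono Basis_le_norm)
      finally show ?thesis by (simp add: sum_distrib_left sum_distrib_right mult.commute)
    qed
    then have "(\<Sum>a\<in>UNIV. norm (T a y w)) \<le> (\<Sum>a\<in>UNIV. (\<Sum>b\<in>Basis. norm (T a y b)) * norm w)"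
      by (rule sum_mono)
    also have "\<dots> \<le> M * norm w"
      using M(2)[OF y] by (simp add: B_def sum_distrib_right[symmetric] mult_right_mono)
    finally show ?thesis .
  qed
  define \<delta> where "\<delta> = min r (1 / (2 * M))"
  have \<delta>: "\<delta> > 0" "\<delta> \<le> r" "\<delta> * M \<le> 1/2" using r(1) M(1) by (auto simp: \<delta>_def min_def field_simps)
  have sub: "cball x \<delta> \<subseteq> cball x r" using \<delta> by auto
  then have subD: "cball x \<delta> \<subseteq> D" using r by blast
  have "continuous_on (cball x \<delta>) (\<lambda>y. norm (V y))"
    by (rule continuous_on_norm[OF continuous_on_subset[OF smooth_on_continuous_on[OF V] subD]])
  moreover have "cball x \<delta> \<noteq> {}" using \<delta>(1) by simp
  ultimately obtain z where z: "z \<in> cball x \<delta>" "\<And>y. y \<in> cball x \<delta> \<Longrightarrow> norm (V y) \<le> norm (V z)"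
    using continuous_attains_sup[of "cball x \<delta>" "\<lambda>y. norm (V y)"] compact_cball by blast
  let ?d = "\<lambda>y v. \<Sum>a\<in>UNIV. (v $ a) *\<^sub>R pd a V y"
  have "norm (V z - V x) \<le> (M * norm (V z)) * norm (z - x)"
  proof (rule differentiable_bound[OF convex_cball[of x \<delta>]])
    fix y assume y: "y \<in> cball x \<delta>"
    then have yD: "y \<in> D" using subD by auto
    show "(V has_derivative ?d y) (at y within cball x \<delta>)"
      using has_derivative_at_withinI[OF has_derivative_pd[OF smooth_on_differentiable[OF V open_D yD]]] .
    have pdV: "pd a V y = - T a y (V y)" for a
      using par[OF yD, of a] by (simp add: cov_def add_eq_0_iff2)
    show "onorm (?d y) \<le> M * norm (V z)"
    proof (rule onorm_le)
      fix v :: "real^'n"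
      have "norm (?d y v) \<le> (\<Sum>a\<in>UNIV. norm v * norm (T a y (V y)))"
        by (rule order_trans[OF norm_sum]) (auto intro!: sum_mono mult_right_mono simp: pdV component_le_norm_cart)
      also have "\<dots> \<le> norm v * (M * norm (V y))"
        using Tb[of y "V y"] y sub by (auto simp: sum_distrib_left[symmetric] intro!: mult_left_mono)
      also have "\<dots> \<le> M * norm (V z) * norm v"
        using z(2)[OF y] M(1) by (simp add: mult.commute mult_left_mono mult_right_mono)
      finally show "norm (?d y v) \<le> M * norm (V z) * norm v" .
    qed
  qed (use z \<delta> in auto)
  also have "\<dots> \<le> (M * norm (V z)) * \<delta>"
    using z(1) M(1) by (intro mult_left_mono) (auto simp: dist_norm norm_minus_commute)
  also have "\<dots> \<le> norm (V z) / 2"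
    using mult_right_mono[OF \<delta>(3), of "norm (V z)"] by (simp add: ac_simps)
  finally have "norm (V z) = 0" using V0 by simp
  then have "V y = 0" if "y \<in> ball x \<delta>" for y using z(2)[of y] that by auto
  then show ?thesis using \<delta>(1) subD by (meson ball_subset_cball order_trans)
qed

end

section \<open>Connections compatible with a bundle metric\<close>

locale metric_connection = connection D T
  for D :: "(real^'n::finite) set" and T :: "'n \<Rightarrow> real^'n \<Rightarrow> 'e::euclidean_space \<Rightarrow> 'e" +
  fixes h :: "real^'n \<Rightarrow> 'e \<Rightarrow> 'e \<Rightarrow> real"
  assumes h: "smooth_on D V \<Longrightarrow> smooth_on D W \<Longrightarrow> smooth_on D (\<lambda>y. h y (V y) (W y))"
    and compat: "smooth_on D V \<Longrightarrow> smooth_on D W \<Longrightarrow> x \<in> D \<Longrightarrow>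
       pd a (\<lambda>y. h y (V y) (W y)) x = h x (cov T a V x) (W x) + h x (V x) (cov T a W x)"
    and bil: "x \<in> D \<Longrightarrow> bilinear (h x)"
begin

text \<open>Second derivatives of \<open>h y v w\<close> commute, and the terms with one derivative
  on each argument are symmetric in a and b; what remains is the skewness.\<close>

lemma curv_skew:
  assumes x: "x \<in> D"
  shows "h x (curv T a b x v) w = - h x v (curv T a b x w)"
proof -
  let ?v = "\<lambda>_. v :: 'e" and ?w = "\<lambda>_. w :: 'e"
  have sv: "smooth_on D ?v" "smooth_on D ?w" by (rule smooth_const)+
  have "pd a (pd b (\<lambda>y. h y v w)) x
    = h x (cov T a (cov T b ?v) x) w + h x (cov T b ?v x) (cov T a ?w x)
      + h x (cov T a ?v x) (cov T b ?w x) + h x v (cov T a (cov T b ?w) x)" for a b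
  proof -
    have "pd a (pd b (\<lambda>y. h y v w)) x = pd a (\<lambda>y. h y (cov T b ?v y) w + h y v (cov T b ?w y)) x"
      by (rule pd_cong[OF open_D x]) (rule compat[OF sv])
    also have "\<dots> = pd a (\<lambda>y. h y (cov T b ?v y) w) x + pd a (\<lambda>y. h y v (cov T b ?w y)) x"
      by (intro pd_add smooth_on_differentiable[OF _ open_D x] h smooth_cov sv)
    finally show ?thesis
      using compat[OF smooth_cov[OF sv(1)] sv(2) x, of a b] compat[OF sv(1) smooth_cov[OF sv(2)] x, of a b]
      by simp
  qed
  then have "h x (cov T a (cov T b ?v) x) w + h x v (cov T a (cov T b ?w) x)
    = h x (cov T b (cov T a ?v) x) w + h x v (cov T b (cov T a ?w) x)"
    using pd_commute[OF h[OF sv] open_D x, of a b] by simp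
  moreover have "curv T a b x v = cov T a (cov T b ?v) x - cov T b (cov T a ?v) x"
      "curv T a b x w = cov T a (cov T b ?w) x - cov T b (cov T a ?w) x"
    using cov_commutator[OF sv(1) x, of a b] cov_commutator[OF sv(2) x, of a b] by simp_all
  ultimately show ?thesis
    using bilinear_lsub[OF bil[OF x]] bilinear_rsub[OF bil[OF x]] by simp
qed

text \<open>This is the derivative of the skewness of the curvature; the terms in which the
  connection form meets v or w cancel by that same skewness.\<close>

lemma dcurv_skew:
  assumes x: "x \<in> D"
  shows "h x (dcurv T e a b x v) w = - h x v (dcurv T e a b x w)"
proof -
  let ?v = "\<lambda>_. v :: 'e" and ?w = "\<lambda>_. w :: 'e"
  have sv: "smooth_on D ?v" "smooth_on D ?w" by (rule smooth_const)+
  have sc: "smooth_on D (\<lambda>y. curv T a b y u)" for u by (rule smooth_family_const[OF family_curv])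
  have "pd e (\<lambda>y. h y (curv T a b y v) w + h y v (curv T a b y w)) x = pd e (\<lambda>y. 0) x"
    by (rule pd_cong[OF open_D x]) (simp add: curv_skew)
  then have "0 = pd e (\<lambda>y. h y (curv T a b y v) w) x + pd e (\<lambda>y. h y v (curv T a b y w)) x"
    by (subst (asm) pd_add) (auto intro!: smooth_on_differentiable[OF _ open_D x] h sc sv)
  also have "\<dots> = h x (cov T e (\<lambda>y. curv T a b y v) x) w + h x (curv T a b x v) (T e x w)
      + h x (T e x v) (curv T a b x w) + h x v (cov T e (\<lambda>y. curv T a b y w) x)"
    using compat[OF sc sv(2) x] compat[OF sv(1) sc x] by (simp add: cov_const)
  finally show ?thesis
    using curv_skew[OF x, of a b v "T e x w"] curv_skew[OF x, of a b "T e x v" w]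
    by (simp add: dcurv_def bilinear_lsub[OF bil[OF x]] bilinear_rsub[OF bil[OF x]])
qed

end

section \<open>Pullback of a connection along a smooth map\<close>

definition pull :: "(real^'m::finite \<Rightarrow> real^'n::finite) \<Rightarrow> ('n \<Rightarrow> real^'n \<Rightarrow> 'e::euclidean_space \<Rightarrow> 'e)
    \<Rightarrow> 'm \<Rightarrow> real^'m \<Rightarrow> 'e \<Rightarrow> 'e" where
  "pull \<phi> T \<alpha> y w = (\<Sum>a\<in>UNIV. (pd \<alpha> \<phi> y $ a) *\<^sub>R T a (\<phi> y) w)"

context connection
begin

context
  fixes E :: "(real^'m::finite) set" and \<phi> :: "real^'m \<Rightarrow> real^'n"
  assumes open_E: "open E" and \<phi>: "smooth_on E \<phi>" and image: "\<phi> ` E \<subseteq> D"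
begin

lemma connection_pull: "connection E (pull \<phi> T)"
proof (unfold_locales, rule open_E, rule smooth_familyI)
  fix \<alpha> y assume "y \<in> E"
  then have l: "linear (T a (\<phi> y))" for a using image linear_T by auto
  show "linear (pull \<phi> T \<alpha> y)"
    unfolding pull_def[abs_def] by (intro linear_compose_sum ballI linear_compose_scale_right l)
next
  fix \<alpha> w
  show "smooth_on E (\<lambda>y. pull \<phi> T \<alpha> y w)"
    unfolding pull_def
    by (intro smooth_sum smooth_scaleR smooth_vec_nth smooth_on_pd \<phi> open_E
        smooth_compose[OF open_D open_E _ \<phi> image] smooth_family_const[OF family])
qed

lemma cov_pull:
  assumes V: "smooth_on D V" and y: "y \<in> E"
  shows "cov (pull \<phi> T) \<alpha> (\<lambda>y. V (\<phi> y)) y = (\<Sum>a\<in>UNIV. (pd \<alpha> \<phi> y $ a) *\<^sub>R cov T a V (\<phi> y))"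
  using pd_compose[OF smooth_on_differentiable[OF \<phi> open_E y] smooth_on_differentiable[OF V open_D], of \<alpha>] y image
  by (auto simp: cov_def pull_def scaleR_add_right sum.distrib)

text \<open>The second derivatives of \<phi> multiply first covariant derivatives and cancel in the
  commutator because they are symmetric.\<close>

lemma curv_pull:
  assumes y: "y \<in> E"
  shows "curv (pull \<phi> T) \<alpha> \<beta> y w
    = (\<Sum>a\<in>UNIV. \<Sum>b\<in>UNIV. (pd \<alpha> \<phi> y $ a * pd \<beta> \<phi> y $ b) *\<^sub>R curv T a b (\<phi> y) w)"
proof -
  interpret P: connection E "pull \<phi> T" by (rule connection_pull)
  let ?w = "\<lambda>_. w :: 'e"
  have s: "smooth_on D ?w" "smooth_on E ?w" by (rule smooth_const)+
  have sb: "smooth_on E (\<lambda>y. cov T b ?w (\<phi> y))" for b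
    by (rule smooth_compose[OF open_D open_E smooth_cov[OF s(1)] \<phi> image])
  have sp: "smooth_on E (\<lambda>y. pd \<beta> \<phi> y $ b)" for \<beta> b
    by (intro smooth_vec_nth smooth_on_pd \<phi> open_E)
  have e: "cov (pull \<phi> T) \<alpha> (cov (pull \<phi> T) \<beta> ?w) y
    = (\<Sum>b\<in>UNIV. (pd \<alpha> (pd \<beta> \<phi>) y $ b) *\<^sub>R cov T b ?w (\<phi> y))
      + (\<Sum>a\<in>UNIV. \<Sum>b\<in>UNIV. (pd \<alpha> \<phi> y $ a * pd \<beta> \<phi> y $ b) *\<^sub>R cov T a (cov T b ?w) (\<phi> y))" for \<alpha> \<beta>
  proof -
    have "cov (pull \<phi> T) \<alpha> (cov (pull \<phi> T) \<beta> ?w) y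
      = cov (pull \<phi> T) \<alpha> (\<lambda>y. \<Sum>b\<in>UNIV. (pd \<beta> \<phi> y $ b) *\<^sub>R cov T b ?w (\<phi> y)) y"
      by (rule P.cov_cong[OF y]) (rule cov_pull[OF s(1)])
    also have "\<dots> = (\<Sum>b\<in>UNIV. (pd \<beta> \<phi> y $ b) *\<^sub>R cov (pull \<phi> T) \<alpha> (\<lambda>y. cov T b ?w (\<phi> y)) y
        + pd \<alpha> (\<lambda>y. pd \<beta> \<phi> y $ b) y *\<^sub>R cov T b ?w (\<phi> y))"
      by (simp add: P.cov_sum[OF smooth_scaleR[OF open_E sp sb] y] P.cov_scaleR[OF sp sb y])
    also have "\<dots> = (\<Sum>b\<in>UNIV. (pd \<beta> \<phi> y $ b) *\<^sub>R (\<Sum>a\<in>UNIV. (pd \<alpha> \<phi> y $ a) *\<^sub>R cov T a (cov T b ?w) (\<phi> y))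
        + (pd \<alpha> (pd \<beta> \<phi>) y $ b) *\<^sub>R cov T b ?w (\<phi> y))"
      by (simp add: cov_pull[OF smooth_cov[OF s(1)] y]
          pd_linear[OF bounded_linear_vec_nth smooth_on_differentiable[OF smooth_on_pd[OF \<phi>] open_E y]])
    also have "\<dots> = (\<Sum>b\<in>UNIV. (pd \<alpha> (pd \<beta> \<phi>) y $ b) *\<^sub>R cov T b ?w (\<phi> y))
      + (\<Sum>b\<in>UNIV. \<Sum>a\<in>UNIV. (pd \<alpha> \<phi> y $ a * pd \<beta> \<phi> y $ b) *\<^sub>R cov T a (cov T b ?w) (\<phi> y))"
      by (simp add: sum.distrib scaleR_sum_right mult.commute)
    also have "(\<Sum>b\<in>UNIV. \<Sum>a\<in>UNIV. (pd \<alpha> \<phi> y $ a * pd \<beta> \<phi> y $ b) *\<^sub>R cov T a (cov T b ?w) (\<phi> y))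
       = (\<Sum>a\<in>UNIV. \<Sum>b\<in>UNIV. (pd \<alpha> \<phi> y $ a * pd \<beta> \<phi> y $ b) *\<^sub>R cov T a (cov T b ?w) (\<phi> y))"
      by (rule sum.swap)
    finally show ?thesis .
  qed
  have sw: "(\<Sum>a\<in>UNIV. \<Sum>b\<in>UNIV. (pd \<beta> \<phi> y $ a * pd \<alpha> \<phi> y $ b) *\<^sub>R cov T a (cov T b ?w) (\<phi> y))
    = (\<Sum>a\<in>UNIV. \<Sum>b\<in>UNIV. (pd \<alpha> \<phi> y $ a * pd \<beta> \<phi> y $ b) *\<^sub>R cov T b (cov T a ?w) (\<phi> y))"
    by (subst sum.swap) (simp add: mult.commute)
  have "curv (pull \<phi> T) \<alpha> \<beta> y w = cov (pull \<phi> T) \<alpha> (cov (pull \<phi> T) \<beta> ?w) y - cov (pull \<phi> T) \<beta> (cov (pull \<phi> T) \<alpha> ?w) y"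
    using P.cov_commutator[OF s(2) y, of \<alpha> \<beta>] by simp
  also have "\<dots> = (\<Sum>a\<in>UNIV. \<Sum>b\<in>UNIV. (pd \<alpha> \<phi> y $ a * pd \<beta> \<phi> y $ b) *\<^sub>R
      (cov T a (cov T b ?w) (\<phi> y) - cov T b (cov T a ?w) (\<phi> y)))"
    unfolding e sw pd_commute[OF \<phi> open_E y, of \<beta> \<alpha>] by (simp add: scaleR_diff_right sum_subtractf)
  also have "\<dots> = (\<Sum>a\<in>UNIV. \<Sum>b\<in>UNIV. (pd \<alpha> \<phi> y $ a * pd \<beta> \<phi> y $ b) *\<^sub>R curv T a b (\<phi> y) w)"
    using y image by (auto intro!: sum.cong simp: cov_commutator[OF s(1)])
  finally show ?thesis .
qed

end

end

text \<open>\<open>\<Psi>\<close> may have a kernel: it will be instantiated with a map between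
  bundles of different rank that kills the normal tractor.\<close>

lemma curv_intertwine:
  assumes "connection E S" "connection E T"
    and \<Psi>: "smooth_family E \<Psi>"
    and inter: "\<And>V \<alpha> y. smooth_on E V \<Longrightarrow> y \<in> E \<Longrightarrow> cov T \<alpha> (\<lambda>y. \<Psi> y (V y)) y = \<Psi> y (cov S \<alpha> V y)"
    and y: "y \<in> E"
  shows "curv T \<alpha> \<beta> y (\<Psi> y w) = \<Psi> y (curv S \<alpha> \<beta> y w)"
proof -
  interpret S: connection E S by fact
  interpret T: connection E T by fact
  let ?w = "\<lambda>_. w"
  have s: "smooth_on E ?w" by (rule smooth_const)
  have s\<Psi>: "smooth_on E (\<lambda>y. \<Psi> y w)" by (rule smooth_family_const[OF \<Psi>])
  have e: "cov T \<alpha> (cov T \<beta> (\<lambda>y. \<Psi> y w)) y = \<Psi> y (cov S \<alpha> (cov S \<beta> ?w) y)" for \<alpha> \<beta>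
  proof -
    have "cov T \<alpha> (cov T \<beta> (\<lambda>y. \<Psi> y w)) y = cov T \<alpha> (\<lambda>y. \<Psi> y (cov S \<beta> ?w y)) y"
      by (rule T.cov_cong[OF y]) (rule inter[OF s])
    then show ?thesis using inter[OF S.smooth_cov[OF s] y] by simp
  qed
  show ?thesis
    using T.cov_commutator[OF s\<Psi> y, of \<alpha> \<beta>] S.cov_commutator[OF s y, of \<alpha> \<beta>]
    by (simp add: e linear_diff[OF smooth_family_linear[OF \<Psi> y], symmetric])
qed

section \<open>Tractor connections in a chart\<close>

lemma bounded_bilinear_matrix_vector_mult:
  "bounded_bilinear ((*v) :: real^'n::finite^'m::finite \<Rightarrow> real^'n \<Rightarrow> real^'m)"
  unfolding bilinear_conv_bounded_bilinear[symmetric] bilinear_def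
  by (auto intro!: linearI simp: matrix_vector_mult_add_rdistrib matrix_vector_right_distrib
      scaleR_matrix_vector_assoc matrix_vector_mult_scaleR)

lemma bounded_bilinear_matrix_matrix_mult:
  "bounded_bilinear ((**) :: real^'n::finite^'m::finite \<Rightarrow> real^'k::finite^'n \<Rightarrow> real^'k^'m)"
  unfolding bilinear_conv_bounded_bilinear[symmetric] bilinear_def
  by (auto intro!: linearI simp: matrix_matrix_mult_def vec_eq_iff algebra_simps sum.distrib sum_distrib_left)

text \<open>The row is the covector index and the column the contracted upper index, so that the
  covariant derivative of a covector is \<open>pd a \<mu> x - gam G a x *v \<mu> x\<close>.\<close>

definition gam :: "(real^'n::finite \<Rightarrow> real^'n^'n) \<Rightarrow> 'n \<Rightarrow> real^'n \<Rightarrow> real^'n^'n" where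
  "gam G a x = (\<chi> b e. christoffel G x e a b)"

text \<open>The connection form of the tractor connection, with an arbitrary tensor \<open>P\<close> in place of the
  Schouten tensor.\<close>

definition tform :: "(real^'n::finite \<Rightarrow> real^'n^'n) \<Rightarrow> (real^'n \<Rightarrow> real^'n^'n) \<Rightarrow> 'n \<Rightarrow> real^'n
    \<Rightarrow> 'n tractor \<Rightarrow> 'n tractor" where
  "tform G P a x w = (- (fst (snd w) $ a),
     - (gam G a x *v fst (snd w)) + snd (snd w) *\<^sub>R (G x $ a) + fst w *\<^sub>R (P x $ a),
     - (P x $ a \<bullet> (Ginv G x *v fst (snd w))))"

lemma tconn_eq_cov: "tconn G a V x = cov (tform G (schouten G)) a V x"
  by (cases "V x", cases "pd a V x")
    (auto simp: tconn_def cov_def tform_def gam_def vec_eq_iff matrix_vector_mult_def inner_vec_def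
      plus_prod_def mult.commute)

abbreviation tX :: "'n::finite tractor" where "tX \<equiv> (0, 0, 1)"
abbreviation tY :: "'n::finite tractor" where "tY \<equiv> (1, 0, 0)"
abbreviation tZ :: "real^'n::finite \<Rightarrow> 'n tractor" where "tZ \<mu> \<equiv> (0, \<mu>, 0)"

lemma tractor_h_eq:
  "tractor_h m v w = fst (snd v) \<bullet> (matrix_inv m *v fst (snd w)) + fst v * snd (snd w) + snd (snd v) * fst w"
  by (cases v, cases w) simp

section \<open>Levi-Civita calculus of a metric in coordinates\<close>

locale riemannian =
  fixes D :: "(real^'n::finite) set" and G :: "real^'n \<Rightarrow> real^'n^'n"
  assumes open_D: "open D" and smooth_G: "smooth_on D G"
    and sym: "x \<in> D \<Longrightarrow> transpose (G x) = G x"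
    and pos: "x \<in> D \<Longrightarrow> v \<noteq> 0 \<Longrightarrow> v \<bullet> (G x *v v) > 0"
begin

lemma G_sym: "x \<in> D \<Longrightarrow> G x $ a $ b = G x $ b $ a"
  using arg_cong[OF sym, of x "\<lambda>M. M $ b $ a"] by (simp add: transpose_def)

lemma invertible_G:
  assumes "x \<in> D"
  shows "invertible (G x)"
proof -
  have "v = 0" if "G x *v v = 0" for v
    using pos[OF assms, of v] that by force
  then show ?thesis
    by (simp add: invertible_left_inverse matrix_left_invertible_ker)
qed

lemma Ginv_left: "x \<in> D \<Longrightarrow> Ginv G x ** G x = mat 1"
  and Ginv_right: "x \<in> D \<Longrightarrow> G x ** Ginv G x = mat 1"
  using matrix_inv[OF invertible_G] by (simp_all add: Ginv_def)

lemma transpose_Ginv: "x \<in> D \<Longrightarrow> transpose (Ginv G x) = Ginv G x"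
proof -
  assume x: "x \<in> D"
  have "G x ** transpose (Ginv G x) = mat 1"
    using Ginv_left[OF x] sym[OF x] by (metis matrix_transpose_mul transpose_mat)
  then show ?thesis
    using Ginv_left[OF x] by (metis matrix_mul_assoc matrix_mul_lid matrix_mul_rid)
qed

lemma Ginv_sym: "x \<in> D \<Longrightarrow> Ginv G x $ a $ b = Ginv G x $ b $ a"
  using arg_cong[OF transpose_Ginv, of x "\<lambda>M. M $ b $ a"] by (simp add: transpose_def)

lemma Ginv_G: "x \<in> D \<Longrightarrow> (\<Sum>b\<in>UNIV. Ginv G x $ a $ b * G x $ b $ c) = (if a = c then 1 else 0)"
  using arg_cong[OF Ginv_left, of x "\<lambda>M. M $ a $ c"] by (simp add: matrix_matrix_mult_def mat_def)

lemma Ginv_G_row: "x \<in> D \<Longrightarrow> Ginv G x *v (G x $ a) = axis a 1"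
  using Ginv_G[of x _ a] G_sym[of x a] by (simp add: vec_eq_iff matrix_vector_mult_def axis_def eq_commute)

lemma Ginv_self_adjoint: "x \<in> D \<Longrightarrow> v \<bullet> (Ginv G x *v w) = (Ginv G x *v v) \<bullet> w"
  using transpose_Ginv[of x] transpose_matrix_vector[of "Ginv G x" v]
  by (simp add: dot_lmul_matrix[symmetric])

lemma smooth_Ginv: "smooth_on D (Ginv G)"
  unfolding Ginv_def[abs_def] by (rule smooth_matrix_inv[OF open_D smooth_G invertible_G])

lemma differentiable_G: "x \<in> D \<Longrightarrow> G differentiable (at x)"
  by (rule smooth_on_differentiable[OF smooth_G open_D])

lemma pd_G_sym: "x \<in> D \<Longrightarrow> pd i G x $ a $ b = pd i G x $ b $ a"
proof -
  assume x: "x \<in> D"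
  have e: "pd i (\<lambda>y. G y $ a $ b) x = pd i G x $ a $ b" for a b
    using pd_linear[OF bounded_linear_compose[OF bounded_linear_vec_nth bounded_linear_vec_nth]
        differentiable_G[OF x]] .
  have "pd i (\<lambda>y. G y $ a $ b) x = pd i (\<lambda>y. G y $ b $ a) x"
    by (rule pd_cong[OF open_D x G_sym])
  then show ?thesis by (simp add: e)
qed

lemma christoffel_sym: "x \<in> D \<Longrightarrow> christoffel G x k i j = christoffel G x k j i"
  unfolding christoffel_def using pd_G_sym[of x _ i j] by (simp add: add.commute)

lemma smooth_christoffel: "smooth_on D (\<lambda>x. christoffel G x k i j)"
  unfolding christoffel_def
  by (intro smooth_divide[OF open_D] smooth_sum[OF open_D] smooth_mult[OF open_D] smooth_add[OF open_D]
      smooth_diff[OF open_D] smooth_vec_nth[OF open_D] smooth_on_pd smooth_G smooth_Ginv smooth_const) auto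

lemma smooth_gam: "smooth_on D (gam G a)"
  unfolding gam_def[abs_def] by (intro smooth_vec_lambda[OF open_D] smooth_christoffel)

lemma smooth_riemann: "smooth_on D (\<lambda>x. riemann G x a b c d)"
  unfolding riemann_def
  by (intro smooth_sum[OF open_D] smooth_mult[OF open_D] smooth_add[OF open_D]
      smooth_diff[OF open_D] smooth_on_pd smooth_christoffel)

lemma smooth_ricci: "smooth_on D (ricci G)"
  unfolding ricci_def[abs_def]
  by (intro smooth_vec_lambda[OF open_D] smooth_sum[OF open_D] smooth_riemann)

lemma smooth_schouten: "smooth_on D (schouten G)"
  unfolding schouten_def[abs_def] schoutenJ_def gtrace_def divide_inverse[of "sum _ _"]
  by (intro smooth_scaleR[OF open_D] smooth_const smooth_diff[OF open_D]
      smooth_sum[OF open_D] smooth_mult[OF open_D] smooth_vec_nth[OF open_D] smooth_ricci smooth_G smooth_Ginv)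

lemma lower_christoffel:
  assumes "x \<in> D"
  shows "(\<Sum>k\<in>UNIV. christoffel G x k i j * G x $ k $ m)
    = (pd i G x $ m $ j + pd j G x $ m $ i - pd m G x $ i $ j) / 2"
proof -
  let ?l = "\<lambda>l. pd i G x $ l $ j + pd j G x $ l $ i - pd l G x $ i $ j"
  have "(\<Sum>k\<in>UNIV. christoffel G x k i j * G x $ k $ m)
    = (\<Sum>k\<in>UNIV. \<Sum>l\<in>UNIV. Ginv G x $ l $ k * G x $ k $ m * ?l l / 2)"
    using Ginv_sym[OF assms]
    by (simp add: christoffel_def sum_distrib_right sum_distrib_left sum_divide_distrib mult.assoc mult.left_commute mult.commute)
  also have "\<dots> = (\<Sum>l\<in>UNIV. \<Sum>k\<in>UNIV. Ginv G x $ l $ k * G x $ k $ m * ?l l / 2)"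
    by (rule sum.swap)
  also have "\<dots> = (\<Sum>l\<in>UNIV. (\<Sum>k\<in>UNIV. Ginv G x $ l $ k * G x $ k $ m) * ?l l / 2)"
    by (simp only: sum_distrib_right sum_divide_distrib)
  also have "\<dots> = ?l m / 2"
    by (simp add: Ginv_G[OF assms] if_distrib[of "\<lambda>u. u * _"] if_distrib[of "\<lambda>u. u / _"] cong: if_cong)
  finally show ?thesis .
qed

text \<open>This is \<nabla> g = 0 in matrix form: in the sum of the two lowered Christoffel symbols
  all derivatives of the metric cancel except the one in direction a.\<close>

lemma pd_G:
  assumes "x \<in> D"
  shows "pd a G x = gam G a x ** G x + G x ** transpose (gam G a x)"
proof -
  have "pd a G x $ b $ c = (\<Sum>e\<in>UNIV. christoffel G x e a b * G x $ e $ c)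
      + (\<Sum>e\<in>UNIV. G x $ b $ e * christoffel G x e a c)" for b c
  proof -
    have "(\<Sum>e\<in>UNIV. G x $ b $ e * christoffel G x e a c) = (\<Sum>e\<in>UNIV. christoffel G x e a c * G x $ e $ b)"
      using G_sym[OF assms, of b] by (simp add: mult.commute)
    then show ?thesis
      using pd_G_sym[OF assms, of a b c] pd_G_sym[OF assms, of b a c] pd_G_sym[OF assms, of c a b]
      by (simp add: lower_christoffel[OF assms] field_simps)
  qed
  then show ?thesis
    by (simp add: vec_eq_iff matrix_matrix_mult_def gam_def transpose_def)
qed

lemma pd_Ginv:
  assumes "x \<in> D"
  shows "pd a (Ginv G) x = - (Ginv G x ** gam G a x) - transpose (gam G a x) ** Ginv G x"
proof -
  have "pd a (\<lambda>y. Ginv G y ** G y) x = pd a (\<lambda>y. mat 1) x"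
    by (rule pd_cong[OF open_D assms Ginv_left])
  then have "pd a (Ginv G) x ** G x = - (Ginv G x ** pd a G x)"
    using pd_bilinear[OF bounded_bilinear_matrix_matrix_mult
        smooth_on_differentiable[OF smooth_Ginv open_D assms] differentiable_G[OF assms], of a]
    by (simp add: add_eq_0_iff)
  then have "pd a (Ginv G) x = - (Ginv G x ** pd a G x) ** Ginv G x"
    using Ginv_right[OF assms] by (metis matrix_mul_assoc matrix_mul_rid)
  also have "\<dots> = - (Ginv G x ** gam G a x ** (G x ** Ginv G x)
      + (Ginv G x ** G x) ** transpose (gam G a x) ** Ginv G x)"
    by (simp only: pd_G[OF assms] matrix_mul_assoc
        bounded_bilinear.add_left[OF bounded_bilinear_matrix_matrix_mult]
        bounded_bilinear.add_right[OF bounded_bilinear_matrix_matrix_mult]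
        bounded_bilinear.minus_left[OF bounded_bilinear_matrix_matrix_mult])
  finally show ?thesis
    by (simp add: Ginv_right[OF assms] Ginv_left[OF assms])
qed

end

section \<open>The tractor metric and the middle block of the curvature\<close>

locale tractor_form = riemannian D G
  for D :: "(real^'n::finite) set" and G :: "real^'n \<Rightarrow> real^'n^'n" +
  fixes P :: "real^'n \<Rightarrow> real^'n^'n"
  assumes smooth_P: "smooth_on D P"
begin

lemma linear_tform: "linear (tform G P a x)"
  by (rule linearI)
    (auto simp: tform_def matrix_vector_right_distrib matrix_vector_mult_scaleR inner_add_right
      scaleR_add_left algebra_simps)

lemma smooth_tform: "smooth_on D (\<lambda>x. tform G P a x w)"
  unfolding tform_def
  by (intro smooth_Pair[OF open_D] smooth_const smooth_add[OF open_D] smooth_minus[OF open_D]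
      smooth_scaleR[OF open_D] smooth_inner[OF open_D] smooth_matrix_vector_mult[OF open_D]
      smooth_vec_nth[OF open_D] smooth_gam smooth_G smooth_P smooth_Ginv)

sublocale connection D "tform G P"
  by unfold_locales (auto intro: open_D smooth_familyI linear_tform smooth_tform)

lemma cov_components:
  fixes V :: "real^'n \<Rightarrow> 'n tractor"
  assumes "smooth_on D V" "x \<in> D"
  shows "cov (tform G P) a V x =
    (pd a (\<lambda>y. fst (V y)) x - fst (snd (V x)) $ a,
     pd a (\<lambda>y. fst (snd (V y))) x - gam G a x *v fst (snd (V x)) + snd (snd (V x)) *\<^sub>R (G x $ a)
       + fst (V x) *\<^sub>R (P x $ a),
     pd a (\<lambda>y. snd (snd (V y))) x - P x $ a \<bullet> (Ginv G x *v fst (snd (V x))))"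
proof -
  note d = smooth_on_differentiable[OF assms(1) open_D assms(2)]
  show ?thesis
    using pd_linear[OF bounded_linear_fst d] pd_linear[OF bounded_linear_compose[OF bounded_linear_fst bounded_linear_snd] d]
      pd_linear[OF bounded_linear_compose[OF bounded_linear_snd bounded_linear_snd] d]
    by (cases "pd a V x") (simp add: cov_def tform_def)
qed

text \<open>The \<open>P\<close> terms of the middle and last slots meet in the pairing with
  opposite signs, so the tractor metric is parallel whatever tensor stands in the Schouten
  slot.\<close>

sublocale metric_connection D "tform G P" "\<lambda>x. tractor_h (G x)"
proof unfold_locales
  fix V W :: "real^'n \<Rightarrow> 'n tractor" assume V: "smooth_on D V" and W: "smooth_on D W"
  note sV = smooth_fst[OF open_D V] smooth_snd[OF open_D V]
  note sV' = smooth_fst[OF open_D sV(2)] smooth_snd[OF open_D sV(2)]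
  note sW = smooth_fst[OF open_D W] smooth_snd[OF open_D W]
  note sW' = smooth_fst[OF open_D sW(2)] smooth_snd[OF open_D sW(2)]
  show "smooth_on D (\<lambda>y. tractor_h (G y) (V y) (W y))"
    unfolding tractor_h_eq Ginv_def[symmetric]
    by (intro smooth_add[OF open_D] smooth_inner[OF open_D] smooth_matrix_vector_mult[OF open_D]
        smooth_mult[OF open_D] smooth_Ginv sV sW sV' sW')
  fix x a assume x: "x \<in> D"
  note d = smooth_on_differentiable[OF _ open_D x]
  note b = differentiable_bilinear
  let ?s = "fst (V x)" and ?m = "fst (snd (V x))" and ?r = "snd (snd (V x))"
  let ?s' = "fst (W x)" and ?m' = "fst (snd (W x))" and ?r' = "snd (snd (W x))"
  have dm: "(\<lambda>y. Ginv G y *v fst (snd (W y))) differentiable (at x)"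
    by (intro d smooth_matrix_vector_mult[OF open_D] smooth_Ginv sW')
  have "pd a (\<lambda>y. tractor_h (G y) (V y) (W y)) x =
      ?m \<bullet> (Ginv G x *v pd a (\<lambda>y. fst (snd (W y))) x + pd a (Ginv G) x *v ?m')
      + pd a (\<lambda>y. fst (snd (V y))) x \<bullet> (Ginv G x *v ?m')
      + (?s * pd a (\<lambda>y. snd (snd (W y))) x + pd a (\<lambda>y. fst (V y)) x * ?r')
      + (?r * pd a (\<lambda>y. fst (W y)) x + pd a (\<lambda>y. snd (snd (V y))) x * ?s')"
    unfolding tractor_h_eq Ginv_def[symmetric]
    by (simp add: pd_add b[OF bounded_bilinear_inner d[OF sV'(1)] dm] b[OF bounded_bilinear_mult d[OF sV(1)] d[OF sW'(2)]]
        b[OF bounded_bilinear_mult d[OF sV'(2)] d[OF sW(1)]]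
        pd_bilinear[OF bounded_bilinear_inner d[OF sV'(1)] dm]
        pd_bilinear[OF bounded_bilinear_matrix_vector_mult d[OF smooth_Ginv] d[OF sW'(1)]]
        pd_bilinear[OF bounded_bilinear_mult d[OF sV(1)] d[OF sW'(2)]]
        pd_bilinear[OF bounded_bilinear_mult d[OF sV'(2)] d[OF sW(1)]])
  moreover have "?m \<bullet> (pd a (Ginv G) x *v ?m')
     = - (?m \<bullet> (Ginv G x *v (gam G a x *v ?m'))) - (gam G a x *v ?m) \<bullet> (Ginv G x *v ?m')"
  proof -
    have "?m \<bullet> (transpose A *v w) = (A *v ?m) \<bullet> w" for A :: "real^'n^'n" and w
      by (metis dot_lmul_matrix inner_commute transpose_matrix_vector)
    then show ?thesis
      by (simp add: pd_Ginv[OF x] matrix_vector_mult_diff_rdistrib inner_diff_right matrix_vector_mul_assoc[symmetric]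
          bounded_bilinear.minus_left[OF bounded_bilinear_matrix_vector_mult] del: transpose_matrix_vector)
  qed
  moreover have "(G x $ a) \<bullet> (Ginv G x *v v) = v $ a" for v
    using Ginv_self_adjoint[OF x, of "G x $ a" v] by (simp add: Ginv_G_row[OF x] inner_axis')
  moreover have "v \<bullet> (Ginv G x *v (G x $ a)) = v $ a" for v
    by (simp add: Ginv_G_row[OF x] inner_axis)
  moreover have "v \<bullet> (Ginv G x *v (P x $ a)) = (P x $ a) \<bullet> (Ginv G x *v v)" for v
    by (metis Ginv_self_adjoint[OF x] inner_commute)
  ultimately show "pd a (\<lambda>y. tractor_h (G y) (V y) (W y)) x =
      tractor_h (G x) (cov (tform G P) a V x) (W x) + tractor_h (G x) (V x) (cov (tform G P) a W x)"
    by (simp add: tractor_h_eq Ginv_def[symmetric] cov_components[OF V x] cov_components[OF W x]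
        inner_add_left inner_add_right inner_diff_left inner_diff_right
        matrix_vector_right_distrib matrix_vector_mult_diff_distrib matrix_vector_mult_scaleR algebra_simps)
next
  fix x assume "x \<in> D"
  show "bilinear (tractor_h (G x))"
    unfolding bilinear_def
    by (auto intro!: linearI simp: tractor_h_eq matrix_vector_right_distrib matrix_vector_mult_scaleR
        inner_add_left inner_add_right algebra_simps)
qed

abbreviation h :: "real^'n \<Rightarrow> 'n tractor \<Rightarrow> 'n tractor \<Rightarrow> real" where
  "h x \<equiv> tractor_h (G x)"

abbreviation \<Omega> :: "'n \<Rightarrow> 'n \<Rightarrow> real^'n \<Rightarrow> 'n tractor \<Rightarrow> 'n tractor" where
  "\<Omega> \<equiv> curv (tform G P)"

lemma h_commute: "x \<in> D \<Longrightarrow> h x v w = h x w v"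
  using Ginv_self_adjoint[of x "fst (snd v)" "fst (snd w)"]
  by (simp add: tractor_h_eq Ginv_def[symmetric] inner_commute)

lemma h_X: "h x tX v = fst v" "h x v tX = fst v"
  and h_Y: "h x tY v = snd (snd v)" "h x v tY = snd (snd v)"
  by (simp_all add: tractor_h_eq)

lemma h_Z_row:
  assumes "x \<in> D"
  shows "h x (tZ (G x $ c)) v = fst (snd v) $ c"
  using Ginv_self_adjoint[OF assms, of "G x $ c" "fst (snd v)"]
  by (simp add: tractor_h_eq Ginv_def[symmetric] Ginv_G_row[OF assms] inner_axis')

lemma h_Z_axis: "x \<in> D \<Longrightarrow> h x (tZ (axis a 1)) (tZ (G x $ c)) = (if a = c then 1 else 0)"
  by (simp add: tractor_h_eq Ginv_def[symmetric] Ginv_G_row inner_axis_axis)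

text \<open>The first slot vanishes because the Christoffel symbols are symmetric. In the middle
  slot \<open>P\<close> enters only through products of the off-diagonal blocks of
  \<open>tform\<close>, so no derivative of \<open>P\<close> appears.\<close>

lemma curv_middle:
  assumes x: "x \<in> D"
  shows "fst (\<Omega> a b x (tZ \<mu>)) = 0"
    and "fst (snd (\<Omega> a b x (tZ \<mu>))) $ c =
      - (\<Sum>e\<in>UNIV. riemann G x a b e c * \<mu> $ e) - (P x $ b \<bullet> (Ginv G x *v \<mu>)) * G x $ a $ c
      + (P x $ a \<bullet> (Ginv G x *v \<mu>)) * G x $ b $ c - \<mu> $ b * P x $ a $ c + \<mu> $ a * P x $ b $ c"
proof -
  note d = smooth_on_differentiable[OF smooth_tform open_D x]
  have dc: "(\<lambda>y. christoffel G y e b c) differentiable (at x)" for e b c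
    by (rule smooth_on_differentiable[OF smooth_christoffel open_D x])
  have f: "fst (pd a (\<lambda>y. tform G P b y (tZ \<mu>)) x) = 0" for a b
    by (subst pd_linear[OF bounded_linear_fst d, symmetric]) (simp add: tform_def)
  have m: "fst (snd (pd a (\<lambda>y. tform G P b y (tZ \<mu>)) x)) $ c = - (\<Sum>e\<in>UNIV. pd a (\<lambda>y. christoffel G y e b c) x * \<mu> $ e)"
    for a b c
  proof -
    have "fst (snd (pd a (\<lambda>y. tform G P b y (tZ \<mu>)) x)) $ c = pd a (\<lambda>y. fst (snd (tform G P b y (tZ \<mu>))) $ c) x"
      by (rule pd_linear[OF bounded_linear_compose[OF bounded_linear_vec_nth
            bounded_linear_compose[OF bounded_linear_fst bounded_linear_snd]] d, symmetric])
    also have "\<dots> = pd a (\<lambda>y. - (\<Sum>e\<in>UNIV. christoffel G y e b c * \<mu> $ e)) x"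
      by (simp add: tform_def gam_def matrix_vector_mult_def)
    also have "\<dots> = - (\<Sum>e\<in>UNIV. pd a (\<lambda>y. christoffel G y e b c * \<mu> $ e) x)"
      using differentiable_linear_image[OF bounded_linear_mult_left dc]
      by (subst pd_minus) (auto intro!: differentiable_sum simp: pd_sum)
    finally show ?thesis by (simp add: pd_linear[OF bounded_linear_mult_left dc])
  qed
  have gg: "(gam G a x *v (gam G b x *v \<mu>)) $ c
      = (\<Sum>e\<in>UNIV. (\<Sum>f\<in>UNIV. christoffel G x f a c * christoffel G x e b f) * \<mu> $ e)" for a b c
    by (simp add: gam_def matrix_vector_mult_def sum_distrib_left sum_distrib_right mult.assoc)
      (rule sum.swap)
  have minus: "A *v (- v) = - (A *v v)" for A :: "real^'n^'n" and v
    using matrix_vector_mult_scaleR[of A "-1" v] by simp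
  show "fst (\<Omega> a b x (tZ \<mu>)) = 0"
    using christoffel_sym[OF x, of _ a b]
    by (simp add: curv_def f) (simp add: tform_def gam_def matrix_vector_mult_def)
  show "fst (snd (\<Omega> a b x (tZ \<mu>))) $ c =
      - (\<Sum>e\<in>UNIV. riemann G x a b e c * \<mu> $ e) - (P x $ b \<bullet> (Ginv G x *v \<mu>)) * G x $ a $ c
      + (P x $ a \<bullet> (Ginv G x *v \<mu>)) * G x $ b $ c - \<mu> $ b * P x $ a $ c + \<mu> $ a * P x $ b $ c"
    by (simp add: curv_def m)
      (simp add: tform_def minus gg riemann_def algebra_simps sum.distrib sum_subtractf sum_negf)
qed

end

section \<open>Symmetries of the Riemann and Ricci tensors\<close>

context riemannian
begin

lemma riemann_swap: "riemann G x b a c d = - riemann G x a b c d"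
  by (simp add: riemann_def sum_subtractf)

lemma riemann_cyclic:
  assumes x: "x \<in> D"
  shows "riemann G x a b c d + riemann G x b d c a + riemann G x d a c b = 0"
proof -
  have "pd i (\<lambda>y. christoffel G y c j k) x = pd i (\<lambda>y. christoffel G y c k j) x" for i j k
    by (rule pd_cong[OF open_D x christoffel_sym])
  from this[of a b d] this[of b a d] this[of d a b] show ?thesis
    by (simp add: riemann_def sum_subtractf christoffel_sym[OF x, of _ d b] christoffel_sym[OF x, of _ d a]
        christoffel_sym[OF x, of _ b a])
qed

text \<open>With zero in the Schouten slot the middle block of the tractor curvature is the Riemann
  tensor up to sign, so \<open>curv_skew\<close> is its skewness in the last two indices, and a skew
  tensor has no trace against the symmetric inverse metric.\<close>

lemma riemann_trace:
  assumes x: "x \<in> D"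
  shows "(\<Sum>c\<in>UNIV. riemann G x a b c c) = 0"
proof -
  interpret tractor_form D G "\<lambda>_. 0" by unfold_locales (rule smooth_const)
  define R where "R c d = (\<Sum>e\<in>UNIV. riemann G x a b e c * G x $ d $ e)" for c d
  have "h x (tZ (G x $ c)) (\<Omega> a b x (tZ (G x $ d))) = - R c d" for c d
    by (simp add: h_Z_row[OF x] curv_middle[OF x] R_def)
  then have skew: "R c d = - R d c" for c d
    using curv_skew[OF x, of a b "tZ (G x $ c)" "tZ (G x $ d)"] h_commute[OF x] by simp
  have "(\<Sum>d\<in>UNIV. Ginv G x $ c $ d * R c d) = riemann G x a b c c" for c
  proof -
    have "(\<Sum>d\<in>UNIV. Ginv G x $ c $ d * R c d)
      = (\<Sum>d\<in>UNIV. \<Sum>e\<in>UNIV. riemann G x a b e c * (Ginv G x $ c $ d * G x $ d $ e))"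
      by (simp add: R_def sum_distrib_left ac_simps)
    also have "\<dots> = (\<Sum>e\<in>UNIV. riemann G x a b e c * (\<Sum>d\<in>UNIV. Ginv G x $ c $ d * G x $ d $ e))"
      by (subst sum.swap) (simp add: sum_distrib_left)
    finally show ?thesis by (simp add: Ginv_G[OF x] if_distrib cong: if_cong)
  qed
  then have e: "(\<Sum>c\<in>UNIV. riemann G x a b c c) = (\<Sum>c\<in>UNIV. \<Sum>d\<in>UNIV. Ginv G x $ c $ d * R c d)"
    by simp
  also have "\<dots> = (\<Sum>c\<in>UNIV. \<Sum>d\<in>UNIV. - (Ginv G x $ d $ c * R d c))"
    by (intro sum.cong refl) (metis Ginv_sym[OF x] skew mult_minus_right)
  also have "\<dots> = - (\<Sum>c\<in>UNIV. \<Sum>d\<in>UNIV. Ginv G x $ d $ c * R d c)"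
    by (simp add: sum_negf)
  also have "\<dots> = - (\<Sum>c\<in>UNIV. riemann G x a b c c)"
    unfolding e by (subst sum.swap) simp
  finally show ?thesis by simp
qed

text \<open>A trace of the cyclic identity: the term traced over the last index pair is
  \<open>riemann_trace\<close>, and the other two are Ricci components.\<close>

lemma ricci_sym:
  assumes x: "x \<in> D"
  shows "ricci G x $ b $ d = ricci G x $ d $ b"
proof -
  have "(\<Sum>a\<in>UNIV. riemann G x a b a d) + (\<Sum>a\<in>UNIV. riemann G x b d a a)
      + (\<Sum>a\<in>UNIV. riemann G x d a a b) = 0"
    unfolding sum.distrib[symmetric] by (simp add: riemann_cyclic[OF x])
  moreover have "(\<Sum>a\<in>UNIV. riemann G x d a a b) = - (\<Sum>a\<in>UNIV. riemann G x a d a b)"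
    by (subst riemann_swap) (simp add: sum_negf)
  ultimately show ?thesis
    by (simp add: riemann_trace[OF x] ricci_def)
qed

lemma schouten_sym: "x \<in> D \<Longrightarrow> schouten G x $ a $ b = schouten G x $ b $ a"
  by (simp add: schouten_def ricci_sym[of x a] G_sym[of x a])

end

context tractor_form
begin

lemma Ginv_axis: "(P x $ b) \<bullet> (Ginv G x *v axis a 1) = (\<Sum>e\<in>UNIV. P x $ b $ e * Ginv G x $ e $ a)"
  by (simp add: inner_vec_def matrix_vector_mult_basis column_def)

text \<open>For the Schouten tensor the right-hand side is zero. Conversely, if the left-hand side
  vanishes for some \<open>P\<close>, the identity is the defining equation of the Schouten tensor;
  both readings are used.\<close>

lemma curv_trace:
  assumes x: "x \<in> D"
  shows "(\<Sum>a\<in>UNIV. fst (snd (\<Omega> a b x (tZ (axis a 1)))) $ c)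
    = - ricci G x $ b $ c + (real CARD('n) - 2) * P x $ b $ c + gtrace G x (P x) * G x $ b $ c"
proof -
  have 1: "(\<Sum>a\<in>UNIV. \<Sum>e\<in>UNIV. riemann G x a b e c * axis a 1 $ e) = ricci G x $ b $ c"
    by (simp add: axis_def ricci_def if_distrib cong: if_cong)
  have "(\<Sum>a\<in>UNIV. (P x $ b \<bullet> (Ginv G x *v axis a 1)) * G x $ a $ c)
      = (\<Sum>a\<in>UNIV. \<Sum>e\<in>UNIV. P x $ b $ e * (Ginv G x $ e $ a * G x $ a $ c))"
    unfolding Ginv_axis by (simp add: sum_distrib_right mult.assoc)
  also have "\<dots> = (\<Sum>e\<in>UNIV. P x $ b $ e * (\<Sum>a\<in>UNIV. Ginv G x $ e $ a * G x $ a $ c))"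
    by (subst sum.swap) (simp add: sum_distrib_left)
  finally have 2: "(\<Sum>a\<in>UNIV. (P x $ b \<bullet> (Ginv G x *v axis a 1)) * G x $ a $ c) = P x $ b $ c"
    by (simp add: Ginv_G[OF x] if_distrib cong: if_cong)
  have 3: "(\<Sum>a\<in>UNIV. (P x $ a \<bullet> (Ginv G x *v axis a 1)) * G x $ b $ c) = gtrace G x (P x) * G x $ b $ c"
  proof -
    have eq: "P x $ a $ e * Ginv G x $ e $ a = Ginv G x $ a $ e * P x $ a $ e" for a e
      using Ginv_sym[OF x, of a e] by simp
    then show ?thesis
      unfolding Ginv_axis gtrace_def sum_distrib_right[symmetric] by (simp only: eq)
  qed
  have 4: "(\<Sum>a\<in>UNIV. axis a 1 $ b * P x $ a $ c) = P x $ b $ c"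
    by (simp add: axis_def if_distrib[of "\<lambda>u. u * _"] cong: if_cong)
  have 5: "(\<Sum>a\<in>(UNIV::'n set). axis a 1 $ a * P x $ b $ c) = real CARD('n) * P x $ b $ c"
    by simp
  show ?thesis
    unfolding curv_middle(2)[OF x] sum.distrib sum_subtractf sum_negf 1 2 3 4 5
    by (simp add: algebra_simps)
qed

end

section \<open>Curvature identities for a symmetric tensor in the Schouten slot\<close>

locale sym_tractor_form = tractor_form D G P
  for D :: "(real^'n::finite) set" and G P :: "real^'n \<Rightarrow> real^'n^'n" +
  assumes P_sym: "x \<in> D \<Longrightarrow> P x $ a $ b = P x $ b $ a"
begin

lemma linear_h: "x \<in> D \<Longrightarrow> linear (h x v)" "x \<in> D \<Longrightarrow> linear (\<lambda>v. h x v w)"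
  using bil[of x] unfolding bilinear_def by blast+

lemmas h_simps = linear_add[OF linear_h(1)] linear_add[OF linear_h(2)]
  linear_diff[OF linear_h(1)] linear_diff[OF linear_h(2)] linear_neg[OF linear_h(1)] linear_neg[OF linear_h(2)]
  linear_cmul[OF linear_h(1)] linear_cmul[OF linear_h(2)] linear_sum[OF linear_h(1)] linear_sum[OF linear_h(2)]
  linear_0[OF linear_h(1)] linear_0[OF linear_h(2)]

lemma tform_X: "x \<in> D \<Longrightarrow> tform G P a x tX = tZ (G x $ a)"
  by (simp add: tform_def)

text \<open>The three slots of \<Omega> X measure the failure of symmetry of the metric, of the
  Christoffel symbols and of \<open>P\<close> respectively.\<close>

lemma curv_X:
  assumes x: "x \<in> D"
  shows "\<Omega> a b x tX = 0"
proof -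
  have X: "pd a (\<lambda>y. tform G P b y tX) x = tZ (pd a G x $ b)" for a b
  proof -
    have "bounded_linear (\<lambda>M::real^'n^'n. tZ (M $ b))"
      by (intro bounded_linear_Pair bounded_linear_zero bounded_linear_vec_nth)
    from pd_linear[OF this differentiable_G[OF x]] show ?thesis by (simp add: tform_def)
  qed
  have T: "tform G P a x (tZ (G x $ b)) = (- (G x $ b $ a), - (gam G a x *v (G x $ b)), - (P x $ a $ b))" for a b
    by (simp add: tform_def Ginv_G_row[OF x] inner_axis)
  have "pd a G x $ b - gam G a x *v (G x $ b) = pd b G x $ a - gam G b x *v (G x $ a)"
  proof -
    have "(pd a G x $ b - gam G a x *v (G x $ b)) $ c = (\<Sum>e\<in>UNIV. christoffel G x e a b * G x $ e $ c)" for a b c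
      by (simp add: pd_G[OF x] matrix_matrix_mult_def matrix_vector_mult_def transpose_def gam_def mult.commute)
    then show ?thesis using christoffel_sym[OF x, of _ a b] by (simp add: vec_eq_iff)
  qed
  then show ?thesis
    using G_sym[OF x, of a b] P_sym[OF x, of a b]
    by (simp add: curv_def X tform_X[OF x] T zero_prod_def algebra_simps)
qed

lemma fst_curv: "x \<in> D \<Longrightarrow> fst (\<Omega> a b x w) = 0"
  using curv_skew[of x a b w tX] by (simp add: h_X curv_X h_simps)

text \<open>Differentiating \<Omega> X = 0 gives this, because the derivative of X in direction e is
  the frame tractor \<open>tZ (G x $ e)\<close>.\<close>

lemma dcurv_X:
  assumes x: "x \<in> D"
  shows "dcurv (tform G P) e a b x tX = - \<Omega> a b x (tZ (G x $ e))"
proof -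
  have "cov (tform G P) e (\<lambda>y. \<Omega> a b y tX) x = cov (tform G P) e (\<lambda>_. 0) x"
    by (rule cov_cong[OF x]) (rule curv_X)
  then show ?thesis
    by (simp add: dcurv_def cov_const linear_0[OF linear_T[OF x]] tform_X[OF x])
qed

text \<open>Applied to X, the differential Bianchi identity becomes algebraic by
  \<open>dcurv_X\<close>.\<close>

lemma curv_cyclic:
  assumes x: "x \<in> D"
  shows "\<Omega> a b x (tZ (G x $ c)) + \<Omega> b c x (tZ (G x $ a)) + \<Omega> c a x (tZ (G x $ b)) = 0"
proof -
  have "- (\<Omega> a b x (tZ (G x $ c)) + \<Omega> b c x (tZ (G x $ a)) + \<Omega> c a x (tZ (G x $ b))) = 0"
    using bianchi[OF x, of c a b tX] by (simp add: dcurv_X[OF x] algebra_simps)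
  then show ?thesis by (metis neg_equal_0_iff_equal)
qed

text \<open>\<open>nab e a b x w\<close> is \<open>(\<nabla>\<^sub>e \<Omega>\<^sub>a\<^sub>b) w\<close>, now with the Levi-Civita terms.\<close>

definition nab :: "'n \<Rightarrow> 'n \<Rightarrow> 'n \<Rightarrow> real^'n \<Rightarrow> 'n tractor \<Rightarrow> 'n tractor" where
  "nab e a b x w = dcurv (tform G P) e a b x w - (\<Sum>f\<in>UNIV. christoffel G x f e a *\<^sub>R \<Omega> f b x w)
     - (\<Sum>f\<in>UNIV. christoffel G x f e b *\<^sub>R \<Omega> a f x w)"

lemma dcurv_swap: "x \<in> D \<Longrightarrow> dcurv (tform G P) e b a x w = - dcurv (tform G P) e a b x w"
proof -
  assume x: "x \<in> D"
  have "cov (tform G P) e (\<lambda>y. \<Omega> b a y w) x = - cov (tform G P) e (\<lambda>y. \<Omega> a b y w) x"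
  proof -
    have "cov (tform G P) e (\<lambda>y. 0 - \<Omega> a b y w) x
        = cov (tform G P) e (\<lambda>_. 0) x - cov (tform G P) e (\<lambda>y. \<Omega> a b y w) x"
      by (rule cov_diff[OF smooth_const smooth_family_const[OF family_curv] x])
    then show ?thesis
      by (subst curv_swap) (simp add: cov_const linear_0[OF linear_T[OF x]])
  qed
  then show ?thesis unfolding dcurv_def by (simp add: curv_swap[of b a])
qed

lemma nab_swap: "x \<in> D \<Longrightarrow> nab e b a x w = - nab e a b x w"
  unfolding nab_def dcurv_swap[of x e b a] curv_swap[of b] curv_swap[of _ a]
  by (simp add: sum_negf)

text \<open>The Levi-Civita terms cancel in the cyclic sum since the connection on the base is
  torsion-free.\<close>

lemma nab_bianchi:
  assumes x: "x \<in> D"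
  shows "nab e a b x w + nab a b e x w + nab b e a x w = 0"
proof -
  have s: "(\<Sum>f\<in>UNIV. christoffel G x f a e *\<^sub>R \<Omega> b f x w) = - (\<Sum>f\<in>UNIV. christoffel G x f e a *\<^sub>R \<Omega> f b x w)"
    for a b e
    by (subst curv_swap) (simp add: christoffel_sym[OF x, of _ a e] sum_negf)
  show ?thesis
    using bianchi[OF x, of e a b w] s[of a e b] s[of b a e] s[of e b a]
    unfolding nab_def by (simp add: algebra_simps)
qed

lemma linear_nab: "x \<in> D \<Longrightarrow> linear (nab e a b x)"
  unfolding nab_def[abs_def]
  by (intro linear_compose_sub linear_dcurv linear_compose_sum ballI linear_compose_scale_right linear_curv)

lemma nab_skew: "x \<in> D \<Longrightarrow> h x (nab e a b x v) w = - h x v (nab e a b x w)"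
  unfolding nab_def by (simp add: h_simps dcurv_skew curv_skew sum_negf)

lemma nab_X: "x \<in> D \<Longrightarrow> nab e a b x tX = - \<Omega> a b x (tZ (G x $ e))"
  by (simp add: nab_def dcurv_X curv_X)

lemma nab_parallel:
  assumes V: "smooth_on D V" and par: "\<And>a y. y \<in> D \<Longrightarrow> cov (tform G P) a V y = 0" and x: "x \<in> D"
  shows "nab e a b x (V x) = 0"
proof -
  have z: "\<Omega> a b y (V y) = 0" if "y \<in> D" for a b y by (rule parallel_curv[OF V par that])
  have "cov (tform G P) e (\<lambda>y. \<Omega> a b y (V y)) x = cov (tform G P) e (\<lambda>_. 0) x"
    by (rule cov_cong[OF x z])
  then have "dcurv (tform G P) e a b x (V x) = 0"
    using cov_curv_apply[OF V x, of e a b] par[OF x]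
    by (simp add: cov_const linear_0[OF linear_T[OF x]] linear_0[OF linear_curv[OF x]])
  then show ?thesis by (simp add: nab_def z[OF x])
qed

text \<open>\<open>tZ (G y $ c)\<close> is the frame field Z with lower index c. Its derivative
  leaves the Z block along -g Y and -P X; the Y part is the source of every Cotton term in
  \<open>nab_K\<close>.\<close>

lemma cov_Z_row:
  assumes x: "x \<in> D"
  shows "cov (tform G P) e (\<lambda>y. tZ (G y $ c)) x
    = (\<Sum>f\<in>UNIV. christoffel G x f e c *\<^sub>R tZ (G x $ f)) - G x $ e $ c *\<^sub>R tY - P x $ e $ c *\<^sub>R tX"
proof -
  have "bounded_linear (\<lambda>M::real^'n^'n. tZ (M $ c))"
    by (intro bounded_linear_Pair bounded_linear_zero bounded_linear_vec_nth)
  from pd_linear[OF this differentiable_G[OF x]]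
  have "cov (tform G P) e (\<lambda>y. tZ (G y $ c)) x
    = (- (G x $ c $ e), pd e G x $ c - gam G e x *v (G x $ c), - (P x $ e $ c))"
    by (simp add: cov_def tform_def Ginv_G_row[OF x] inner_axis)
  moreover have "pd e G x $ c - gam G e x *v (G x $ c) = (\<Sum>f\<in>UNIV. christoffel G x f e c *\<^sub>R (G x $ f))"
    by (simp add: vec_eq_iff pd_G[OF x] matrix_matrix_mult_def matrix_vector_mult_def transpose_def gam_def mult.commute)
  moreover have "(\<Sum>f\<in>UNIV. christoffel G x f e c *\<^sub>R tZ (G x $ f)) = tZ (\<Sum>f\<in>UNIV. christoffel G x f e c *\<^sub>R (G x $ f))"
    by (simp add: prod_eq_iff fst_sum snd_sum)
  ultimately show ?thesis using G_sym[OF x, of c e] by simp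
qed

text \<open>\<open>tZ (axis a 1)\<close> is the dual frame field Z with upper index a, which is why
  the Christoffel terms have the opposite sign from \<open>cov_Z_row\<close> and the metric is
  replaced by a Kronecker delta.\<close>

lemma tform_Z_axis:
  "tform G P e x (tZ (axis a 1)) = - (if a = e then tY else 0)
    - (\<Sum>f\<in>UNIV. christoffel G x a e f *\<^sub>R tZ (axis f 1)) - (P x $ e \<bullet> (Ginv G x *v axis a 1)) *\<^sub>R tX"
proof -
  have "gam G e x *v axis a 1 = (\<Sum>f\<in>UNIV. christoffel G x a e f *\<^sub>R axis f 1)"
  proof -
    have "(gam G e x *v axis a 1) $ i = christoffel G x a e i" for i
      by (simp add: matrix_vector_mult_basis column_def gam_def)
    then show ?thesis
      by (simp add: vec_eq_iff) (simp add: axis_def if_distrib cong: if_cong)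
  qed
  moreover have "(\<Sum>f\<in>UNIV. christoffel G x a e f *\<^sub>R tZ (axis f 1)) = tZ (\<Sum>f\<in>UNIV. christoffel G x a e f *\<^sub>R axis f 1)"
    by (simp add: prod_eq_iff fst_sum snd_sum)
  ultimately show ?thesis
    by (auto simp: tform_def axis_def)
qed

lemma sum_Ginv_Z_row: "x \<in> D \<Longrightarrow> (\<Sum>c\<in>UNIV. Ginv G x $ a $ c *\<^sub>R tZ (G x $ c)) = tZ (axis a 1)"
  by (simp add: prod_eq_iff fst_sum snd_sum vec_eq_iff Ginv_G axis_def eq_commute)

lemma tractor_decomp: "w = fst w *\<^sub>R tY + tZ (fst (snd w)) + snd (snd w) *\<^sub>R tX"
  by (cases w) auto

lemma nondegenerate:
  assumes x: "x \<in> D" and "h x tX v = 0" "h x tY v = 0" "\<And>c. h x (tZ (G x $ c)) v = 0"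
  shows "v = 0"
  using assms(2-4) by (simp add: h_X h_Y h_Z_row[OF x] prod_eq_iff vec_eq_iff)

lemma Z_expand: "x \<in> D \<Longrightarrow> tZ \<mu> = (\<Sum>c\<in>UNIV. (Ginv G x *v \<mu>) $ c *\<^sub>R tZ (G x $ c))"
proof -
  assume x: "x \<in> D"
  have "(\<Sum>c\<in>UNIV. (Ginv G x *v \<mu>) $ c *\<^sub>R (G x $ c)) = transpose (G x) *v (Ginv G x *v \<mu>)"
    by (simp add: vec_eq_iff matrix_vector_mult_def transpose_def mult.commute)
  also have "\<dots> = \<mu>"
    by (simp add: sym[OF x] matrix_vector_mul_assoc Ginv_right[OF x] del: transpose_matrix_vector)
  finally show ?thesis by (simp add: prod_eq_iff fst_sum snd_sum)
qed

end

section \<open>The Yang-Mills equation\<close>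

text \<open>The cyclic identity is taken at the four cyclic shifts of the indices; combined with the
  skew symmetries, everything cancels except the two terms compared.\<close>

lemma pair_symmetry:
  fixes K :: "'i \<Rightarrow> 'i \<Rightarrow> 'i \<Rightarrow> 'i \<Rightarrow> real"
  assumes "\<And>a b c d. K b a c d = - K a b c d" "\<And>a b c d. K a b d c = - K a b c d"
    and "\<And>a b c d. K a b c d + K b d c a + K d a c b = 0"
  shows "K a b c d = K c d a b"
  using assms(3)[of a b c d] assms(3)[of b c d a] assms(3)[of c d a b] assms(3)[of d a b c]
    assms(1)[of a b] assms(1)[of b c] assms(1)[of c d] assms(1)[of d a] assms(1)[of a c] assms(1)[of b d]
    assms(2)[of _ _ a b] assms(2)[of _ _ b c] assms(2)[of _ _ c d] assms(2)[of _ _ d a] assms(2)[of _ _ a c]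
    assms(2)[of _ _ b d]
  by smt

section \<open>The divergence of the tractor curvature\<close>

locale schouten_form = riemannian D G
  for D :: "(real^'n::finite) set" and G :: "real^'n \<Rightarrow> real^'n^'n" +
  assumes dim: "3 \<le> CARD('n)"
begin

sublocale sym_tractor_form D G "schouten G"
  by unfold_locales (auto intro: smooth_schouten schouten_sym)

lemma tconn2_eq: "tconn2 G a b V x = cov (tform G (schouten G)) a (cov (tform G (schouten G)) b V) x
    - (\<Sum>e\<in>UNIV. christoffel G x e a b *\<^sub>R cov (tform G (schouten G)) e V x)"
  unfolding tconn2_def tconn_eq_cov[abs_def] by simp

lemma tcurv_eq:
  assumes x: "x \<in> D"
  shows "tcurv G a b x w = \<Omega> a b x w"
  unfolding tcurv_def tconn2_eq christoffel_sym[OF x, of _ b a]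
  using cov_commutator[OF smooth_const x, of a b w] by simp

lemma dtcurv_eq:
  assumes x: "x \<in> D"
  shows "dtcurv G e a b x w = nab e a b x w"
proof -
  have "cov (tform G (schouten G)) e (\<lambda>y. tcurv G a b y w) x = cov (tform G (schouten G)) e (\<lambda>y. \<Omega> a b y w) x"
    by (rule cov_cong[OF x tcurv_eq])
  then show ?thesis
    by (simp add: dtcurv_def nab_def dcurv_def tconn_eq_cov tcurv_eq[OF x] cov_const)
qed

text \<open>The trace of \<Omega> against Z turns out to be a multiple of X, and this is the
  coefficient, a trace of the Cotton tensor. It vanishes by \<open>tr_zero\<close>, but the proof of
  that differentiates the trace, so it has to be carried along.\<close>

definition tr :: "'n \<Rightarrow> real^'n \<Rightarrow> real" where
  "tr b x = snd (snd (\<Sum>a\<in>UNIV. \<Omega> a b x (tZ (axis a 1))))"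

lemma schouten_trace:
  assumes x: "x \<in> D"
  shows "ricci G x = (real CARD('n) - 2) *\<^sub>R schouten G x + gtrace G x (schouten G x) *\<^sub>R G x"
  using ricci_schouten[OF dim, of G x] schoutenJ_trace[of G x, OF dim invertible_G[OF x] sym[OF x]] by simp

lemma sum_curv_axis:
  assumes x: "x \<in> D"
  shows "(\<Sum>a\<in>UNIV. \<Omega> a b x (tZ (axis a 1))) = tr b x *\<^sub>R tX"
proof -
  have "fst (snd (\<Sum>a\<in>UNIV. \<Omega> a b x (tZ (axis a 1)))) $ c = 0" for c
  proof -
    have "fst (snd (\<Sum>a\<in>UNIV. \<Omega> a b x (tZ (axis a 1)))) $ c
        = (\<Sum>a\<in>UNIV. fst (snd (\<Omega> a b x (tZ (axis a 1)))) $ c)"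
      by (simp add: fst_sum snd_sum)
    also have "\<dots> = 0"
      unfolding curv_trace[OF x] by (subst schouten_trace[OF x]) simp
    finally show ?thesis .
  qed
  moreover have "fst (\<Sum>a\<in>UNIV. \<Omega> a b x (tZ (axis a 1))) = 0"
    by (simp add: fst_sum fst_curv[OF x])
  ultimately show ?thesis
    by (simp add: prod_eq_iff vec_eq_iff tr_def)
qed

lemma smooth_tr: "smooth_on D (tr b)"
  unfolding tr_def[abs_def]
  by (intro smooth_snd[OF open_D] smooth_sum[OF open_D] smooth_family_const[OF family_curv])

text \<open>The derivative of \<open>sum_curv_axis\<close>: differentiating Z contributes \<Omega> Y
  and differentiating X contributes Z. The multiple of X can stay unspecified, as it is only paired
  with elements of the Z block.\<close>

lemma sum_nab_axis_aux:
  assumes x: "x \<in> D"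
  shows "\<exists>s. (\<Sum>a\<in>UNIV. nab e a b x (tZ (axis a 1))) = tr b x *\<^sub>R tZ (G x $ e) + \<Omega> e b x tY + s *\<^sub>R tX"
proof -
  let ?T = "tform G (schouten G)"
  let ?Z = "\<lambda>a. tZ (axis a 1)"
  let ?g = "\<lambda>f. christoffel G x f"
  have "?T e x (?Z a) = - (if a = e then tY else 0) - (\<Sum>f\<in>UNIV. ?g a e f *\<^sub>R ?Z f)
      - (schouten G x $ e \<bullet> (Ginv G x *v axis a 1)) *\<^sub>R tX" for a
    by (rule tform_Z_axis)
  then have "\<Omega> a b x (?T e x (?Z a)) = - (if a = e then \<Omega> a b x tY else 0) - (\<Sum>f\<in>UNIV. ?g a e f *\<^sub>R \<Omega> a b x (?Z f))" for a
    using linear_curv[OF x, of a b]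
    by (simp only: linear_diff linear_neg linear_sum linear_cmul curv_X[OF x] scaleR_zero_right diff_0_right)
      (simp add: linear_0)
  then have 1: "(\<Sum>a\<in>UNIV. \<Omega> a b x (?T e x (?Z a)))
      = - \<Omega> e b x tY - (\<Sum>a\<in>UNIV. \<Sum>f\<in>UNIV. ?g a e f *\<^sub>R \<Omega> a b x (?Z f))"
    by (simp add: sum_subtractf sum_negf)
  have "cov ?T e (\<lambda>y. \<Sum>a\<in>UNIV. \<Omega> a b y (?Z a)) x = cov ?T e (\<lambda>y. tr b y *\<^sub>R tX) x"
    by (rule cov_cong[OF x sum_curv_axis])
  also have "\<dots> = tr b x *\<^sub>R tZ (G x $ e) + pd e (tr b) x *\<^sub>R tX"
    by (simp only: cov_scaleR[OF smooth_tr smooth_const x] cov_const tform_X[OF x])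
  finally have 2: "(\<Sum>a\<in>UNIV. cov ?T e (\<lambda>y. \<Omega> a b y (?Z a)) x) = tr b x *\<^sub>R tZ (G x $ e) + pd e (tr b) x *\<^sub>R tX"
    by (subst (asm) cov_sum[OF smooth_family_const[OF family_curv] x]) auto
  have 3: "(\<Sum>a\<in>UNIV. \<Sum>f\<in>UNIV. ?g f e b *\<^sub>R \<Omega> a f x (?Z a)) = (\<Sum>f\<in>UNIV. ?g f e b * tr f x) *\<^sub>R tX"
    by (subst sum.swap) (simp only: scaleR_sum_right[symmetric] sum_curv_axis[OF x] scaleR_scaleR scaleR_sum_left)
  have "(\<Sum>a\<in>UNIV. nab e a b x (?Z a)) = (\<Sum>a\<in>UNIV. cov ?T e (\<lambda>y. \<Omega> a b y (?Z a)) x)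
      - (\<Sum>a\<in>UNIV. \<Omega> a b x (?T e x (?Z a)))
      - (\<Sum>a\<in>UNIV. \<Sum>f\<in>UNIV. ?g f e a *\<^sub>R \<Omega> f b x (?Z a))
      - (\<Sum>a\<in>UNIV. \<Sum>f\<in>UNIV. ?g f e b *\<^sub>R \<Omega> a f x (?Z a))"
    by (simp add: nab_def dcurv_def sum_subtractf)
  also have "(\<Sum>a\<in>UNIV. \<Sum>f\<in>UNIV. ?g f e a *\<^sub>R \<Omega> f b x (?Z a)) = (\<Sum>a\<in>UNIV. \<Sum>f\<in>UNIV. ?g a e f *\<^sub>R \<Omega> a b x (?Z f))"
    by (rule sum.swap)
  finally have "(\<Sum>a\<in>UNIV. nab e a b x (?Z a)) = tr b x *\<^sub>R tZ (G x $ e) + \<Omega> e b x tY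
      + (pd e (tr b) x - (\<Sum>f\<in>UNIV. ?g f e b * tr f x)) *\<^sub>R tX"
    unfolding 1 2 3 scaleR_diff_left by simp
  then show ?thesis by blast
qed

lemma sum_nab_cyc:
  assumes x: "x \<in> D"
  shows "(\<Sum>a\<in>UNIV. nab a b e x (w a)) = (\<Sum>a\<in>UNIV. nab b a e x (w a)) - (\<Sum>a\<in>UNIV. nab e a b x (w a))"
proof -
  have "nab a b e x w = nab b a e x w - nab e a b x w" for a w
  proof -
    have "nab a b e x w = (nab e a b x w + nab a b e x w + nab b e a x w) - nab b e a x w - nab e a b x w"
      by simp
    then show ?thesis
      unfolding nab_bianchi[OF x] nab_swap[OF x, of b a e] by simp
  qed
  then show ?thesis by (simp add: sum_subtractf)
qed

text \<open>A contracted Bianchi identity. Pairing \<open>sum_nab_axis_aux\<close> with Z and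
  tracing gives n - 1 times \<open>tr\<close> in one way (A) and twice \<open>tr\<close> in the
  other (B). The Bianchi identity and skewness yield A - B = - A, so (2 n - 4) times
  \<open>tr\<close> is zero.\<close>

lemma tr_zero:
  assumes x: "x \<in> D"
  shows "tr e x = 0"
proof -
  let ?Z = "\<lambda>a. tZ (axis a 1)"
  let ?n = "real CARD('n)"
  define R where "R e b = (\<Sum>a\<in>UNIV. nab e a b x (?Z a))" for e b
  have hX: "h x (?Z b) tX = 0" for b by (simp add: h_X)
  have hR: "h x (?Z c) (R e b) = tr b x * (if c = e then 1 else 0) + h x (?Z c) (\<Omega> e b x tY)" for c e b
  proof -
    obtain s where "R e b = tr b x *\<^sub>R tZ (G x $ e) + \<Omega> e b x tY + s *\<^sub>R tX"
      using sum_nab_axis_aux[OF x] unfolding R_def by blast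
    then show ?thesis
      by (simp only: h_simps x h_Z_axis hX real_scaleR_def mult_zero_right add_0_right)
  qed
  have Y: "(\<Sum>b\<in>UNIV. h x (?Z b) (\<Omega> b e x tY)) = - tr e x"
  proof -
    have "h x (?Z b) (\<Omega> b e x tY) = - h x (\<Omega> b e x (?Z b)) tY" for b
      using curv_skew[OF x, of b e "?Z b" tY] by simp
    then have "(\<Sum>b\<in>UNIV. h x (?Z b) (\<Omega> b e x tY)) = - h x (\<Sum>b\<in>UNIV. \<Omega> b e x (?Z b)) tY"
      by (simp add: h_simps x sum_negf)
    then show ?thesis by (simp add: sum_curv_axis[OF x] h_Y)
  qed
  have Y': "(\<Sum>b\<in>UNIV. h x (?Z b) (\<Omega> e b x tY)) = tr e x"
  proof -
    have "h x (?Z b) (\<Omega> e b x tY) = - h x (?Z b) (\<Omega> b e x tY)" for b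
      by (subst curv_swap) (simp only: h_simps x)
    then show ?thesis using Y by (simp add: sum_negf)
  qed
  have A: "(\<Sum>b\<in>UNIV. h x (?Z b) (R b e)) = (?n - 1) * tr e x"
    by (simp add: hR sum.distrib Y algebra_simps)
  have B: "(\<Sum>b\<in>UNIV. h x (?Z b) (R e b)) = 2 * tr e x"
    by (simp only: hR sum.distrib Y') (simp add: if_distrib[of "\<lambda>u. _ * u"] cong: if_cong)
  have "(\<Sum>b\<in>UNIV. h x (?Z b) (R b e - R e b)) = (\<Sum>b\<in>UNIV. \<Sum>a\<in>UNIV. h x (?Z b) (nab a b e x (?Z a)))"
    unfolding R_def by (simp only: sum_nab_cyc[OF x, symmetric] h_simps x)
  \<comment> \<open>Skewness exchanges the two Z factors; renaming the summation indices then brings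
    back minus the first trace.\<close>
  also have "\<dots> = (\<Sum>b\<in>UNIV. \<Sum>a\<in>UNIV. - h x (?Z a) (nab a b e x (?Z b)))"
    by (intro sum.cong refl) (metis nab_skew[OF x] h_commute[OF x] minus_minus)
  also have "\<dots> = - (\<Sum>a\<in>UNIV. h x (?Z a) (R a e))"
    unfolding R_def by (subst sum.swap) (simp only: h_simps x sum_negf)
  finally have "(\<Sum>b\<in>UNIV. h x (?Z b) (R b e)) - (\<Sum>b\<in>UNIV. h x (?Z b) (R e b)) = - (\<Sum>a\<in>UNIV. h x (?Z a) (R a e))"
    by (simp only: h_simps x sum_subtractf)
  then have "(2 * ?n - 4) * tr e x = 0"
    unfolding A B by (simp add: algebra_simps)
  then show ?thesis using dim by auto
qed

lemma sum_nab_axis: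
  assumes x: "x \<in> D"
  shows "\<exists>s. (\<Sum>a\<in>UNIV. nab e a b x (tZ (axis a 1))) = \<Omega> e b x tY + s *\<^sub>R tX"
  using sum_nab_axis_aux[OF x, of e b] by (simp add: tr_zero[OF x] zero_prod_def[symmetric])

definition YM :: "'n \<Rightarrow> real^'n \<Rightarrow> 'n tractor \<Rightarrow> 'n tractor" where
  "YM b x w = (\<Sum>e\<in>UNIV. \<Sum>a\<in>UNIV. Ginv G x $ e $ a *\<^sub>R nab e a b x w)"

lemma linear_YM: "x \<in> D \<Longrightarrow> linear (YM b x)"
  unfolding YM_def[abs_def]
  by (intro linear_compose_sum ballI linear_compose_scale_right linear_nab)

lemma YM_skew: "x \<in> D \<Longrightarrow> h x (YM b x v) w = - h x v (YM b x w)"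
  unfolding YM_def by (simp add: h_simps nab_skew sum_negf)

text \<open>By \<open>nab_X\<close> the divergence applied to X is minus the trace of \<Omega>
  against Z, which \<open>tr_zero\<close> has shown to vanish.\<close>

lemma YM_X:
  assumes x: "x \<in> D"
  shows "YM b x tX = 0"
proof -
  have "YM b x tX = - (\<Sum>e\<in>UNIV. \<Sum>a\<in>UNIV. Ginv G x $ e $ a *\<^sub>R \<Omega> a b x (tZ (G x $ e)))"
    by (simp add: YM_def nab_X[OF x] sum_negf)
  also have "(\<Sum>e\<in>UNIV. \<Sum>a\<in>UNIV. Ginv G x $ e $ a *\<^sub>R \<Omega> a b x (tZ (G x $ e)))
      = (\<Sum>a\<in>UNIV. \<Omega> a b x (\<Sum>e\<in>UNIV. Ginv G x $ a $ e *\<^sub>R tZ (G x $ e)))"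
    using linear_curv[OF x]
    by (subst sum.swap) (simp only: linear_sum linear_cmul Ginv_sym[OF x])
  also have "\<dots> = 0"
    by (simp only: sum_Ginv_Z_row[OF x] sum_curv_axis[OF x] tr_zero[OF x] scaleR_zero_left)
  finally show ?thesis by simp
qed

abbreviation K :: "'n \<Rightarrow> 'n \<Rightarrow> 'n \<Rightarrow> 'n \<Rightarrow> real^'n \<Rightarrow> real" where
  "K a b c d y \<equiv> h y (tZ (G y $ c)) (\<Omega> a b y (tZ (G y $ d)))"

text \<open>The Y-Z block of the curvature; up to sign this is the Cotton tensor, just as
  \<open>K\<close> is the Weyl tensor by \<open>weyl_eq_K\<close>.\<close>

abbreviation cotton :: "'n \<Rightarrow> 'n \<Rightarrow> 'n \<Rightarrow> real^'n \<Rightarrow> real" where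
  "cotton a b d y \<equiv> h y tY (\<Omega> a b y (tZ (G y $ d)))"

lemma K_swap: "x \<in> D \<Longrightarrow> K b a c d x = - K a b c d x"
  by (subst curv_swap) (simp only: h_simps)

lemma K_skew: "x \<in> D \<Longrightarrow> K a b d c x = - K a b c d x"
  using curv_skew[of x a b "tZ (G x $ c)" "tZ (G x $ d)"] h_commute[of x] by simp

lemma K_pair:
  assumes x: "x \<in> D"
  shows "K a b c d x = K c d a b x"
proof (rule pair_symmetry[of "\<lambda>a b c d. K a b c d x"])
  fix a b c d
  have "K a b c d x + K b d c a x + K d a c b x
      = h x (tZ (G x $ c)) (\<Omega> a b x (tZ (G x $ d)) + \<Omega> b d x (tZ (G x $ a)) + \<Omega> d a x (tZ (G x $ b)))"
    by (simp only: h_simps x)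
  then show "K a b c d x + K b d c a x + K d a c b x = 0"
    by (simp only: curv_cyclic[OF x] h_simps x)
qed (fact K_swap[OF x] K_skew[OF x])+

text \<open>Apart from the last two summands, the right-hand side is the Levi-Civita derivative of
  the Weyl tensor. Those two come from the Y parts of the derivatives of the frame fields Z with
  indices c and d.\<close>

lemma nab_K:
  assumes x: "x \<in> D"
  shows "h x (tZ (G x $ c)) (nab e a b x (tZ (G x $ d))) = pd e (K a b c d) x
    - (\<Sum>f\<in>UNIV. christoffel G x f e a * K f b c d x) - (\<Sum>f\<in>UNIV. christoffel G x f e b * K a f c d x)
    - (\<Sum>f\<in>UNIV. christoffel G x f e c * K a b f d x) - (\<Sum>f\<in>UNIV. christoffel G x f e d * K a b c f x)
    + G x $ e $ c * cotton a b d x - G x $ e $ d * cotton a b c x"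
proof -
  let ?T = "tform G (schouten G)"
  have s: "smooth_on D (\<lambda>y. tZ (G y $ c))" for c
    by (intro smooth_Pair[OF open_D] smooth_const smooth_vec_nth[OF open_D] smooth_G)
  have "pd e (K a b c d) x = h x (cov ?T e (\<lambda>y. tZ (G y $ c)) x) (\<Omega> a b x (tZ (G x $ d)))
      + h x (tZ (G x $ c)) (cov ?T e (\<lambda>y. \<Omega> a b y (tZ (G y $ d))) x)"
    by (rule compat[OF s smooth_family_apply[OF open_D family_curv s] x])
  also have "cov ?T e (\<lambda>y. \<Omega> a b y (tZ (G y $ d))) x = dcurv ?T e a b x (tZ (G x $ d))
      + \<Omega> a b x (cov ?T e (\<lambda>y. tZ (G y $ d)) x)"
    by (rule cov_curv_apply[OF s x])
  also have "h x (cov ?T e (\<lambda>y. tZ (G y $ c)) x) (\<Omega> a b x (tZ (G x $ d)))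
      = (\<Sum>f\<in>UNIV. christoffel G x f e c * K a b f d x) - G x $ e $ c * cotton a b d x"
    by (simp only: cov_Z_row[OF x] h_simps x real_scaleR_def h_X fst_curv mult_zero_right diff_0_right)
  also have "\<Omega> a b x (cov ?T e (\<lambda>y. tZ (G y $ d)) x)
      = (\<Sum>f\<in>UNIV. christoffel G x f e d *\<^sub>R \<Omega> a b x (tZ (G x $ f))) - G x $ e $ d *\<^sub>R \<Omega> a b x tY"
    using linear_curv[OF x, of a b]
    by (simp only: cov_Z_row[OF x] linear_diff linear_sum linear_cmul curv_X[OF x] scaleR_zero_right diff_0_right)
  also have "h x (tZ (G x $ c)) (dcurv ?T e a b x (tZ (G x $ d)) + ((\<Sum>f\<in>UNIV. christoffel G x f e d *\<^sub>R \<Omega> a b x (tZ (G x $ f)))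
      - G x $ e $ d *\<^sub>R \<Omega> a b x tY))
    = h x (tZ (G x $ c)) (dcurv ?T e a b x (tZ (G x $ d))) + ((\<Sum>f\<in>UNIV. christoffel G x f e d * K a b c f x)
      - G x $ e $ d * h x (tZ (G x $ c)) (\<Omega> a b x tY))"
    by (simp only: h_simps x real_scaleR_def)
  finally have 1: "h x (tZ (G x $ c)) (dcurv ?T e a b x (tZ (G x $ d))) = pd e (K a b c d) x
      - ((\<Sum>f\<in>UNIV. christoffel G x f e c * K a b f d x) - G x $ e $ c * cotton a b d x)
      - ((\<Sum>f\<in>UNIV. christoffel G x f e d * K a b c f x) - G x $ e $ d * h x (tZ (G x $ c)) (\<Omega> a b x tY))"
    by linarith
  have 2: "h x (tZ (G x $ c)) (\<Omega> a b x tY) = - cotton a b c x"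
    using curv_skew[OF x, of a b "tZ (G x $ c)" tY] h_commute[OF x] by simp
  have "h x (tZ (G x $ c)) (nab e a b x (tZ (G x $ d))) = h x (tZ (G x $ c)) (dcurv ?T e a b x (tZ (G x $ d)))
      - (\<Sum>f\<in>UNIV. christoffel G x f e a * K f b c d x) - (\<Sum>f\<in>UNIV. christoffel G x f e b * K a f c d x)"
    unfolding nab_def by (simp only: h_simps x real_scaleR_def)
  then show ?thesis unfolding 1 2 by (simp only: algebra_simps)
qed

text \<open>Pair symmetry survives differentiation. It exchanges the form indices of \<Omega> with
  its endomorphism indices, so that a divergence over a form index becomes a contraction with Z,
  which \<open>sum_nab_axis\<close> evaluates.\<close>

lemma nab_K_pair:
  assumes x: "x \<in> D"
  shows "h x (tZ (G x $ c)) (nab e a b x (tZ (G x $ d))) - G x $ e $ c * cotton a b d x + G x $ e $ d * cotton a b c x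
    = h x (tZ (G x $ a)) (nab e c d x (tZ (G x $ b))) - G x $ e $ a * cotton c d b x + G x $ e $ b * cotton c d a x"
proof -
  have "pd e (K a b c d) x = pd e (K c d a b) x"
    by (rule pd_cong[OF open_D x K_pair])
  moreover have "K a b c d x = K c d a b x" for a b c d by (rule K_pair[OF x])
  ultimately show ?thesis
    unfolding nab_K[OF x] by (simp only: algebra_simps)
qed

lemma contract_G: "x \<in> D \<Longrightarrow> (\<Sum>e\<in>UNIV. \<Sum>a\<in>UNIV. Ginv G x $ e $ a * (G x $ e $ c * f a)) = f c"
proof -
  assume x: "x \<in> D"
  have "(\<Sum>e\<in>UNIV. \<Sum>a\<in>UNIV. Ginv G x $ e $ a * (G x $ e $ c * f a))
      = (\<Sum>a\<in>UNIV. \<Sum>e\<in>UNIV. Ginv G x $ a $ e * G x $ e $ c * f a)"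
    by (subst sum.swap) (simp only: Ginv_sym[OF x] mult.assoc)
  also have "\<dots> = (\<Sum>a\<in>UNIV. (if a = c then 1 else 0) * f a)"
    by (simp only: sum_distrib_right[symmetric] Ginv_G[OF x])
  finally show ?thesis by (simp add: if_distrib[of "\<lambda>u. u * _"] cong: if_cong)
qed

text \<open>In dimension four the remaining multiple of the Cotton tensor is a cyclic sum.\<close>

lemma YM_Z_Z:
  assumes x: "x \<in> D" and four: "CARD('n) = 4"
  shows "h x (tZ (G x $ c)) (YM b x (tZ (G x $ d))) = 0"
proof -
  let ?i = "\<lambda>e a. Ginv G x $ e $ a"
  let ?N = "\<lambda>c e a b d. h x (tZ (G x $ c)) (nab e a b x (tZ (G x $ d)))"
  have 1: "h x (tZ (G x $ c)) (YM b x (tZ (G x $ d))) = (\<Sum>e\<in>UNIV. \<Sum>a\<in>UNIV. ?i e a * ?N c e a b d)"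
    unfolding YM_def by (simp only: h_simps x real_scaleR_def)
  have N: "?N c e a b d = ?N a e c d b + G x $ e $ c * cotton a b d x - G x $ e $ d * cotton a b c x
      - G x $ e $ a * cotton c d b x + G x $ e $ b * cotton c d a x" for e a
    using nab_K_pair[OF x, of c e a b d] by linarith
  \<comment> \<open>The derivative index is now contracted with Z. The Bianchi identity splits the
    sum into two traces of the form in \<open>sum_nab_axis\<close>, which contribute the same Cotton
    term; hence the factor 2.\<close>
  have 2: "(\<Sum>e\<in>UNIV. \<Sum>a\<in>UNIV. ?i e a * ?N a e c d b) = 2 * cotton c d b x"
  proof -
    obtain s where s: "(\<Sum>e\<in>UNIV. nab c e d x (tZ (axis e 1))) = \<Omega> c d x tY + s *\<^sub>R tX"
      using sum_nab_axis[OF x] by blast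
    obtain s' where s': "(\<Sum>e\<in>UNIV. nab d e c x (tZ (axis e 1))) = \<Omega> d c x tY + s' *\<^sub>R tX"
      using sum_nab_axis[OF x] by blast
    have "(\<Sum>e\<in>UNIV. \<Sum>a\<in>UNIV. ?i e a * ?N a e c d b)
        = (\<Sum>e\<in>UNIV. h x (\<Sum>a\<in>UNIV. ?i e a *\<^sub>R tZ (G x $ a)) (nab e c d x (tZ (G x $ b))))"
      by (simp only: h_simps x real_scaleR_def)
    also have "\<dots> = - h x (\<Sum>e\<in>UNIV. nab e c d x (tZ (axis e 1))) (tZ (G x $ b))"
      by (simp only: sum_Ginv_Z_row[OF x] h_simps x nab_skew sum_negf minus_minus)
    also have "(\<Sum>e\<in>UNIV. nab e c d x (tZ (axis e 1))) = \<Omega> c d x tY + s *\<^sub>R tX - (\<Omega> d c x tY + s' *\<^sub>R tX)"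
      unfolding sum_nab_cyc[OF x] s s' ..
    also have "h x \<dots> (tZ (G x $ b)) = 2 * h x (\<Omega> c d x tY) (tZ (G x $ b))"
      unfolding curv_swap[of d c] by (simp only: h_simps x h_X real_scaleR_def fst_conv)
    also have "h x (\<Omega> c d x tY) (tZ (G x $ b)) = - cotton c d b x"
      by (rule curv_skew[OF x])
    finally show ?thesis by simp
  qed
  \<comment> \<open>The factor 4 is the trace of the metric, the only place where the dimension
    enters.\<close>
  have 3: "(\<Sum>e\<in>UNIV. \<Sum>a\<in>UNIV. ?i e a * (G x $ e $ a * cotton c d b x)) = 4 * cotton c d b x"
  proof -
    have "(\<Sum>e\<in>UNIV. \<Sum>a\<in>UNIV. ?i e a * (G x $ e $ a * cotton c d b x))
        = (\<Sum>e\<in>UNIV. (\<Sum>a\<in>UNIV. ?i e a * G x $ a $ e) * cotton c d b x)"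
      by (simp only: sum_distrib_right mult.assoc G_sym[OF x])
    then show ?thesis by (simp add: Ginv_G[OF x] four)
  qed
  \<comment> \<open>With n instead of 4 the result would be minus the cyclic sum plus (4 - n) times
    \<open>cotton c d b x\<close>.\<close>
  have "h x (tZ (G x $ c)) (YM b x (tZ (G x $ d)))
     = 2 * cotton c d b x + cotton c b d x - cotton d b c x - 4 * cotton c d b x + cotton c d b x"
    unfolding 1 N distrib_left right_diff_distrib sum.distrib sum_subtractf
    using 2 3 by (simp only: contract_G[OF x])
  also have "\<dots> = - h x tY (\<Omega> b c x (tZ (G x $ d)) + \<Omega> c d x (tZ (G x $ b)) + \<Omega> d b x (tZ (G x $ c)))"
  proof -
    have "cotton c b d x = - cotton b c d x" by (subst curv_swap) (simp only: h_simps x)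
    then show ?thesis by (simp only: h_simps x)
  qed
  finally show ?thesis by (simp only: curv_cyclic[OF x] h_simps x minus_zero)
qed

text \<open>The skew endomorphism J = \<open>YM b x\<close> kills X and has no Z-Z block, so only
  its Y-Z block is left. J I = 0 expresses \<sigma> J Y as minus J applied to the Z part of I, whose
  pairing with Z is zero; dividing by \<sigma> removes the last block.\<close>

lemma YM_zero_off_singular:
  assumes x: "x \<in> D" and four: "CARD('n) = 4" and I: "YM b x I = 0" and \<sigma>: "fst I \<noteq> 0"
  shows "YM b x w = 0"
proof -
  note lin = linear_YM[OF x, of b]
  let ?J = "YM b x"
  have X: "?J tX = 0" by (rule YM_X[OF x])
  have JZ: "h x (tZ (G x $ c)) (?J (tZ \<mu>)) = 0" for c \<mu>
  proof -
    have "?J (tZ \<mu>) = (\<Sum>d\<in>UNIV. (Ginv G x *v \<mu>) $ d *\<^sub>R ?J (tZ (G x $ d)))"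
      by (subst Z_expand[OF x, of \<mu>]) (simp only: linear_sum[OF lin] linear_cmul[OF lin])
    then show ?thesis
      by (simp only: h_simps x YM_Z_Z[OF x four] scaleR_zero_right sum.neutral_const)
  qed
  have JZ': "h x (tZ \<nu>) (?J (tZ \<mu>)) = 0" for \<nu> \<mu>
    by (subst Z_expand[OF x, of \<nu>]) (simp only: h_simps x JZ scaleR_zero_right sum.neutral_const)
  have XJ: "h x tX (?J w) = 0" for w
    using YM_skew[OF x, of b tX w] by (simp add: X h_simps x)
  have JY: "?J tY = - (inverse (fst I) *\<^sub>R ?J (tZ (fst (snd I))))"
  proof -
    have "0 = ?J (fst I *\<^sub>R tY + tZ (fst (snd I)) + snd (snd I) *\<^sub>R tX)"
      using I tractor_decomp[of I] by simp
    then have "fst I *\<^sub>R ?J tY = - ?J (tZ (fst (snd I)))"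
      by (simp only: linear_add[OF lin] linear_cmul[OF lin] X) (simp add: add_eq_0_iff2)
    then have "inverse (fst I) *\<^sub>R (fst I *\<^sub>R ?J tY) = inverse (fst I) *\<^sub>R (- ?J (tZ (fst (snd I))))" by simp
    then show ?thesis using \<sigma> by simp
  qed
  have YJZ: "h x tY (?J (tZ \<mu>)) = 0" for \<mu>
  proof -
    have "h x tY (?J (tZ \<mu>)) = - h x (?J tY) (tZ \<mu>)"
      using YM_skew[OF x, of b tY "tZ \<mu>"] by simp
    also have "\<dots> = inverse (fst I) * h x (?J (tZ (fst (snd I)))) (tZ \<mu>)"
      unfolding JY by (simp only: h_simps x real_scaleR_def minus_minus)
    also have "\<dots> = 0"
      unfolding YM_skew[OF x] JZ' by simp
    finally show ?thesis .
  qed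
  have Z: "?J (tZ \<mu>) = 0" for \<mu>
    by (rule nondegenerate[OF x XJ YJZ JZ])
  then have "?J tY = 0" using JY by simp
  then show ?thesis
    using tractor_decomp[of w] Z X by (metis (no_types) lin linear_add linear_cmul add_0 scaleR_zero_right)
qed

lemma yang_mills_of_YM: "x \<in> D \<Longrightarrow> (\<And>b w. YM b x w = 0) \<Longrightarrow> yang_mills_at G x"
  unfolding yang_mills_at_def by (simp add: dtcurv_eq YM_def)

lemma smooth_YM: "smooth_on D (\<lambda>x. YM b x w)"
  unfolding YM_def nab_def
  by (intro smooth_sum[OF open_D] smooth_scaleR[OF open_D] smooth_vec_nth[OF open_D] smooth_Ginv
      smooth_diff[OF open_D] smooth_christoffel smooth_family_const[OF family_dcurv] smooth_family_const[OF family_curv])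

end

section \<open>Weyl tensors in dimension four with a null direction\<close>

text \<open>In an orthonormal frame whose fourth vector is annihilated, the tensor is a trace-free
  curvature tensor on a three-dimensional space, and in three dimensions the Ricci trace determines
  the curvature.\<close>

lemma weyl_type_zero:
  fixes K :: "4 \<Rightarrow> 4 \<Rightarrow> 4 \<Rightarrow> 4 \<Rightarrow> real"
  assumes s1: "\<And>a b c d. K b a c d = - K a b c d" and s2: "\<And>a b c d. K a b d c = - K a b c d"
    and p: "\<And>a b c d. K a b c d = K c d a b"
    and tr: "\<And>b d. (\<Sum>a\<in>UNIV. K a b a d) = 0"
    and n: "\<And>a b c. K a b c 4 = 0"
  shows "K a b c d = 0"
proof -
  have d1: "K a a c d = 0" and d2: "K a b c c = 0" for a b c d
    using s1[of a a c d] s2[of a b c c] by simp_all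
  have n3: "K a b 4 c = 0" for a b c using n[of a b c] s2[of a b 4 c] by simp
  have n2: "K a 4 b c = 0" and n1: "K 4 a b c = 0" for a b c
    using p[of a 4 b c] p[of 4 a b c] n n3 by simp_all
  note z = d1 d2 n n1 n2 n3
  have t: "K 2 b 2 d = - (K 1 b 1 d) - K 3 b 3 d" for b d
    using tr[of b d] by (simp add: sum_4 z)
  have q: "K 2 1 c d = - K 1 2 c d" "K 3 1 c d = - K 1 3 c d" "K 3 2 c d = - K 2 3 c d"
    "K a b 2 1 = - K a b 1 2" "K a b 3 1 = - K a b 1 3" "K a b 3 2 = - K a b 2 3" for a b c d
    by (rule s1 s2)+
  \<comment> \<open>The three diagonal traces are linear equations in the three sectional components
    with only the zero solution; each off-diagonal trace contains a single component.\<close>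
  have v: "K 1 2 1 2 = 0" "K 1 3 1 3 = 0" "K 2 3 2 3 = 0" "K 1 2 1 3 = 0" "K 1 2 2 3 = 0" "K 1 3 2 3 = 0"
    using t[of 1 1] t[of 2 2] t[of 3 3] t[of 2 3] t[of 1 3] t[of 1 2] by (simp_all add: z q)
  have v': "K 1 3 1 2 = 0" "K 2 3 1 2 = 0" "K 2 3 1 3 = 0"
    using v p[of 1 3 1 2] p[of 2 3 1 2] p[of 2 3 1 3] by simp_all
  have "\<forall>a b c d. K a b c d = 0"
    unfolding forall_4 by (simp add: z q v v')
  then show ?thesis by blast
qed

context riemannian
begin

lemma G_self_adjoint: "x \<in> D \<Longrightarrow> v \<bullet> (G x *v w) = w \<bullet> (G x *v v)"
  by (metis dot_lmul_matrix inner_commute sym transpose_matrix_vector)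

lemma ex_unit_orthogonal:
  assumes x: "x \<in> D" and S: "finite S" "card S < CARD('n)"
  shows "\<exists>u. u \<bullet> (G x *v u) = 1 \<and> (\<forall>v\<in>S. v \<bullet> (G x *v u) = 0)"
proof -
  let ?T = "(\<lambda>v. G x *v v) ` S"
  have "dim ?T \<le> card ?T" using S by (intro dim_le_card') simp
  also have "\<dots> < DIM(real^'n)" using card_image_le[OF S(1), of "\<lambda>v. G x *v v"] S(2) by simp
  finally obtain u where u: "u \<noteq> 0" "\<And>y. y \<in> span ?T \<Longrightarrow> orthogonal u y"
    using orthogonal_to_subspace_exists by blast
  define r where "r = u \<bullet> (G x *v u)"
  have r: "r > 0" unfolding r_def using pos[OF x u(1)] .
  have "(inverse (sqrt r) *\<^sub>R u) \<bullet> (G x *v (inverse (sqrt r) *\<^sub>R u)) = inverse (sqrt r) * inverse (sqrt r) * r"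
    by (simp add: matrix_vector_mult_scaleR r_def)
  also have "\<dots> = 1" using r by (simp add: field_simps)
  finally have "(inverse (sqrt r) *\<^sub>R u) \<bullet> (G x *v (inverse (sqrt r) *\<^sub>R u)) = 1" .
  moreover have "v \<bullet> (G x *v (inverse (sqrt r) *\<^sub>R u)) = 0" if "v \<in> S" for v
    using u(2)[of "G x *v v"] that
    by (simp add: G_self_adjoint[OF x, of v] matrix_vector_mult_scaleR orthogonal_def span_base)
  ultimately show ?thesis by blast
qed

end

lemma ex_frame4:
  fixes G :: "real^4 \<Rightarrow> real^4^4"
  assumes "riemannian D G" and x: "x \<in> D" and \<nu>: "\<nu> \<bullet> (G x *v \<nu>) = 1"
  shows "\<exists>e :: 4 \<Rightarrow> real^4. e 4 = \<nu> \<and> (\<forall>i j. e i \<bullet> (G x *v e j) = (if i = j then 1 else 0))"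
proof -
  interpret riemannian D G by fact
  obtain e1 where e1: "e1 \<bullet> (G x *v e1) = 1" "\<nu> \<bullet> (G x *v e1) = 0"
    using ex_unit_orthogonal[OF x, of "{\<nu>}"] by auto
  have "card {\<nu>, e1} < CARD(4)" using card_insert_le_m1[of 2 "{e1}" \<nu>] by simp
  then obtain e2 where e2: "e2 \<bullet> (G x *v e2) = 1" "\<nu> \<bullet> (G x *v e2) = 0" "e1 \<bullet> (G x *v e2) = 0"
    using ex_unit_orthogonal[OF x, of "{\<nu>, e1}"] by auto
  have "card {\<nu>, e1, e2} \<le> 3"
    by (simp add: card_insert_if)
  then have "card {\<nu>, e1, e2} < CARD(4)" by simp
  then obtain e3 where e3: "e3 \<bullet> (G x *v e3) = 1" "\<nu> \<bullet> (G x *v e3) = 0" "e1 \<bullet> (G x *v e3) = 0" "e2 \<bullet> (G x *v e3) = 0"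
    using ex_unit_orthogonal[OF x, of "{\<nu>, e1, e2}"] by auto
  \<comment> \<open>The prescribed vector \<nu> is placed at index 4, the index singled out in
    \<open>weyl_type_zero\<close>.\<close>
  define e :: "4 \<Rightarrow> real^4" where "e i = (if i = 1 then e1 else if i = 2 then e2 else if i = 3 then e3 else \<nu>)" for i
  have "\<forall>i j. e i \<bullet> (G x *v e j) = (if i = j then 1 else 0)"
    unfolding forall_4
    using e1 e2 e3 \<nu> G_self_adjoint[OF x, of e1 \<nu>] G_self_adjoint[OF x, of e2 \<nu>] G_self_adjoint[OF x, of e3 \<nu>]
      G_self_adjoint[OF x, of e2 e1] G_self_adjoint[OF x, of e3 e1] G_self_adjoint[OF x, of e3 e2]
    by (simp add: e_def)
  moreover have "e 4 = \<nu>" by (simp add: e_def)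
  ultimately show ?thesis by blast
qed

section \<open>The Weyl tensor on arbitrary vectors and on orthonormal frames\<close>

context schouten_form
begin

lemma weyl_eq_K:
  assumes x: "x \<in> D"
  shows "weyl G x a b c d = K a b c d x"
proof -
  have "K a b c d x = - K a b d c x" by (rule K_skew[OF x])
  also have "\<dots> = weyl G x a b c d"
    by (simp add: h_Z_row[OF x] curv_middle(2)[OF x] weyl_def Ginv_G_row[OF x] inner_axis
        G_sym[OF x, of c] G_sym[OF x, of d] schouten_sym[OF x, of b] mult.commute)
  finally show ?thesis by simp
qed

definition \<Omega>v :: "real^'n \<Rightarrow> real^'n \<Rightarrow> real^'n \<Rightarrow> 'n tractor \<Rightarrow> 'n tractor" where
  "\<Omega>v x u v w = (\<Sum>a\<in>UNIV. \<Sum>b\<in>UNIV. (u $ a * v $ b) *\<^sub>R \<Omega> a b x w)"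

abbreviation Kv :: "real^'n \<Rightarrow> real^'n \<Rightarrow> real^'n \<Rightarrow> real^'n \<Rightarrow> real^'n \<Rightarrow> real" where
  "Kv x u v w z \<equiv> h x (tZ (G x *v w)) (\<Omega>v x u v (tZ (G x *v z)))"

lemma linear_\<Omega>v: "x \<in> D \<Longrightarrow> linear (\<Omega>v x u v)"
  unfolding \<Omega>v_def[abs_def]
  by (intro linear_compose_sum ballI linear_compose_scale_right linear_curv)

lemma tZ_G_expand: "x \<in> D \<Longrightarrow> tZ (G x *v z) = (\<Sum>d\<in>UNIV. z $ d *\<^sub>R tZ (G x $ d))"
  by (simp add: prod_eq_iff fst_sum snd_sum vec_eq_iff matrix_vector_mult_def G_sym[of x _ "_ :: 'n"] mult.commute)

lemma linear_Kv:
  assumes x: "x \<in> D"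
  shows "linear (\<lambda>u. Kv x u v w z)" "linear (\<lambda>v. Kv x u v w z)" "linear (\<lambda>w. Kv x u v w z)" "linear (\<lambda>z. Kv x u v w z)"
proof -
  have Z: "linear (\<lambda>z. tZ (G x *v z))"
    by (rule linearI) (auto simp: matrix_vector_right_distrib matrix_vector_mult_scaleR)
  show "linear (\<lambda>w. Kv x u v w z)"
    using linear_compose[OF Z linear_h(2)[OF x]] by (simp add: o_def)
  show "linear (\<lambda>z. Kv x u v w z)"
    using linear_compose[OF linear_compose[OF Z linear_\<Omega>v[OF x]] linear_h(1)[OF x]] by (simp add: o_def)
  have "linear (\<lambda>u. \<Omega>v x u v w)" "linear (\<lambda>v. \<Omega>v x u v w)" for u v w
    by (rule linearI; simp add: \<Omega>v_def algebra_simps sum.distrib scaleR_sum_right)+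
  then show "linear (\<lambda>u. Kv x u v w z)" "linear (\<lambda>v. Kv x u v w z)"
    by - (rule linear_compose[OF _ linear_h(1)[OF x], unfolded o_def], assumption)+
qed

lemma \<Omega>v_swap: "\<Omega>v x v u w = - \<Omega>v x u v w"
  unfolding \<Omega>v_def
  by (subst sum.swap, subst curv_swap) (simp add: sum_negf mult.commute)

lemma Kv_swap: "x \<in> D \<Longrightarrow> Kv x v u w z = - Kv x u v w z"
  by (subst \<Omega>v_swap) (simp only: h_simps)

lemma \<Omega>v_skew: "x \<in> D \<Longrightarrow> h x v (\<Omega>v x u u' w) = - h x (\<Omega>v x u u' v) w"
  unfolding \<Omega>v_def by (simp add: h_simps curv_skew sum_negf)

lemma Kv_skew: "x \<in> D \<Longrightarrow> Kv x u v z w = - Kv x u v w z"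
  by (metis \<Omega>v_skew h_commute)

text \<open>The trilinear extension of \<open>curv_cyclic\<close>; \<open>rot\<close> relabels the
  three summation indices so that all terms carry the same coefficients.\<close>

lemma Kv_cyclic:
  assumes x: "x \<in> D"
  shows "Kv x a b c d + Kv x b d c a + Kv x d a c b = 0"
proof -
  have E: "\<Omega>v x u v (tZ (G x *v z)) = (\<Sum>a\<in>UNIV. \<Sum>b\<in>UNIV. \<Sum>d\<in>UNIV. (u $ a * v $ b * z $ d) *\<^sub>R \<Omega> a b x (tZ (G x $ d)))" for u v z
    unfolding \<Omega>v_def tZ_G_expand[OF x]
    by (simp only: linear_sum[OF linear_curv[OF x]] linear_cmul[OF linear_curv[OF x]] scaleR_sum_right scaleR_scaleR)
  have rot: "(\<Sum>a\<in>UNIV. \<Sum>b\<in>UNIV. \<Sum>d\<in>UNIV. f a b d) = (\<Sum>a\<in>UNIV. \<Sum>b\<in>UNIV. \<Sum>d\<in>UNIV. f d a b)"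
    for f :: "'n \<Rightarrow> 'n \<Rightarrow> 'n \<Rightarrow> 'n tractor"
  proof -
    have "(\<Sum>a\<in>UNIV. \<Sum>b\<in>UNIV. \<Sum>d\<in>UNIV. f d a b) = (\<Sum>a\<in>UNIV. \<Sum>d\<in>UNIV. \<Sum>b\<in>UNIV. f d a b)"
      by (rule sum.cong[OF refl sum.swap])
    also have "\<dots> = (\<Sum>d\<in>UNIV. \<Sum>a\<in>UNIV. \<Sum>b\<in>UNIV. f d a b)" by (rule sum.swap)
    finally show ?thesis by simp
  qed
  have 1: "\<Omega>v x b d (tZ (G x *v a)) = (\<Sum>i\<in>UNIV. \<Sum>j\<in>UNIV. \<Sum>k\<in>UNIV. (a $ i * b $ j * d $ k) *\<^sub>R \<Omega> j k x (tZ (G x $ i)))"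
    unfolding E by (subst (2) rot) (simp only: ac_simps)
  have 2: "\<Omega>v x d a (tZ (G x *v b)) = (\<Sum>i\<in>UNIV. \<Sum>j\<in>UNIV. \<Sum>k\<in>UNIV. (a $ i * b $ j * d $ k) *\<^sub>R \<Omega> k i x (tZ (G x $ j)))"
    unfolding E by (subst rot) (simp only: ac_simps)
  have "\<Omega>v x a b (tZ (G x *v d)) + \<Omega>v x b d (tZ (G x *v a)) + \<Omega>v x d a (tZ (G x *v b))
    = (\<Sum>i\<in>UNIV. \<Sum>j\<in>UNIV. \<Sum>k\<in>UNIV. (a $ i * b $ j * d $ k) *\<^sub>R (\<Omega> i j x (tZ (G x $ k)) + \<Omega> j k x (tZ (G x $ i)) + \<Omega> k i x (tZ (G x $ j))))"
    unfolding 1 2 unfolding E by (simp only: scaleR_add_right sum.distrib)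
  also have "\<dots> = 0" by (simp only: curv_cyclic[OF x] scaleR_zero_right sum.neutral_const)
  finally have z: "\<Omega>v x a b (tZ (G x *v d)) + \<Omega>v x b d (tZ (G x *v a)) + \<Omega>v x d a (tZ (G x *v b)) = 0" .
  have "Kv x a b c d + Kv x b d c a + Kv x d a c b = h x (tZ (G x *v c))
      (\<Omega>v x a b (tZ (G x *v d)) + \<Omega>v x b d (tZ (G x *v a)) + \<Omega>v x d a (tZ (G x *v b)))"
    by (simp only: linear_add[OF linear_h(1)[OF x]])
  then show ?thesis unfolding z by (simp only: linear_0[OF linear_h(1)[OF x]])
qed

text \<open>For an orthonormal frame the sum of the products of the components of \<open>e i\<close>
  over i is the inverse metric, so the frame trace is the coordinate trace of \<Omega> against Z,
  which vanishes.\<close>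

lemma Kv_trace:
  fixes e :: "'n \<Rightarrow> real^'n"
  assumes x: "x \<in> D" and e: "\<And>i j. e i \<bullet> (G x *v e j) = (if i = j then 1 else 0)"
  shows "(\<Sum>i\<in>UNIV. Kv x (e i) v (e i) z) = 0"
proof -
  define M :: "real^'n^'n" where "M = (\<chi> a i. e i $ a)"
  have "transpose M ** (G x ** M) = mat 1"
    using e by (simp add: vec_eq_iff mat_def M_def transpose_def matrix_matrix_mult_def inner_vec_def matrix_vector_mult_def)
  then have "M ** (transpose M ** G x) = mat 1"
    by (metis matrix_mul_assoc matrix_left_right_inverse)
  then have "M ** transpose M = Ginv G x"
    by (metis matrix_mul_assoc matrix_mul_lid matrix_mul_rid Ginv_right[OF x])
  then have M: "(\<Sum>i\<in>UNIV. e i $ a * e i $ c) = Ginv G x $ a $ c" for a c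
    by (simp add: vec_eq_iff matrix_matrix_mult_def transpose_def M_def)
  have Z: "(\<Sum>i\<in>UNIV. e i $ a *\<^sub>R tZ (G x *v e i)) = tZ (axis a 1)" for a
  proof -
    have "(\<Sum>i\<in>UNIV. e i $ a *\<^sub>R tZ (G x *v e i)) = (\<Sum>i\<in>UNIV. \<Sum>d\<in>UNIV. (e i $ a * e i $ d) *\<^sub>R tZ (G x $ d))"
      by (simp only: tZ_G_expand[OF x] scaleR_sum_right scaleR_scaleR)
    also have "\<dots> = (\<Sum>d\<in>UNIV. (\<Sum>i\<in>UNIV. e i $ a * e i $ d) *\<^sub>R tZ (G x $ d))"
      by (subst sum.swap) (simp only: scaleR_sum_left)
    finally show ?thesis by (simp only: M sum_Ginv_Z_row[OF x])
  qed
  let ?w = "tZ (G x *v z)"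
  have "(\<Sum>i\<in>UNIV. Kv x (e i) v (e i) z)
      = (\<Sum>i\<in>UNIV. \<Sum>a\<in>UNIV. \<Sum>b\<in>UNIV. v $ b * h x (e i $ a *\<^sub>R tZ (G x *v e i)) (\<Omega> a b x ?w))"
    unfolding \<Omega>v_def by (simp only: h_simps x real_scaleR_def ac_simps)
  also have "\<dots> = (\<Sum>a\<in>UNIV. \<Sum>i\<in>UNIV. \<Sum>b\<in>UNIV. v $ b * h x (e i $ a *\<^sub>R tZ (G x *v e i)) (\<Omega> a b x ?w))"
    by (rule sum.swap)
  also have "\<dots> = (\<Sum>a\<in>UNIV. \<Sum>b\<in>UNIV. \<Sum>i\<in>UNIV. v $ b * h x (e i $ a *\<^sub>R tZ (G x *v e i)) (\<Omega> a b x ?w))"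
    by (rule sum.cong[OF refl sum.swap])
  also have "\<dots> = (\<Sum>a\<in>UNIV. \<Sum>b\<in>UNIV. v $ b * h x (\<Sum>i\<in>UNIV. e i $ a *\<^sub>R tZ (G x *v e i)) (\<Omega> a b x ?w))"
    by (simp only: linear_sum[OF linear_h(2)[OF x]] sum_distrib_left)
  also have "\<dots> = (\<Sum>a\<in>UNIV. \<Sum>b\<in>UNIV. - (v $ b * h x (\<Omega> a b x (tZ (axis a 1))) ?w))"
    by (simp only: Z curv_skew[OF x] mult_minus_right minus_minus)
  also have "\<dots> = (\<Sum>b\<in>UNIV. - (v $ b * h x (\<Sum>a\<in>UNIV. \<Omega> a b x (tZ (axis a 1))) ?w))"
    by (subst sum.swap) (simp only: linear_sum[OF linear_h(2)[OF x]] sum_distrib_left sum_negf)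
  also have "\<dots> = 0"
    by (simp only: sum_curv_axis[OF x] tr_zero[OF x] scaleR_zero_left h_simps x mult_zero_right minus_zero sum.neutral_const)
  finally show ?thesis .
qed

lemma Kv_axis: "x \<in> D \<Longrightarrow> Kv x (axis a 1) (axis b 1) (axis c 1) (axis d 1) = K a b c d x"
proof -
  assume x: "x \<in> D"
  have "G x *v axis c 1 = G x $ c" for c
    by (simp add: vec_eq_iff matrix_vector_mult_basis column_def G_sym[OF x, of _ c])
  moreover have "\<Omega>v x (axis a 1) (axis b 1) w = \<Omega> a b x w" for w
  proof -
    have "\<Omega>v x (axis a 1) (axis b 1) w = (\<Sum>i\<in>UNIV. \<Sum>j\<in>UNIV. if j = b then (if i = a then \<Omega> i j x w else 0) else 0)"
      unfolding \<Omega>v_def by (intro sum.cong refl) (auto simp: axis_def)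
    then show ?thesis by simp
  qed
  ultimately show ?thesis by simp
qed

end

lemma linear_frame_zero:
  fixes e :: "'n::finite \<Rightarrow> real^'n" and f :: "real^'n \<Rightarrow> real"
  assumes f: "linear f" and z: "\<And>i. f (e i) = 0" and e: "\<And>i j. e i \<bullet> (M *v e j) = (if i = j then 1 else 0)"
  shows "f u = 0"
proof -
  define B :: "real^'n^'n" where "B = (\<chi> a i. e i $ a)"
  have "transpose B ** (M ** B) = mat 1"
    using e by (simp add: vec_eq_iff mat_def B_def transpose_def matrix_matrix_mult_def inner_vec_def matrix_vector_mult_def)
  then have "B ** (transpose B ** M) = mat 1"
    by (metis matrix_mul_assoc matrix_left_right_inverse)
  then have "u = B *v ((transpose B ** M) *v u)" by (simp add: matrix_vector_mul_assoc)
  then have "u = (\<Sum>i\<in>UNIV. ((transpose B ** M) *v u) $ i *\<^sub>R e i)"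
    by (simp add: vec_eq_iff B_def matrix_vector_mult_def[of "\<chi> a i. e i $ a"] mult.commute)
  then have "f u = f (\<Sum>i\<in>UNIV. ((transpose B ** M) *v u) $ i *\<^sub>R e i)" by simp
  also have "\<dots> = 0" by (simp add: linear_sum[OF f] linear_cmul[OF f] z)
  finally show ?thesis .
qed

text \<open>Null refers to annihilation, not to length: \<mu> has positive norm, so its raised and
  normalised form can be the fourth vector of an orthonormal frame. The vanishing on the frame
  extends to all vectors one argument at a time.\<close>

lemma weyl_zero_of_null_direction:
  fixes G :: "real^4 \<Rightarrow> real^4^4"
  assumes "schouten_form D G" and x: "x \<in> D" and \<mu>: "\<mu> \<bullet> (Ginv G x *v \<mu>) > 0"
    and null: "\<And>a b. curv (tform G (schouten G)) a b x (tZ \<mu>) = 0"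
  shows "weyl G x a b c d = 0"
proof -
  interpret schouten_form D G by fact
  define s where "s = \<mu> \<bullet> (Ginv G x *v \<mu>)"
  define \<nu> where "\<nu> = inverse (sqrt s) *\<^sub>R (Ginv G x *v \<mu>)"
  have s: "s > 0" using \<mu> by (simp add: s_def)
  have G\<nu>: "G x *v \<nu> = inverse (sqrt s) *\<^sub>R \<mu>"
    by (simp add: \<nu>_def matrix_vector_mult_scaleR matrix_vector_mul_assoc Ginv_right[OF x])
  have "\<nu> \<bullet> (G x *v \<nu>) = inverse (sqrt s) * inverse (sqrt s) * s"
    unfolding G\<nu> by (simp add: \<nu>_def s_def inner_commute)
  also have "\<dots> = 1" using s by (simp add: field_simps)
  finally obtain e :: "4 \<Rightarrow> real^4" where e4: "e 4 = \<nu>" and e: "\<And>i j. e i \<bullet> (G x *v e j) = (if i = j then 1 else 0)"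
    using ex_frame4[OF riemannian_axioms x] by blast
  have "\<Omega> a b x (tZ (G x *v \<nu>)) = 0" for a b
    unfolding G\<nu> using null[of a b] linear_cmul[OF linear_curv[OF x], of a b "inverse (sqrt s)" "tZ \<mu>"] by simp
  then have n: "Kv x u v w (e 4) = 0" for u v w
    unfolding e4 \<Omega>v_def by (simp only: scaleR_zero_right sum.neutral_const h_simps x)
  have "Kv x (e i) (e j) (e k) (e l) = 0" for i j k l
  proof (rule weyl_type_zero[of "\<lambda>i j k l. Kv x (e i) (e j) (e k) (e l)"])
    fix a b c d
    show "Kv x (e b) (e a) (e c) (e d) = - Kv x (e a) (e b) (e c) (e d)" by (rule Kv_swap[OF x])
    show "Kv x (e a) (e b) (e d) (e c) = - Kv x (e a) (e b) (e c) (e d)" by (rule Kv_skew[OF x])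
    show "Kv x (e a) (e b) (e c) (e d) = Kv x (e c) (e d) (e a) (e b)"
      by (rule pair_symmetry[of "Kv x"]) (rule Kv_swap[OF x] Kv_skew[OF x] Kv_cyclic[OF x])+
    show "(\<Sum>a\<in>UNIV. Kv x (e a) (e b) (e a) (e d)) = 0" by (rule Kv_trace[OF x e])
    show "Kv x (e a) (e b) (e c) (e 4) = 0" by (rule n)
  qed
  then have "Kv x u (e j) (e k) (e l) = 0" for u j k l
    by (rule linear_frame_zero[OF linear_Kv(1)[OF x] _ e])
  then have "Kv x u v (e k) (e l) = 0" for u v k l
    by (rule linear_frame_zero[OF linear_Kv(2)[OF x] _ e])
  then have "Kv x u v w (e l) = 0" for u v w l
    by (rule linear_frame_zero[OF linear_Kv(3)[OF x] _ e])
  then have "Kv x u v w z = 0" for u v w z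
    by (rule linear_frame_zero[OF linear_Kv(4)[OF x] _ e])
  then show ?thesis by (simp only: weyl_eq_K[OF x] Kv_axis[OF x, symmetric])
qed

lemma (in schouten_form) curv_Z_of_weyl_zero:
  assumes x: "x \<in> D" and "\<And>a b c d. weyl G x a b c d = 0"
  shows "fst (snd (\<Omega> a b x (tZ \<mu>))) = 0"
proof -
  have "fst (snd (\<Omega> a b x (tZ (G x $ d)))) $ c = 0" for a b c d
    using assms(2)[of a b c d] by (simp add: weyl_eq_K[OF x] h_Z_row[OF x])
  then have z: "fst (snd (\<Omega> a b x (tZ (G x $ d)))) = 0" for a b d by (simp add: vec_eq_iff)
  show ?thesis
    by (subst Z_expand[OF x])
      (simp only: linear_sum[OF linear_curv[OF x]] linear_cmul[OF linear_curv[OF x]] fst_sum snd_sum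
        snd_scaleR fst_scaleR z scaleR_zero_right sum.neutral_const)
qed

section \<open>Parallel normal tractors along a hypersurface\<close>

lemma smooth_matrix_matrix_mult:
  fixes M :: "real^'k::finite \<Rightarrow> real^'n::finite^'m::finite" and N :: "real^'k \<Rightarrow> real^'l::finite^'n"
  shows "open D \<Longrightarrow> smooth_on D M \<Longrightarrow> smooth_on D N \<Longrightarrow> smooth_on D (\<lambda>x. M x ** N x)"
  by (rule smooth_bilinear[OF _ bounded_bilinear_matrix_matrix_mult])

lemma bounded_linear_transpose: "bounded_linear (transpose :: real^'n::finite^'m::finite \<Rightarrow> real^'m^'n)"
  unfolding linear_conv_bounded_linear[symmetric]
  by (rule linearI) (simp_all add: transpose_def vec_eq_iff)

lemma smooth_transpose: "open D \<Longrightarrow> smooth_on D M \<Longrightarrow> smooth_on D (\<lambda>x. transpose (M x :: real^'n::finite^'m::finite))"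
  by (rule smooth_linear[OF _ bounded_linear_transpose])

text \<open>On constant sections compatibility is the chain rule; the Leibniz rule in each argument
  of the metric then extends it to all smooth sections.\<close>

lemma (in metric_connection) metric_connection_pull:
  fixes E :: "(real^'m::finite) set" and \<phi> :: "real^'m \<Rightarrow> real^'n"
  assumes E: "open E" and \<phi>: "smooth_on E \<phi>" and image: "\<phi> ` E \<subseteq> D"
  shows "metric_connection E (pull \<phi> T) (\<lambda>y. h (\<phi> y))"
proof -
  interpret P: connection E "pull \<phi> T" by (rule connection_pull[OF E \<phi> image])
  have inD: "\<phi> y \<in> D" if "y \<in> E" for y using image that by auto
  have sh: "smooth_on E (\<lambda>y. h (\<phi> y) v w)" for v w
    by (rule smooth_compose[OF open_D E h[OF smooth_const smooth_const] \<phi> image])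
  have lin: "linear (h x v)" "linear (\<lambda>v. h x v w)" if "x \<in> D" for x v w
    using bil[OF that] unfolding bilinear_def by blast+
  have fam1: "smooth_family E (\<lambda>y. h (\<phi> y) v)" for v
    by (rule smooth_familyI[OF lin(1)[OF inD] sh])
  have s1: "smooth_on E (\<lambda>y. h (\<phi> y) v (W y))" if "smooth_on E W" for v W
    by (rule smooth_family_apply[OF E fam1 that])
  have fam2: "smooth_family E (\<lambda>y v. h (\<phi> y) v (W y))" if "smooth_on E W" for W
    by (rule smooth_familyI[OF lin(2)[OF inD] s1[OF that]])
  have c: "pd \<alpha> (\<lambda>y. h (\<phi> y) v w) y = h (\<phi> y) (pull \<phi> T \<alpha> y v) w + h (\<phi> y) v (pull \<phi> T \<alpha> y w)"
    if y: "y \<in> E" for \<alpha> y v w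
  proof -
    have "pd \<alpha> (\<lambda>y. h (\<phi> y) v w) y = (\<Sum>a\<in>UNIV. (pd \<alpha> \<phi> y $ a) *\<^sub>R pd a (\<lambda>x. h x v w) (\<phi> y))"
      by (rule pd_compose[OF smooth_on_differentiable[OF \<phi> E y]
            smooth_on_differentiable[OF h[OF smooth_const smooth_const] open_D inD[OF y]]])
    also have "\<dots> = (\<Sum>a\<in>UNIV. (pd \<alpha> \<phi> y $ a) *\<^sub>R (h (\<phi> y) (T a (\<phi> y) v) w + h (\<phi> y) v (T a (\<phi> y) w)))"
      by (simp only: compat[OF smooth_const smooth_const inD[OF y]] cov_const)
    finally show ?thesis
      unfolding pull_def
      by (simp add: linear_sum[OF lin(1)[OF inD[OF y]]] linear_sum[OF lin(2)[OF inD[OF y]]]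
          linear_cmul[OF lin(1)[OF inD[OF y]]] linear_cmul[OF lin(2)[OF inD[OF y]]] sum.distrib algebra_simps)
  qed
  show ?thesis
  proof unfold_locales
    fix V W :: "real^'m \<Rightarrow> 'e" assume V: "smooth_on E V" and W: "smooth_on E W"
    show "smooth_on E (\<lambda>y. h (\<phi> y) (V y) (W y))"
      by (rule smooth_family_apply[OF E fam2[OF W] V])
    fix y \<alpha> assume y: "y \<in> E"
    have "pd \<alpha> (\<lambda>y. h (\<phi> y) (V y) (W y)) y = pd \<alpha> (\<lambda>z. h (\<phi> z) (V y) (W z)) y + h (\<phi> y) (pd \<alpha> V y) (W y)"
      by (rule pd_family_apply[OF E fam2[OF W] V y])
    also have "pd \<alpha> (\<lambda>z. h (\<phi> z) (V y) (W z)) y = pd \<alpha> (\<lambda>z. h (\<phi> z) (V y) (W y)) y + h (\<phi> y) (V y) (pd \<alpha> W y)"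
      by (rule pd_family_apply[OF E fam1 W y])
    finally show "pd \<alpha> (\<lambda>y. h (\<phi> y) (V y) (W y)) y
        = h (\<phi> y) (cov (pull \<phi> T) \<alpha> V y) (W y) + h (\<phi> y) (V y) (cov (pull \<phi> T) \<alpha> W y)"
      by (simp add: c[OF y] cov_def linear_add[OF lin(1)[OF inD[OF y]]] linear_add[OF lin(2)[OF inD[OF y]]])
  next
    fix y assume "y \<in> E"
    then show "bilinear (h (\<phi> y))" by (rule bil[OF inD])
  qed
qed

lemma sum4_swap:
  fixes f :: "'i::finite \<Rightarrow> 'j::finite \<Rightarrow> 'k::finite \<Rightarrow> 'l::finite \<Rightarrow> 'v::comm_monoid_add"
  shows "(\<Sum>a\<in>UNIV. \<Sum>b\<in>UNIV. \<Sum>c\<in>UNIV. \<Sum>d\<in>UNIV. f a b c d) = (\<Sum>c\<in>UNIV. \<Sum>d\<in>UNIV. \<Sum>a\<in>UNIV. \<Sum>b\<in>UNIV. f a b c d)"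
proof -
  have "(\<Sum>a\<in>UNIV. \<Sum>b\<in>UNIV. \<Sum>c\<in>UNIV. \<Sum>d\<in>UNIV. f a b c d) = (\<Sum>a\<in>UNIV. \<Sum>c\<in>UNIV. \<Sum>d\<in>UNIV. \<Sum>b\<in>UNIV. f a b c d)"
    by (rule sum.cong[OF refl]) (subst sum.swap, rule sum.cong[OF refl sum.swap])
  also have "\<dots> = (\<Sum>c\<in>UNIV. \<Sum>d\<in>UNIV. \<Sum>a\<in>UNIV. \<Sum>b\<in>UNIV. f a b c d)"
    by (subst sum.swap) (rule sum.cong[OF refl sum.swap])
  finally show ?thesis .
qed

definition jacobian :: "(real^'m::finite \<Rightarrow> real^'n::finite) \<Rightarrow> real^'m \<Rightarrow> real^'m^'n" where
  "jacobian \<phi> y = (\<chi> a \<alpha>. pd \<alpha> \<phi> y $ a)"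

definition induced_metric :: "(real^'n::finite \<Rightarrow> real^'n^'n) \<Rightarrow> (real^'m::finite \<Rightarrow> real^'n) \<Rightarrow> real^'m \<Rightarrow> real^'m^'m" where
  "induced_metric G \<phi> y = transpose (jacobian \<phi> y) ** G (\<phi> y) ** jacobian \<phi> y"

lemma jacobian_mult: "jacobian \<phi> y *v u = (\<Sum>\<alpha>\<in>UNIV. u $ \<alpha> *\<^sub>R pd \<alpha> \<phi> y)"
  by (simp add: vec_eq_iff jacobian_def matrix_vector_mult_def mult.commute)

lemma jacobian_axis: "jacobian \<phi> y *v axis \<alpha> 1 = pd \<alpha> \<phi> y"
  by (simp add: vec_eq_iff jacobian_def matrix_vector_mult_basis column_def)

lemma vector_jacobian: "(\<mu> v* jacobian \<phi> y) $ \<alpha> = \<mu> \<bullet> pd \<alpha> \<phi> y"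
  by (simp add: jacobian_def vector_matrix_mult_def inner_vec_def mult.commute)

lemma congruence_component:
  fixes \<phi> :: "real^'m::finite \<Rightarrow> real^'n::finite"
  shows "(transpose (jacobian \<phi> y) ** M ** jacobian \<phi> y) $ \<alpha> $ \<beta> = pd \<alpha> \<phi> y \<bullet> (M *v pd \<beta> \<phi> y)"
proof -
  have "A $ \<alpha> $ \<beta> = (A *v axis \<beta> 1) $ \<alpha>" for A :: "real^'m^'m"
    by (simp add: matrix_vector_mult_basis column_def)
  then have "(transpose (jacobian \<phi> y) ** M ** jacobian \<phi> y) $ \<alpha> $ \<beta>
      = (transpose (jacobian \<phi> y) *v (M *v pd \<beta> \<phi> y)) $ \<alpha>"
    by (simp add: matrix_vector_mul_assoc[symmetric] jacobian_axis del: transpose_matrix_vector)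
  then show ?thesis by (simp add: vector_jacobian inner_commute)
qed

text \<open>\<open>E\<close> is the image of an intrinsic chart and \<phi> the inclusion of the
  hypersurface read in an ambient chart. The conormal \<nu> lives on \<open>E\<close> only; an
  extension to the ambient space is not met before \<open>mean_curv_eq\<close>.\<close>

locale embedded = riemannian D G
  for D :: "(real^'n::finite) set" and G :: "real^'n \<Rightarrow> real^'n^'n" +
  fixes E :: "(real^'m::finite) set" and \<phi> :: "real^'m \<Rightarrow> real^'n" and \<nu> :: "real^'m \<Rightarrow> real^'n"
  assumes open_E: "open E" and smooth_\<phi>: "smooth_on E \<phi>" and image: "\<phi> ` E \<subseteq> D"
    and immersion: "y \<in> E \<Longrightarrow> inj (\<lambda>u. jacobian \<phi> y *v u)"
    and codim: "CARD('n) = Suc CARD('m)"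
    and smooth_\<nu>: "smooth_on E \<nu>"
    and conormal: "y \<in> E \<Longrightarrow> \<nu> y \<bullet> pd \<alpha> \<phi> y = 0"
    and unit: "y \<in> E \<Longrightarrow> \<nu> y \<bullet> (Ginv G (\<phi> y) *v \<nu> y) = 1"
begin

abbreviation "J \<equiv> jacobian \<phi>"
abbreviation "\<gamma> \<equiv> induced_metric G \<phi>"

lemma inD: "y \<in> E \<Longrightarrow> \<phi> y \<in> D"
  using image by auto

lemma induced_component: "\<gamma> y $ \<alpha> $ \<beta> = pd \<alpha> \<phi> y \<bullet> (G (\<phi> y) *v pd \<beta> \<phi> y)"
  unfolding induced_metric_def by (rule congruence_component)

lemma smooth_pd_\<phi>: "smooth_on E (pd \<alpha> \<phi>)"
  by (rule smooth_on_pd[OF smooth_\<phi>])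

lemma smooth_J: "smooth_on E J"
  unfolding jacobian_def[abs_def]
  by (intro smooth_vec_lambda[OF open_E] smooth_vec_nth[OF open_E] smooth_pd_\<phi>)

lemma smooth_congruence: "smooth_on D M \<Longrightarrow> smooth_on E (\<lambda>y. transpose (J y) ** M (\<phi> y) ** J y)"
  by (intro smooth_matrix_matrix_mult[OF open_E] smooth_transpose[OF open_E] smooth_J
      smooth_compose[OF open_D open_E _ smooth_\<phi> image])

sublocale Sigma: riemannian E \<gamma>
proof
  show "smooth_on E \<gamma>"
    unfolding induced_metric_def[abs_def] by (rule smooth_congruence[OF smooth_G])
  fix y assume y: "y \<in> E"
  show "transpose (\<gamma> y) = \<gamma> y"
    by (simp add: vec_eq_iff transpose_def induced_component G_self_adjoint[OF inD[OF y]])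
  fix u :: "real^'m" assume "u \<noteq> 0"
  then have "J y *v u \<noteq> 0"
    using immersion[OF y] by (metis injD matrix_vector_mult_0_right)
  moreover have "u \<bullet> (\<gamma> y *v u) = (J y *v u) \<bullet> (G (\<phi> y) *v (J y *v u))"
    unfolding induced_metric_def
    by (metis (no_types, lifting) dot_lmul_matrix matrix_vector_mul_assoc transpose_matrix_vector inner_commute)
  ultimately show "u \<bullet> (\<gamma> y *v u) > 0" using pos[OF inD[OF y]] by simp
qed (fact open_E)

text \<open>The decomposition into tangential and normal parts. L extracts the parts, R reassembles
  them, and L R is the identity by direct computation. R is then an injection between spaces of the
  same dimension, by \<open>codim\<close>, hence onto, which makes R L the identity as well.\<close>

lemma completeness:
  assumes y: "y \<in> E"
  shows "w = J y *v (Ginv \<gamma> y *v ((G (\<phi> y) *v w) v* J y)) + (\<nu> y \<bullet> w) *\<^sub>R (Ginv G (\<phi> y) *v \<nu> y)"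
proof -
  note x = inD[OF y]
  let ?n = "Ginv G (\<phi> y) *v \<nu> y"
  let ?L = "\<lambda>w. ((G (\<phi> y) *v w) v* J y, \<nu> y \<bullet> w)"
  let ?R = "\<lambda>p :: (real^'m) \<times> real. J y *v (Ginv \<gamma> y *v fst p) + snd p *\<^sub>R ?n"
  have lR: "linear ?R"
    by (rule linearI) (auto simp: matrix_vector_right_distrib matrix_vector_mult_scaleR scaleR_add_left scaleR_add_right)
  have Jn: "\<nu> y \<bullet> (J y *v u) = 0" for u
    by (simp add: jacobian_mult inner_sum_right conormal[OF y])
  have nJ: "(k *\<^sub>R \<nu> y) v* J y = 0" for k
    by (simp add: vec_eq_iff vector_jacobian conormal[OF y])
  have gg: "(G (\<phi> y) *v (J y *v u)) v* J y = \<gamma> y *v u" for u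
    unfolding induced_metric_def
    by (metis matrix_vector_mul_assoc transpose_matrix_vector)
  have "G (\<phi> y) *v ?n = \<nu> y" by (simp add: matrix_vector_mul_assoc Ginv_right[OF inD[OF y]])
  moreover have "\<gamma> y *v (Ginv \<gamma> y *v u) = u" for u
    by (simp add: matrix_vector_mul_assoc Sigma.Ginv_right[OF y])
  ultimately have LR: "?L (?R p) = p" for p
    by (simp add: prod_eq_iff matrix_vector_right_distrib matrix_vector_mult_scaleR vector_matrix_left_distrib gg nJ
        inner_add_right Jn unit[OF y])
  have inj: "inj ?R"
  proof (rule injI)
    fix p q assume "?R p = ?R q"
    then have "?L (?R p) = ?L (?R q)" by (rule arg_cong)
    then show "p = q" unfolding LR .
  qed
  have "dim (range ?R) = dim (UNIV :: ((real^'m) \<times> real) set)"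
    by (rule dim_image_eq[OF lR]) (simp add: inj)
  then have "dim (range ?R) = DIM(real^'n)" by (simp add: codim)
  then have "span (range ?R) = UNIV" by (simp only: dim_eq_full)
  moreover have "span (range ?R) = range ?R"
    unfolding span_eq_iff by (rule linear_subspace_image[OF lR subspace_UNIV])
  ultimately have "range ?R = UNIV" by (rule trans[OF HOL.sym, rotated])
  then obtain p where p: "w = ?R p" by blast
  then have L: "?L w = p" using LR[of p] by (simp only:)
  have f: "fst p = (G (\<phi> y) *v w) v* J y" and s: "snd p = \<nu> y \<bullet> w"
    unfolding L[symmetric] by simp_all
  show ?thesis using p unfolding f s .
qed

lemma conormal_unique:
  assumes y: "y \<in> E" and d: "\<And>\<alpha>. d \<bullet> pd \<alpha> \<phi> y = 0"
  shows "d = (d \<bullet> (Ginv G (\<phi> y) *v \<nu> y)) *\<^sub>R \<nu> y"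
proof -
  note x = inD[OF y]
  have G: "G (\<phi> y) *v (Ginv G (\<phi> y) *v v) = v" for v
    by (simp add: matrix_vector_mul_assoc Ginv_right[OF x])
  have "d v* J y = 0" by (simp add: vec_eq_iff vector_jacobian d)
  then have "Ginv G (\<phi> y) *v d = (\<nu> y \<bullet> (Ginv G (\<phi> y) *v d)) *\<^sub>R (Ginv G (\<phi> y) *v \<nu> y)"
    using completeness[OF y, of "Ginv G (\<phi> y) *v d"] by (simp add: G)
  then have "d = (\<nu> y \<bullet> (Ginv G (\<phi> y) *v d)) *\<^sub>R \<nu> y"
    by (metis G matrix_vector_mult_scaleR)
  then show ?thesis by (metis Ginv_self_adjoint[OF x] inner_commute)
qed

end

text \<open>\<open>H\<close> is just a smooth function here. The parallel equation makes the
  hypersurface totally umbilic with factor \<open>H\<close>, from which \<open>mean_curv_eq\<close>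
  recovers the mean curvature.\<close>

locale hypersurface = schouten_form D G + embedded D G E \<phi> \<nu>
  for D :: "(real^'n::finite) set" and G :: "real^'n \<Rightarrow> real^'n^'n"
    and E :: "(real^'m::finite) set" and \<phi> :: "real^'m \<Rightarrow> real^'n" and \<nu> :: "real^'m \<Rightarrow> real^'n" +
  fixes H :: "real^'m \<Rightarrow> real"
  assumes dim_E: "3 \<le> CARD('m)" and smooth_H: "smooth_on E H"
    and parallel: "y \<in> E \<Longrightarrow> cov (pull \<phi> (tform G (schouten G))) \<alpha> (\<lambda>y. (0, \<nu> y, - H y)) y = 0"
    and weyl_zero: "y \<in> E \<Longrightarrow> weyl G (\<phi> y) a b c d = 0"
begin

abbreviation "N y \<equiv> (0, \<nu> y, - H y)"
abbreviation "S \<equiv> pull \<phi> (tform G (schouten G))"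

text \<open>The candidate for the intrinsic Schouten tensor. The term with the square of
  \<open>H\<close> is what \<open>\<Psi>_intertwines\<close> requires to absorb the
  \<open>H\<close>-dependent shift in the identification of tractors.\<close>

definition Q :: "real^'m \<Rightarrow> real^'m^'m" where
  "Q y = transpose (J y) ** schouten G (\<phi> y) ** J y + ((H y)\<^sup>2 / 2) *\<^sub>R \<gamma> y"

lemma Q_component: "Q y $ \<alpha> $ \<beta> = pd \<alpha> \<phi> y \<bullet> (schouten G (\<phi> y) *v pd \<beta> \<phi> y) + (H y)\<^sup>2 / 2 * \<gamma> y $ \<alpha> $ \<beta>"
  by (simp add: Q_def congruence_component)

lemma transpose_schouten: "x \<in> D \<Longrightarrow> transpose (schouten G x) = schouten G x"
  by (simp add: vec_eq_iff transpose_def schouten_sym)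

lemma schouten_self_adjoint: "x \<in> D \<Longrightarrow> v \<bullet> (schouten G x *v w) = w \<bullet> (schouten G x *v v)"
  by (metis dot_lmul_matrix inner_commute transpose_schouten transpose_matrix_vector)

sublocale SigmaQ: sym_tractor_form E \<gamma> Q
proof
  show "smooth_on E Q"
    unfolding Q_def[abs_def]
    by (intro smooth_add[OF open_E] smooth_congruence smooth_schouten smooth_scaleR[OF open_E] Sigma.smooth_G
        smooth_divide[OF open_E] smooth_power[OF open_E] smooth_H smooth_const) auto
  show "Q y $ \<alpha> $ \<beta> = Q y $ \<beta> $ \<alpha>" if "y \<in> E" for y \<alpha> \<beta>
    unfolding Q_component using schouten_self_adjoint[OF inD[OF that]] Sigma.G_sym[OF that] by metis
qed

sublocale pulled: metric_connection E S "\<lambda>y. h (\<phi> y)"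
  by (rule metric_connection_pull[OF open_E smooth_\<phi> image])

definition pgam :: "'m \<Rightarrow> real^'m \<Rightarrow> real^'n^'n" where
  "pgam \<alpha> y = (\<Sum>a\<in>UNIV. (pd \<alpha> \<phi> y $ a) *\<^sub>R gam G a (\<phi> y))"

lemma row_combination:
  fixes M :: "real^'n^'n"
  assumes "\<And>a b. M $ a $ b = M $ b $ a"
  shows "(\<Sum>a\<in>UNIV. (u $ a) *\<^sub>R (M $ a)) = M *v u"
proof -
  have e: "u $ a * M $ a $ b = M $ b $ a * u $ a" for a b
    using assms[of a b] by simp
  show ?thesis by (simp add: vec_eq_iff matrix_vector_mult_def e)
qed

lemma pull_tform:
  assumes y: "y \<in> E"
  shows "S \<alpha> y w = (- (fst (snd w) \<bullet> pd \<alpha> \<phi> y),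
     - (pgam \<alpha> y *v fst (snd w)) + snd (snd w) *\<^sub>R (G (\<phi> y) *v pd \<alpha> \<phi> y)
       + fst w *\<^sub>R (schouten G (\<phi> y) *v pd \<alpha> \<phi> y),
     - ((schouten G (\<phi> y) *v pd \<alpha> \<phi> y) \<bullet> (Ginv G (\<phi> y) *v fst (snd w))))"
proof -
  note x = inD[OF y]
  let ?J = "pd \<alpha> \<phi> y"
  have 1: "(\<Sum>a\<in>UNIV. ?J $ a *\<^sub>R (gam G a (\<phi> y) *v v)) = pgam \<alpha> y *v v" for v
    unfolding pgam_def
    by (simp add: bounded_bilinear.sum_left[OF bounded_bilinear_matrix_vector_mult] scaleR_matrix_vector_assoc)
  have 2: "(\<Sum>a\<in>UNIV. ?J $ a *\<^sub>R (G (\<phi> y) $ a)) = G (\<phi> y) *v ?J"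
    by (rule row_combination[OF G_sym[OF x]])
  have 3: "(\<Sum>a\<in>UNIV. ?J $ a *\<^sub>R (schouten G (\<phi> y) $ a)) = schouten G (\<phi> y) *v ?J"
    by (rule row_combination[OF schouten_sym[OF x]])
  have "(\<Sum>a\<in>UNIV. ?J $ a *\<^sub>R (- (gam G a (\<phi> y) *v m) + r *\<^sub>R (G (\<phi> y) $ a) + s *\<^sub>R (schouten G (\<phi> y) $ a)))
    = - (\<Sum>a\<in>UNIV. ?J $ a *\<^sub>R (gam G a (\<phi> y) *v m)) + r *\<^sub>R (\<Sum>a\<in>UNIV. ?J $ a *\<^sub>R (G (\<phi> y) $ a))
      + s *\<^sub>R (\<Sum>a\<in>UNIV. ?J $ a *\<^sub>R (schouten G (\<phi> y) $ a))" for m r s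
    by (simp add: scaleR_add_right scaleR_diff_right sum.distrib sum_negf sum_subtractf scaleR_sum_right mult.commute)
  then have m: "(\<Sum>a\<in>UNIV. ?J $ a *\<^sub>R (- (gam G a (\<phi> y) *v m) + r *\<^sub>R (G (\<phi> y) $ a) + s *\<^sub>R (schouten G (\<phi> y) $ a)))
    = - (pgam \<alpha> y *v m) + r *\<^sub>R (G (\<phi> y) *v ?J) + s *\<^sub>R (schouten G (\<phi> y) *v ?J)" for m r s
    by (simp only: 1 2 3)
  have l: "(\<Sum>a\<in>UNIV. ?J $ a * (schouten G (\<phi> y) $ a \<bullet> v)) = (schouten G (\<phi> y) *v ?J) \<bullet> v" for v
    unfolding 3[symmetric] by (simp add: inner_sum_left)
  have f: "(\<Sum>a\<in>UNIV. ?J $ a * v $ a) = v \<bullet> ?J" for v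
    by (simp add: inner_vec_def mult.commute)
  show ?thesis
    unfolding pull_def tform_def prod_eq_iff fst_sum snd_sum fst_scaleR snd_scaleR fst_conv snd_conv m
    by (simp add: sum_negf l f)
qed

lemma cov_S:
  assumes V: "smooth_on E V" and y: "y \<in> E"
  shows "cov S \<alpha> V y = (pd \<alpha> (\<lambda>y. fst (V y)) y - fst (snd (V y)) \<bullet> pd \<alpha> \<phi> y,
    pd \<alpha> (\<lambda>y. fst (snd (V y))) y - pgam \<alpha> y *v fst (snd (V y)) + snd (snd (V y)) *\<^sub>R (G (\<phi> y) *v pd \<alpha> \<phi> y)
      + fst (V y) *\<^sub>R (schouten G (\<phi> y) *v pd \<alpha> \<phi> y),
    pd \<alpha> (\<lambda>y. snd (snd (V y))) y - (schouten G (\<phi> y) *v pd \<alpha> \<phi> y) \<bullet> (Ginv G (\<phi> y) *v fst (snd (V y))))"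
proof -
  note d = smooth_on_differentiable[OF V open_E y]
  show ?thesis
    using pd_linear[OF bounded_linear_fst d] pd_linear[OF bounded_linear_compose[OF bounded_linear_fst bounded_linear_snd] d]
      pd_linear[OF bounded_linear_compose[OF bounded_linear_snd bounded_linear_snd] d]
    by (cases "pd \<alpha> V y") (simp add: cov_def pull_tform[OF y])
qed

lemma smooth_N: "smooth_on E N"
  by (intro smooth_Pair[OF open_E] smooth_const smooth_\<nu> smooth_minus[OF open_E] smooth_H)

text \<open>The middle slot of the parallel equation is umbilicity; the last slot is a Codazzi
  equation that gives the derivative of \<open>H\<close> as the mixed normal and tangential part of
  the Schouten tensor.\<close>

lemma parallel_\<nu>:
  assumes y: "y \<in> E"
  shows "pd \<alpha> \<nu> y = pgam \<alpha> y *v \<nu> y + H y *\<^sub>R (G (\<phi> y) *v pd \<alpha> \<phi> y)"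
    and "pd \<alpha> H y = - ((schouten G (\<phi> y) *v pd \<alpha> \<phi> y) \<bullet> (Ginv G (\<phi> y) *v \<nu> y))"
  using parallel[OF y, of \<alpha>] pd_minus[OF smooth_on_differentiable[OF smooth_H open_E y]]
  by (simp_all add: cov_S[OF smooth_N y] zero_prod_def algebra_simps add_eq_0_iff)

lemma pd_induced:
  assumes y: "y \<in> E"
  shows "pd \<alpha> \<gamma> y $ \<beta> $ \<delta> = (pd \<alpha> (pd \<beta> \<phi>) y + pd \<beta> \<phi> y v* pgam \<alpha> y) \<bullet> (G (\<phi> y) *v pd \<delta> \<phi> y)
    + (pd \<alpha> (pd \<delta> \<phi>) y + pd \<delta> \<phi> y v* pgam \<alpha> y) \<bullet> (G (\<phi> y) *v pd \<beta> \<phi> y)"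
proof -
  note x = inD[OF y]
  note dJ = smooth_on_differentiable[OF smooth_pd_\<phi> open_E y]
  have dG: "(\<lambda>y. G (\<phi> y)) differentiable (at y)"
    by (rule smooth_on_differentiable[OF smooth_compose[OF open_D open_E smooth_G smooth_\<phi> image] open_E y])
  have "pd \<alpha> (\<lambda>y. G (\<phi> y)) y = (\<Sum>a\<in>UNIV. (pd \<alpha> \<phi> y $ a) *\<^sub>R pd a G (\<phi> y))"
    by (rule pd_compose[OF smooth_on_differentiable[OF smooth_\<phi> open_E y] differentiable_G[OF x]])
  also have "\<dots> = pgam \<alpha> y ** G (\<phi> y) + G (\<phi> y) ** transpose (pgam \<alpha> y)"
    unfolding pgam_def
    by (simp add: pd_G[OF x] bounded_bilinear.sum_left[OF bounded_bilinear_matrix_matrix_mult]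
        bounded_bilinear.sum_right[OF bounded_bilinear_matrix_matrix_mult]
        bounded_bilinear.scaleR_left[OF bounded_bilinear_matrix_matrix_mult]
        bounded_bilinear.scaleR_right[OF bounded_bilinear_matrix_matrix_mult]
        linear_sum[OF bounded_linear.linear[OF bounded_linear_transpose]]
        linear_cmul[OF bounded_linear.linear[OF bounded_linear_transpose]] scaleR_add_right sum.distrib)
  finally have pG: "pd \<alpha> (\<lambda>y. G (\<phi> y)) y = pgam \<alpha> y ** G (\<phi> y) + G (\<phi> y) ** transpose (pgam \<alpha> y)" .
  have "pd \<alpha> \<gamma> y $ \<beta> $ \<delta> = pd \<alpha> (\<lambda>y. \<gamma> y $ \<beta> $ \<delta>) y"
    by (rule pd_linear[OF bounded_linear_compose[OF bounded_linear_vec_nth bounded_linear_vec_nth]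
        Sigma.differentiable_G[OF y], symmetric])
  also have "\<dots> = pd \<beta> \<phi> y \<bullet> (G (\<phi> y) *v pd \<alpha> (pd \<delta> \<phi>) y) + pd \<beta> \<phi> y \<bullet> (pd \<alpha> (\<lambda>y. G (\<phi> y)) y *v pd \<delta> \<phi> y)
      + pd \<alpha> (pd \<beta> \<phi>) y \<bullet> (G (\<phi> y) *v pd \<delta> \<phi> y)"
    unfolding induced_component
    by (simp add: pd_bilinear[OF bounded_bilinear_inner dJ differentiable_bilinear[OF bounded_bilinear_matrix_vector_mult dG dJ]]
        pd_bilinear[OF bounded_bilinear_matrix_vector_mult dG dJ] inner_add_right)
  also have "pd \<beta> \<phi> y \<bullet> (pd \<alpha> (\<lambda>y. G (\<phi> y)) y *v pd \<delta> \<phi> y)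
    = (pd \<beta> \<phi> y v* pgam \<alpha> y) \<bullet> (G (\<phi> y) *v pd \<delta> \<phi> y) + (pd \<delta> \<phi> y v* pgam \<alpha> y) \<bullet> (G (\<phi> y) *v pd \<beta> \<phi> y)"
    unfolding pG
    by (simp add: matrix_vector_mult_add_rdistrib inner_add_right dot_lmul_matrix matrix_vector_mul_assoc[symmetric]
        G_self_adjoint[OF x, of "pd \<beta> \<phi> y"])
  finally show ?thesis
    by (simp add: inner_add_right inner_add_left G_self_adjoint[OF x, of "pd \<beta> \<phi> y" "pd \<alpha> (pd \<delta> \<phi>) y"])
qed

text \<open>The Gauss formula: the second fundamental form is \<open>- H \<gamma>\<close>.\<close>

lemma gauss_formula:
  assumes y: "y \<in> E"
  shows "pd \<alpha> (pd \<beta> \<phi>) y + pd \<beta> \<phi> y v* pgam \<alpha> y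
    = (\<Sum>\<delta>\<in>UNIV. christoffel \<gamma> y \<delta> \<alpha> \<beta> *\<^sub>R pd \<delta> \<phi> y) - (H y * \<gamma> y $ \<alpha> $ \<beta>) *\<^sub>R (Ginv G (\<phi> y) *v \<nu> y)"
    (is "?S \<alpha> \<beta> = ?R")
proof -
  note x = inD[OF y]
  note dJ = smooth_on_differentiable[OF smooth_pd_\<phi> open_E y]
  let ?n = "Ginv G (\<phi> y) *v \<nu> y"
  \<comment> \<open>Partial derivatives of \<phi> commute and the ambient connection is
    torsion-free.\<close>
  have sym_S: "?S \<alpha> \<beta> = ?S \<beta> \<alpha>" for \<alpha> \<beta>
  proof -
    have "(pd \<beta> \<phi> y v* pgam \<alpha> y) $ e = (\<Sum>b\<in>UNIV. \<Sum>a\<in>UNIV. pd \<alpha> \<phi> y $ a * pd \<beta> \<phi> y $ b * christoffel G (\<phi> y) e a b)" for \<alpha> \<beta> e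
      by (simp add: vector_matrix_mult_def pgam_def gam_def sum_distrib_left sum_distrib_right ac_simps)
    moreover have "(\<Sum>b\<in>UNIV. \<Sum>a\<in>UNIV. pd \<alpha> \<phi> y $ a * pd \<beta> \<phi> y $ b * christoffel G (\<phi> y) e a b)
      = (\<Sum>b\<in>UNIV. \<Sum>a\<in>UNIV. pd \<beta> \<phi> y $ a * pd \<alpha> \<phi> y $ b * christoffel G (\<phi> y) e a b)" for e
      by (subst sum.swap) (intro sum.cong refl, metis christoffel_sym[OF x] mult.commute)
    ultimately show ?thesis
      by (simp add: vec_eq_iff pd_commute[OF smooth_\<phi> open_E y, of \<alpha> \<beta>])
  qed
  define w where "w = ?S \<alpha> \<beta> - ?R"
  \<comment> \<open>The normal component: differentiate the conormal condition and insert
    umbilicity.\<close>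
  have "\<nu> y \<bullet> ?S \<alpha> \<beta> = - H y * \<gamma> y $ \<alpha> $ \<beta>"
  proof -
    have "pd \<alpha> (\<lambda>y. \<nu> y \<bullet> pd \<beta> \<phi> y) y = pd \<alpha> (\<lambda>y. 0) y"
      by (rule pd_cong[OF open_E y conormal])
    then have "\<nu> y \<bullet> pd \<alpha> (pd \<beta> \<phi>) y = - (pd \<alpha> \<nu> y \<bullet> pd \<beta> \<phi> y)"
      using pd_bilinear[OF bounded_bilinear_inner smooth_on_differentiable[OF smooth_\<nu> open_E y] dJ, of \<alpha> \<beta>] by simp
    moreover have "\<nu> y \<bullet> (pd \<beta> \<phi> y v* pgam \<alpha> y) = (pgam \<alpha> y *v \<nu> y) \<bullet> pd \<beta> \<phi> y"
      by (metis dot_lmul_matrix inner_commute)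
    ultimately show ?thesis
      by (simp add: parallel_\<nu>(1)[OF y] inner_add_left inner_add_right induced_component inner_commute
          G_self_adjoint[OF x, of "pd \<alpha> \<phi> y"])
  qed
  moreover have "\<nu> y \<bullet> ?R = - H y * \<gamma> y $ \<alpha> $ \<beta>"
    by (simp add: inner_diff_right inner_sum_right conormal[OF y] unit[OF y])
  ultimately have w1: "\<nu> y \<bullet> w = 0" by (simp add: w_def inner_diff_right)
  \<comment> \<open>The tangential component is Koszul's argument: in the combination of derivatives
    of the induced metric that defines its Christoffel symbols, symmetry leaves a single
    term.\<close>
  have w2: "(G (\<phi> y) *v w) v* J y = 0"
  proof -
    have "(G (\<phi> y) *v w) \<bullet> pd \<delta> \<phi> y = 0" for \<delta>
    proof -
      have "?S \<alpha> \<beta> \<bullet> (G (\<phi> y) *v pd \<delta> \<phi> y) = (\<Sum>k\<in>UNIV. christoffel \<gamma> y k \<alpha> \<beta> * \<gamma> y $ k $ \<delta>)"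
        unfolding Sigma.lower_christoffel[OF y] pd_induced[OF y]
        using sym_S[of \<alpha> \<delta>] sym_S[of \<beta> \<delta>] sym_S[of \<beta> \<alpha>] by simp
      moreover have "?R \<bullet> (G (\<phi> y) *v pd \<delta> \<phi> y) = (\<Sum>k\<in>UNIV. christoffel \<gamma> y k \<alpha> \<beta> * \<gamma> y $ k $ \<delta>)"
      proof -
        have "?n \<bullet> (G (\<phi> y) *v pd \<delta> \<phi> y) = 0"
          by (simp add: G_self_adjoint[OF x, of ?n] matrix_vector_mul_assoc Ginv_right[OF x] inner_commute conormal[OF y])
        then show ?thesis by (simp add: inner_diff_left inner_sum_left induced_component)
      qed
      ultimately have "w \<bullet> (G (\<phi> y) *v pd \<delta> \<phi> y) = 0" by (simp add: w_def inner_diff_left)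
      then show ?thesis by (metis G_self_adjoint[OF x] inner_commute)
    qed
    then show ?thesis by (simp add: vec_eq_iff vector_jacobian)
  qed
  have "w = 0" using completeness[OF y, of w] by (simp add: w1 w2)
  then show ?thesis by (simp add: w_def)
qed

text \<open>Orthogonal projection along N followed by the identification with intrinsic tractors,
  see \<open>intrinsic_projection\<close>. It is defined on all ambient tractors so that it applies
  to arbitrary sections. Removing the N component adds the term with
  \<open>h (\<phi> y) (N y) w\<close> in the last slot and leaves the middle slot alone, as J kills
  the conormal.\<close>

definition \<Psi> :: "real^'m \<Rightarrow> 'n tractor \<Rightarrow> 'm tractor" where
  "\<Psi> y w = (fst w, fst (snd w) v* J y, snd (snd w) + (H y)\<^sup>2 / 2 * fst w + H y * h (\<phi> y) (N y) w)"

lemma family_\<Psi>: "smooth_family E \<Psi>"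
proof (rule smooth_familyI)
  show "linear (\<Psi> y)" if "y \<in> E" for y
    unfolding \<Psi>_def[abs_def]
    by (rule linearI)
      (auto simp: linear_add[OF linear_h(1)[OF inD[OF that]]] linear_cmul[OF linear_h(1)[OF inD[OF that]]]
        vector_matrix_left_distrib scaleR_vector_matrix_assoc algebra_simps simp del: tractor_h.simps)
  show "smooth_on E (\<lambda>y. \<Psi> y w)" for w
    unfolding \<Psi>_def vector_matrix_mult_def
    by (intro smooth_Pair[OF open_E] smooth_const smooth_vec_lambda[OF open_E] smooth_sum[OF open_E]
        smooth_mult[OF open_E] smooth_add[OF open_E] smooth_vec_nth[OF open_E] smooth_J smooth_H
        smooth_divide[OF open_E] smooth_power[OF open_E] pulled.h smooth_N) auto
qed

text \<open>\<open>completeness\<close> splits the ambient contraction with the Schouten tensor; its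
  normal part is minus the derivative of \<open>H\<close> times the normal component of \<mu>, by
  \<open>parallel_\<nu>\<close>.\<close>

lemma Q_row_contract:
  assumes y: "y \<in> E"
  shows "Q y $ \<alpha> \<bullet> (Ginv \<gamma> y *v (\<mu> v* J y)) = (schouten G (\<phi> y) *v pd \<alpha> \<phi> y) \<bullet> (Ginv G (\<phi> y) *v \<mu>)
    + pd \<alpha> H y * (\<nu> y \<bullet> (Ginv G (\<phi> y) *v \<mu>)) + (H y)\<^sup>2 / 2 * (\<mu> \<bullet> pd \<alpha> \<phi> y)"
proof -
  note x = inD[OF y]
  let ?P = "schouten G (\<phi> y) *v pd \<alpha> \<phi> y" and ?u = "Ginv \<gamma> y *v (\<mu> v* J y)"
  have r: "Q y $ \<alpha> = (?P v* J y) + ((H y)\<^sup>2 / 2) *\<^sub>R (\<gamma> y $ \<alpha>)"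
    by (simp add: vec_eq_iff vector_jacobian Q_component schouten_self_adjoint[OF x, of "pd \<alpha> \<phi> y"] inner_commute)
  have "(\<gamma> y $ \<alpha>) \<bullet> ?u = \<mu> \<bullet> pd \<alpha> \<phi> y"
    by (simp add: Sigma.Ginv_self_adjoint[OF y] Sigma.Ginv_G_row[OF y] inner_axis' vector_jacobian)
  moreover have "(?P v* J y) \<bullet> ?u = ?P \<bullet> (Ginv G (\<phi> y) *v \<mu>) + pd \<alpha> H y * (\<nu> y \<bullet> (Ginv G (\<phi> y) *v \<mu>))"
  proof -
    have "Ginv G (\<phi> y) *v \<mu> = J y *v ?u + (\<nu> y \<bullet> (Ginv G (\<phi> y) *v \<mu>)) *\<^sub>R (Ginv G (\<phi> y) *v \<nu> y)"
      using completeness[OF y, of "Ginv G (\<phi> y) *v \<mu>"] by (simp add: matrix_vector_mul_assoc Ginv_right[OF x])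
    then have "?P \<bullet> (Ginv G (\<phi> y) *v \<mu>) = ?P \<bullet> (J y *v ?u)
        + (\<nu> y \<bullet> (Ginv G (\<phi> y) *v \<mu>)) * (?P \<bullet> (Ginv G (\<phi> y) *v \<nu> y))"
      by (metis inner_add_right inner_scaleR_right)
    then show ?thesis by (simp add: parallel_\<nu>(2)[OF y] dot_lmul_matrix)
  qed
  ultimately show ?thesis unfolding r by (simp add: inner_add_left)
qed

text \<open>Slot by slot, the Gauss formula converts the intrinsic Christoffel symbols in the middle
  slot and \<open>Q_row_contract\<close> handles the last one. Since N is parallel, the derivative
  of its pairing with V is its pairing with the derivative of V.\<close>

lemma \<Psi>_intertwines:
  assumes V: "smooth_on E V" and y: "y \<in> E"
  shows "cov (tform \<gamma> Q) \<alpha> (\<lambda>y. \<Psi> y (V y)) y = \<Psi> y (cov S \<alpha> V y)"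
proof -
  note x = inD[OF y]
  note d = smooth_on_differentiable[OF _ open_E y]
  note sV = smooth_fst[OF open_E V] smooth_fst[OF open_E smooth_snd[OF open_E V]] smooth_snd[OF open_E smooth_snd[OF open_E V]]
  let ?s = "fst (V y)" and ?m = "fst (snd (V y))" and ?r = "snd (snd (V y))"
  let ?N = "h (\<phi> y) (N y)"
  have sN: "smooth_on E (\<lambda>y. h (\<phi> y) (N y) (V y))" by (rule pulled.h[OF smooth_N V])
  have pN: "pd \<alpha> (\<lambda>y. h (\<phi> y) (N y) (V y)) y = ?N (cov S \<alpha> V y)"
    using pulled.compat[OF smooth_N V y, of \<alpha>] parallel[OF y, of \<alpha>]
    by (simp add: linear_0[OF linear_h(2)[OF x]] del: tractor_h.simps)
  have hN: "?N w = \<nu> y \<bullet> (Ginv G (\<phi> y) *v fst (snd w)) - H y * fst w" for w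
    by (cases w) (simp add: Ginv_def)
  have s2: "smooth_on E (\<lambda>y. (H y)\<^sup>2 / 2 * fst (V y))"
    by (intro smooth_mult[OF open_E] smooth_divide[OF open_E] smooth_power[OF open_E] smooth_H smooth_const sV) auto
  have s3: "smooth_on E (\<lambda>y. H y * h (\<phi> y) (N y) (V y))"
    by (intro smooth_mult[OF open_E] smooth_H sN)
  have pH: "pd \<alpha> (\<lambda>y. (H y)\<^sup>2 / 2) y = H y * pd \<alpha> H y"
  proof -
    have "pd \<alpha> (\<lambda>y. (1/2) * (H y * H y)) y = (1/2) * (H y * pd \<alpha> H y + pd \<alpha> H y * H y)"
      using pd_linear[OF bounded_linear_mult_right differentiable_bilinear[OF bounded_bilinear_mult d[OF smooth_H] d[OF smooth_H]], of \<alpha> "1/2"]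
      by (simp add: pd_bilinear[OF bounded_bilinear_mult d[OF smooth_H] d[OF smooth_H]])
    then show ?thesis by (simp add: power2_eq_square)
  qed
  have dH: "(\<lambda>y. (H y)\<^sup>2 / 2) differentiable (at y)"
    by (intro d smooth_divide[OF open_E] smooth_power[OF open_E] smooth_H smooth_const) auto
  have p3: "pd \<alpha> (\<lambda>y. snd (snd (V y)) + (H y)\<^sup>2 / 2 * fst (V y) + H y * h (\<phi> y) (N y) (V y)) y
      = pd \<alpha> (\<lambda>y. snd (snd (V y))) y + ((H y)\<^sup>2 / 2 * pd \<alpha> (\<lambda>y. fst (V y)) y + H y * pd \<alpha> H y * ?s)
      + (H y * ?N (cov S \<alpha> V y) + pd \<alpha> H y * ?N (V y))"
    by (simp only: pd_add[OF differentiable_add[OF d[OF sV(3)] d[OF s2]] d[OF s3]] pd_add[OF d[OF sV(3)] d[OF s2]]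
        pd_bilinear[OF bounded_bilinear_mult dH d[OF sV(1)]] pH pd_bilinear[OF bounded_bilinear_mult d[OF smooth_H] d[OF sN]] pN)
  have p2: "pd \<alpha> (\<lambda>y. fst (snd (V y)) v* J y) y $ \<beta> = pd \<alpha> (\<lambda>y. fst (snd (V y))) y \<bullet> pd \<beta> \<phi> y + ?m \<bullet> pd \<alpha> (pd \<beta> \<phi>) y" for \<beta>
  proof -
    have s: "smooth_on E (\<lambda>y. fst (snd (V y)) v* J y)"
      unfolding vector_matrix_mult_def
      by (intro smooth_vec_lambda[OF open_E] smooth_sum[OF open_E] smooth_mult[OF open_E] smooth_vec_nth[OF open_E] smooth_J sV)
    have "pd \<alpha> (\<lambda>y. fst (snd (V y)) v* J y) y $ \<beta> = pd \<alpha> (\<lambda>y. fst (snd (V y)) \<bullet> pd \<beta> \<phi> y) y"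
      using pd_linear[OF bounded_linear_vec_nth d[OF s], of \<alpha> \<beta>] by (simp add: vector_jacobian)
    then show ?thesis
      by (simp add: pd_bilinear[OF bounded_bilinear_inner d[OF sV(2)] d[OF smooth_pd_\<phi>]])
  qed
  have g2: "(gam \<gamma> \<alpha> y *v (?m v* J y)) $ \<beta>
     = ?m \<bullet> pd \<alpha> (pd \<beta> \<phi>) y + (pgam \<alpha> y *v ?m) \<bullet> pd \<beta> \<phi> y + H y * (\<nu> y \<bullet> (Ginv G (\<phi> y) *v ?m)) * \<gamma> y $ \<alpha> $ \<beta>" for \<beta>
  proof -
    have "(gam \<gamma> \<alpha> y *v (?m v* J y)) $ \<beta> = ?m \<bullet> (\<Sum>\<delta>\<in>UNIV. christoffel \<gamma> y \<delta> \<alpha> \<beta> *\<^sub>R pd \<delta> \<phi> y)"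
      by (simp add: matrix_vector_mult_def gam_def vector_jacobian inner_sum_right)
    also have "(\<Sum>\<delta>\<in>UNIV. christoffel \<gamma> y \<delta> \<alpha> \<beta> *\<^sub>R pd \<delta> \<phi> y) = pd \<alpha> (pd \<beta> \<phi>) y + pd \<beta> \<phi> y v* pgam \<alpha> y
       + (H y * \<gamma> y $ \<alpha> $ \<beta>) *\<^sub>R (Ginv G (\<phi> y) *v \<nu> y)"
      using gauss_formula[OF y, of \<alpha> \<beta>] by (simp add: algebra_simps)
    also have "?m \<bullet> \<dots> = ?m \<bullet> pd \<alpha> (pd \<beta> \<phi>) y + (pgam \<alpha> y *v ?m) \<bullet> pd \<beta> \<phi> y
       + H y * \<gamma> y $ \<alpha> $ \<beta> * (\<nu> y \<bullet> (Ginv G (\<phi> y) *v ?m))"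
    proof -
      have "?m \<bullet> (pd \<beta> \<phi> y v* pgam \<alpha> y) = (pgam \<alpha> y *v ?m) \<bullet> pd \<beta> \<phi> y"
        by (metis dot_lmul_matrix inner_commute)
      moreover have "?m \<bullet> (Ginv G (\<phi> y) *v \<nu> y) = \<nu> y \<bullet> (Ginv G (\<phi> y) *v ?m)"
        by (metis Ginv_self_adjoint[OF x] inner_commute)
      ultimately show ?thesis by (simp add: inner_add_right)
    qed
    finally show ?thesis by simp
  qed
  have s\<Psi>: "smooth_on E (\<lambda>y. \<Psi> y (V y))" by (rule smooth_family_apply[OF open_E family_\<Psi> V])
  have cS: "fst (cov S \<alpha> V y) = pd \<alpha> (\<lambda>y. fst (V y)) y - ?m \<bullet> pd \<alpha> \<phi> y"
    "fst (snd (cov S \<alpha> V y)) = pd \<alpha> (\<lambda>y. fst (snd (V y))) y - pgam \<alpha> y *v ?m + ?r *\<^sub>R (G (\<phi> y) *v pd \<alpha> \<phi> y)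
      + ?s *\<^sub>R (schouten G (\<phi> y) *v pd \<alpha> \<phi> y)"
    "snd (snd (cov S \<alpha> V y)) = pd \<alpha> (\<lambda>y. snd (snd (V y))) y - (schouten G (\<phi> y) *v pd \<alpha> \<phi> y) \<bullet> (Ginv G (\<phi> y) *v ?m)"
    by (simp_all add: cov_S[OF V y])
  show ?thesis
  proof (intro prod_eqI)
    show "fst (cov (tform \<gamma> Q) \<alpha> (\<lambda>y. \<Psi> y (V y)) y) = fst (\<Psi> y (cov S \<alpha> V y))"
      unfolding SigmaQ.cov_components[OF s\<Psi> y] by (simp add: \<Psi>_def cS vector_jacobian)
    show "snd (snd (cov (tform \<gamma> Q) \<alpha> (\<lambda>y. \<Psi> y (V y)) y)) = snd (snd (\<Psi> y (cov S \<alpha> V y)))"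
      unfolding SigmaQ.cov_components[OF s\<Psi> y]
      unfolding \<Psi>_def fst_conv snd_conv p3 Q_row_contract[OF y] hN[of "V y"] cS
      by (simp add: algebra_simps del: tractor_h.simps)
    show "fst (snd (cov (tform \<gamma> Q) \<alpha> (\<lambda>y. \<Psi> y (V y)) y)) = fst (snd (\<Psi> y (cov S \<alpha> V y)))"
      unfolding SigmaQ.cov_components[OF s\<Psi> y]
      unfolding \<Psi>_def fst_conv snd_conv cS hN
      by (simp add: vec_eq_iff p2 g2 vector_jacobian inner_add_left inner_diff_left Q_component
          induced_component inner_commute G_self_adjoint[OF x, of "pd \<alpha> \<phi> y"]
          schouten_self_adjoint[OF x, of "pd \<alpha> \<phi> y"] power2_eq_square algebra_simps del: tractor_h.simps)
  qed
qed

lemma curv_\<Psi>: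
  assumes y: "y \<in> E"
  shows "curv (tform \<gamma> Q) \<alpha> \<beta> y (\<Psi> y w)
    = \<Psi> y (\<Sum>a\<in>UNIV. \<Sum>b\<in>UNIV. (pd \<alpha> \<phi> y $ a * pd \<beta> \<phi> y $ b) *\<^sub>R \<Omega> a b (\<phi> y) w)"
  unfolding curv_pull[OF open_E smooth_\<phi> image y, symmetric]
  by (rule curv_intertwine[OF pulled.connection_axioms SigmaQ.connection_axioms family_\<Psi> \<Psi>_intertwines y])

text \<open>Each intrinsic tractor in the Z block comes from an ambient one in the Z block, and
  there the vanishing of the Weyl tensor controls the curvature.\<close>

lemma \<Psi>_lift:
  assumes y: "y \<in> E"
  shows "\<Psi> y (tZ (G (\<phi> y) *v (J y *v (Ginv \<gamma> y *v m)))) = tZ m"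
proof -
  have "(G (\<phi> y) *v (J y *v u)) v* J y = \<gamma> y *v u" for u
    unfolding induced_metric_def by (metis matrix_vector_mul_assoc transpose_matrix_vector)
  moreover have "\<nu> y \<bullet> (J y *v u) = 0" for u
    by (simp add: jacobian_mult inner_sum_right conormal[OF y])
  moreover have "\<gamma> y *v (Ginv \<gamma> y *v m) = m"
    by (simp add: matrix_vector_mul_assoc Sigma.Ginv_right[OF y])
  moreover have "Ginv G (\<phi> y) *v (G (\<phi> y) *v w) = w" for w
    by (simp add: matrix_vector_mul_assoc Ginv_left[OF inD[OF y]])
  ultimately show ?thesis
    by (simp add: \<Psi>_def Ginv_def[symmetric])
qed

text \<open>The Gauss equation: \<open>\<Psi>\<close> carries the vanishing middle slot of the curvature to the
  curvature of the connection defined by \<open>Q\<close>, whose trace then identifies \<open>Q\<close>.\<close>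

lemma Q_eq_schouten:
  assumes y: "y \<in> E"
  shows "schouten \<gamma> y = Q y"
proof -
  have 0: "fst (snd (curv (tform \<gamma> Q) \<alpha> \<beta> y (tZ m))) = 0" for \<alpha> \<beta> m
  proof -
    let ?w = "tZ (G (\<phi> y) *v (J y *v (Ginv \<gamma> y *v m)))"
    have "curv (tform \<gamma> Q) \<alpha> \<beta> y (tZ m)
      = \<Psi> y (\<Sum>a\<in>UNIV. \<Sum>b\<in>UNIV. (pd \<alpha> \<phi> y $ a * pd \<beta> \<phi> y $ b) *\<^sub>R \<Omega> a b (\<phi> y) ?w)"
      using curv_\<Psi>[OF y, of \<alpha> \<beta> ?w] by (simp only: \<Psi>_lift[OF y])
    moreover have "fst (snd (\<Omega> a b (\<phi> y) ?w)) = 0" for a b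
      by (rule curv_Z_of_weyl_zero[OF inD[OF y] weyl_zero[OF y]])
    ultimately show ?thesis by (simp add: \<Psi>_def fst_sum snd_sum del: tractor_h.simps)
  qed
  let ?m = "real CARD('m)" and ?t = "gtrace \<gamma> y (Q y)"
  \<comment> \<open>With its left-hand side zero, \<open>curv_trace\<close> becomes the equation
    that defines the Schouten tensor, with \<open>Q\<close> as a solution.\<close>
  have ric: "ricci \<gamma> y = (?m - 2) *\<^sub>R Q y + ?t *\<^sub>R \<gamma> y"
    using SigmaQ.curv_trace[OF y] by (simp add: 0 vec_eq_iff algebra_simps)
  have tr\<gamma>: "gtrace \<gamma> y (\<gamma> y) = ?m"
  proof -
    have "gtrace \<gamma> y (\<gamma> y) = (\<Sum>a\<in>UNIV. \<Sum>b\<in>UNIV. Ginv \<gamma> y $ a $ b * \<gamma> y $ b $ a)"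
      unfolding gtrace_def by (intro sum.cong refl) (metis Sigma.G_sym[OF y])
    then show ?thesis by (simp add: Sigma.Ginv_G[OF y])
  qed
  have "gtrace \<gamma> y (ricci \<gamma> y) = (?m - 2) * ?t + ?t * gtrace \<gamma> y (\<gamma> y)"
  proof -
    have "gtrace \<gamma> y (k *\<^sub>R A + l *\<^sub>R B) = k * gtrace \<gamma> y A + l * gtrace \<gamma> y B" for k l A B
      by (simp add: gtrace_def sum.distrib sum_distrib_left algebra_simps)
    then show ?thesis unfolding ric .
  qed
  \<comment> \<open>The trace of the Ricci tensor is (2 m - 2) times the trace of \<open>Q\<close>,
    so J is the trace of \<open>Q\<close>; the remaining division by m - 2 uses that m is at least
    3.\<close>
  then have "schoutenJ \<gamma> y = ?t"
    using dim_E by (simp add: schoutenJ_def tr\<gamma> field_simps)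
  then show ?thesis
    using dim_E by (simp add: schouten_def ric)
qed

sublocale SigmaP: schouten_form E \<gamma>
  by unfold_locales (rule dim_E)

lemma curv_schouten_eq:
  assumes y: "y \<in> E"
  shows "curv (tform \<gamma> (schouten \<gamma>)) \<alpha> \<beta> y w = curv (tform \<gamma> Q) \<alpha> \<beta> y w"
proof -
  have t: "tform \<gamma> (schouten \<gamma>) \<alpha> z w = tform \<gamma> Q \<alpha> z w" if "z \<in> E" for \<alpha> z w
    by (simp add: tform_def Q_eq_schouten[OF that])
  then have "pd \<alpha> (\<lambda>z. tform \<gamma> (schouten \<gamma>) \<beta> z w) y = pd \<alpha> (\<lambda>z. tform \<gamma> Q \<beta> z w) y" for \<alpha> \<beta> w
    by (rule pd_cong[OF open_E y])
  then show ?thesis by (simp add: curv_def t[OF y])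
qed

lemma tcurv_pull:
  assumes y: "y \<in> E"
  shows "tcurv_vec G (\<phi> y) (J y *v u) (J y *v v) w = (\<Sum>\<alpha>\<in>UNIV. \<Sum>\<beta>\<in>UNIV. (u $ \<alpha> * v $ \<beta>) *\<^sub>R curv S \<alpha> \<beta> y w)"
proof -
  have "tcurv_vec G (\<phi> y) (J y *v u) (J y *v v) w
    = (\<Sum>a\<in>UNIV. \<Sum>b\<in>UNIV. \<Sum>\<alpha>\<in>UNIV. \<Sum>\<beta>\<in>UNIV. (u $ \<alpha> * v $ \<beta>) *\<^sub>R ((pd \<alpha> \<phi> y $ a * pd \<beta> \<phi> y $ b) *\<^sub>R \<Omega> a b (\<phi> y) w))"
    unfolding tcurv_vec_def jacobian_mult
    by (simp add: tcurv_eq[OF inD[OF y]] sum_product scaleR_sum_left ac_simps)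
  also have "\<dots> = (\<Sum>\<alpha>\<in>UNIV. \<Sum>\<beta>\<in>UNIV. \<Sum>a\<in>UNIV. \<Sum>b\<in>UNIV. (u $ \<alpha> * v $ \<beta>) *\<^sub>R ((pd \<alpha> \<phi> y $ a * pd \<beta> \<phi> y $ b) *\<^sub>R \<Omega> a b (\<phi> y) w))"
    by (rule sum4_swap)
  finally show ?thesis
    by (simp only: curv_pull[OF open_E smooth_\<phi> image y] scaleR_sum_right)
qed

lemma tcurv_induced:
  assumes y: "y \<in> E"
  shows "tcurv_vec \<gamma> y u v (\<Psi> y w) = \<Psi> y (tcurv_vec G (\<phi> y) (J y *v u) (J y *v v) w)"
proof -
  have "curv (tform \<gamma> Q) \<alpha> \<beta> y (\<Psi> y w) = \<Psi> y (curv S \<alpha> \<beta> y w)" for \<alpha> \<beta>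
    by (rule curv_intertwine[OF pulled.connection_axioms SigmaQ.connection_axioms family_\<Psi> \<Psi>_intertwines y])
  then show ?thesis
    using smooth_family_linear[OF family_\<Psi> y]
    by (simp only: tcurv_pull[OF y] tcurv_vec_def[of \<gamma>] SigmaP.tcurv_eq[OF y] curv_schouten_eq[OF y] linear_sum linear_cmul)
qed

lemma curv_normal:
  assumes y: "y \<in> E"
  shows "tcurv_vec G (\<phi> y) (J y *v u) (J y *v v) (N y) = 0"
proof -
  have "curv S \<alpha> \<beta> y (N y) = 0" for \<alpha> \<beta>
    by (rule pulled.parallel_curv[OF smooth_N parallel y])
  then show ?thesis by (simp only: tcurv_pull[OF y] scaleR_zero_right sum.neutral_const)
qed

text \<open>Since the curvature is skew and kills N, its values are orthogonal to N, where the
  identification with intrinsic tractors is injective. This allows \<Omega> to be recovered from its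
  intrinsic image.\<close>

lemma tcurv_perp:
  assumes y: "y \<in> E"
  shows "h (\<phi> y) (N y) (tcurv_vec G (\<phi> y) (J y *v u) (J y *v v) w) = 0"
proof -
  note x = inD[OF y]
  have "h (\<phi> y) (N y) (tcurv_vec G (\<phi> y) (J y *v u) (J y *v v) w)
      = - h (\<phi> y) (tcurv_vec G (\<phi> y) (J y *v u) (J y *v v) (N y)) w"
    unfolding tcurv_vec_def by (simp only: tcurv_eq[OF x] h_simps x curv_skew real_scaleR_def sum_negf mult_minus_right minus_minus)
  then show ?thesis by (simp only: curv_normal[OF y] h_simps x)
qed

text \<open>The tensor contracted with \<nabla> n is the inverse metric minus the square of the
  normal, that is, the push-forward of the inverse induced metric (\<open>comp\<close>). So only
  tangential derivatives of the extension n enter (\<open>tang\<close>); they form \<open>H\<close>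
  times the induced metric, with trace m \<open>H\<close>, and m is the denominator in the mean
  curvature.\<close>

lemma mean_curv_eq:
  assumes y: "y \<in> E" and n: "n differentiable (at (\<phi> y))" and \<nu>n: "\<And>y. y \<in> E \<Longrightarrow> \<nu> y = n (\<phi> y)"
  shows "mean_curv_local G n (\<phi> y) = H y"
proof -
  note x = inD[OF y]
  let ?n = "Ginv G (\<phi> y) *v \<nu> y"
  define B where "B a b = pd a n (\<phi> y) $ b - (\<Sum>e\<in>UNIV. christoffel G (\<phi> y) e a b * \<nu> y $ e)" for a b
  have tang: "(\<Sum>a\<in>UNIV. \<Sum>b\<in>UNIV. pd \<alpha> \<phi> y $ a * pd \<beta> \<phi> y $ b * B a b) = H y * \<gamma> y $ \<alpha> $ \<beta>" for \<alpha> \<beta>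
  proof -
    have "pd \<alpha> \<nu> y = pd \<alpha> (\<lambda>y. n (\<phi> y)) y"
      by (rule pd_cong[OF open_E y \<nu>n])
    also have "\<dots> = (\<Sum>a\<in>UNIV. (pd \<alpha> \<phi> y $ a) *\<^sub>R pd a n (\<phi> y))"
      by (rule pd_compose[OF smooth_on_differentiable[OF smooth_\<phi> open_E y] n])
    finally have "H y *\<^sub>R (G (\<phi> y) *v pd \<alpha> \<phi> y)
        = (\<Sum>a\<in>UNIV. (pd \<alpha> \<phi> y $ a) *\<^sub>R pd a n (\<phi> y)) - pgam \<alpha> y *v \<nu> y"
      using parallel_\<nu>(1)[OF y, of \<alpha>] by (simp add: eq_diff_eq add.commute)
    also have "\<dots> = (\<Sum>a\<in>UNIV. (pd \<alpha> \<phi> y $ a) *\<^sub>R (pd a n (\<phi> y) - gam G a (\<phi> y) *v \<nu> y))"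
      unfolding pgam_def
      by (simp add: bounded_bilinear.sum_left[OF bounded_bilinear_matrix_vector_mult] scaleR_matrix_vector_assoc
          scaleR_diff_right sum_subtractf)
    also have "\<dots> = (\<Sum>a\<in>UNIV. (pd \<alpha> \<phi> y $ a) *\<^sub>R (\<chi> b. B a b))"
      by (intro sum.cong refl) (simp add: vec_eq_iff B_def gam_def matrix_vector_mult_def)
    finally have "(\<Sum>a\<in>UNIV. (pd \<alpha> \<phi> y $ a) *\<^sub>R (\<chi> b. B a b)) \<bullet> pd \<beta> \<phi> y
        = (H y *\<^sub>R (G (\<phi> y) *v pd \<alpha> \<phi> y)) \<bullet> pd \<beta> \<phi> y"
      by (rule arg_cong[OF HOL.sym])
    then have "(\<Sum>a\<in>UNIV. (pd \<alpha> \<phi> y $ a) *\<^sub>R (\<chi> b. B a b)) \<bullet> pd \<beta> \<phi> y = H y * \<gamma> y $ \<alpha> $ \<beta>"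
      by (simp add: induced_component inner_commute G_self_adjoint[OF x, of "pd \<alpha> \<phi> y"])
    then show ?thesis
      by (subst sum.swap) (simp add: inner_sum_left inner_vec_def sum_distrib_left ac_simps)
  qed
  have comp: "Ginv G (\<phi> y) $ a $ b - ?n $ a * ?n $ b
      = (\<Sum>\<alpha>\<in>UNIV. \<Sum>\<beta>\<in>UNIV. Ginv \<gamma> y $ \<alpha> $ \<beta> * (pd \<alpha> \<phi> y $ a * pd \<beta> \<phi> y $ b))" for a b
  proof -
    have "Ginv G (\<phi> y) *v axis b 1 = J y *v (Ginv \<gamma> y *v (axis b 1 v* J y)) + (\<nu> y \<bullet> (Ginv G (\<phi> y) *v axis b 1)) *\<^sub>R ?n"
      using completeness[OF y, of "Ginv G (\<phi> y) *v axis b 1"] by (simp add: matrix_vector_mul_assoc Ginv_right[OF x])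
    moreover have "\<nu> y \<bullet> (Ginv G (\<phi> y) *v axis b 1) = ?n $ b"
      by (simp only: Ginv_self_adjoint[OF x] inner_axis inner_real_def mult_1_right)
    moreover have "(Ginv G (\<phi> y) *v axis b 1) $ a = Ginv G (\<phi> y) $ a $ b"
      by (simp add: matrix_vector_mult_basis column_def)
    ultimately have "Ginv G (\<phi> y) $ a $ b = (J y *v (Ginv \<gamma> y *v (axis b 1 v* J y))) $ a + ?n $ b * ?n $ a"
      by (metis vector_add_component vector_scaleR_component real_scaleR_def)
    moreover have "(J y *v (Ginv \<gamma> y *v (axis b 1 v* J y))) $ a
        = (\<Sum>\<alpha>\<in>UNIV. \<Sum>\<beta>\<in>UNIV. Ginv \<gamma> y $ \<alpha> $ \<beta> * (pd \<alpha> \<phi> y $ a * pd \<beta> \<phi> y $ b))"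
      by (simp add: jacobian_mult matrix_vector_mult_def[of "Ginv \<gamma> y"] vector_jacobian inner_axis' sum_distrib_left
          sum_distrib_right ac_simps)
    ultimately show ?thesis by simp
  qed
  have "(\<Sum>a\<in>UNIV. \<Sum>b\<in>UNIV. Ginv G (\<phi> y) $ a $ b * B a b) - (\<Sum>a\<in>UNIV. \<Sum>b\<in>UNIV. ?n $ a * ?n $ b * B a b)
      = (\<Sum>a\<in>UNIV. \<Sum>b\<in>UNIV. (Ginv G (\<phi> y) $ a $ b - ?n $ a * ?n $ b) * B a b)"
    by (simp only: left_diff_distrib sum_subtractf)
  also have "\<dots> = (\<Sum>a\<in>UNIV. \<Sum>b\<in>UNIV. \<Sum>\<alpha>\<in>UNIV. \<Sum>\<beta>\<in>UNIV. Ginv \<gamma> y $ \<alpha> $ \<beta> * (pd \<alpha> \<phi> y $ a * pd \<beta> \<phi> y $ b * B a b))"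
    by (simp only: comp sum_distrib_right mult.assoc)
  also have "\<dots> = (\<Sum>\<alpha>\<in>UNIV. \<Sum>\<beta>\<in>UNIV. \<Sum>a\<in>UNIV. \<Sum>b\<in>UNIV. Ginv \<gamma> y $ \<alpha> $ \<beta> * (pd \<alpha> \<phi> y $ a * pd \<beta> \<phi> y $ b * B a b))"
    by (rule sum4_swap)
  also have "\<dots> = (\<Sum>\<alpha>\<in>UNIV. \<Sum>\<beta>\<in>UNIV. Ginv \<gamma> y $ \<alpha> $ \<beta> * (H y * \<gamma> y $ \<beta> $ \<alpha>))"
    by (simp only: sum_distrib_left[symmetric] tang) (simp only: Sigma.G_sym[OF y])
  also have "\<dots> = (\<Sum>\<alpha>\<in>UNIV. H y * (\<Sum>\<beta>\<in>UNIV. Ginv \<gamma> y $ \<alpha> $ \<beta> * \<gamma> y $ \<beta> $ \<alpha>))"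
    by (simp only: sum_distrib_left mult.left_commute)
  also have "\<dots> = real CARD('m) * H y" by (simp add: Sigma.Ginv_G[OF y])
  finally show ?thesis
    using dim_E by (simp add: mean_curv_local_def Let_def \<nu>n[OF y, symmetric] B_def[symmetric] codim)
qed

end

context hypersurface
begin

definition intrinsic :: "real^'m \<Rightarrow> 'n tractor \<Rightarrow> 'm tractor" where
  "intrinsic y w = (fst w, (fst (snd w) - (H y * fst w) *\<^sub>R \<nu> y) v* J y, snd (snd w) + (1/2) * (H y)\<^sup>2 * fst w)"

lemma h_N: "h (\<phi> y) (N y) w = \<nu> y \<bullet> (Ginv G (\<phi> y) *v fst (snd w)) - H y * fst w"
  by (cases w) (simp add: Ginv_def)

lemma vector_J_shift: "y \<in> E \<Longrightarrow> (\<mu> - k *\<^sub>R \<nu> y) v* J y = \<mu> v* J y"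
  by (simp add: vec_eq_iff vector_jacobian inner_diff_left conormal)

lemma intrinsic_perp: "y \<in> E \<Longrightarrow> h (\<phi> y) (N y) w = 0 \<Longrightarrow> intrinsic y w = \<Psi> y w"
  by (simp only: intrinsic_def \<Psi>_def vector_J_shift) simp

lemma intrinsic_projection: "y \<in> E \<Longrightarrow> intrinsic y (w - h (\<phi> y) (N y) w *\<^sub>R N y) = \<Psi> y w"
  by (simp add: intrinsic_def \<Psi>_def vector_J_shift del: tractor_h.simps)

text \<open>Restricting a covector to the hypersurface loses only its normal component, and
  orthogonality to N fixes that component as \<open>H\<close> times the first slot.\<close>

lemma inj_intrinsic:
  assumes y: "y \<in> E"
  shows "inj_on (intrinsic y) {w. h (\<phi> y) (N y) w = 0}"
proof (rule inj_onI, unfold mem_Collect_eq)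
  fix v w assume N: "h (\<phi> y) (N y) v = 0" "h (\<phi> y) (N y) w = 0" and e: "intrinsic y v = intrinsic y w"
  then have f: "fst v = fst w" "fst (snd v) v* J y = fst (snd w) v* J y" "snd (snd v) = snd (snd w)"
    by (auto simp: intrinsic_def vector_J_shift[OF y])
  let ?d = "fst (snd v) - fst (snd w)"
  have "?d \<bullet> pd \<alpha> \<phi> y = 0" for \<alpha>
    using arg_cong[OF f(2), of "\<lambda>u. u $ \<alpha>"] by (simp add: vector_jacobian inner_diff_left)
  then have "?d = (?d \<bullet> (Ginv G (\<phi> y) *v \<nu> y)) *\<^sub>R \<nu> y"
    by (rule conormal_unique[OF y])
  moreover have "?d \<bullet> (Ginv G (\<phi> y) *v \<nu> y) = 0"
  proof -
    have "\<nu> y \<bullet> (Ginv G (\<phi> y) *v fst (snd v)) = \<nu> y \<bullet> (Ginv G (\<phi> y) *v fst (snd w))"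
      using N by (simp add: h_N f(1) del: tractor_h.simps)
    then show ?thesis
      by (simp add: inner_diff_left) (metis Ginv_self_adjoint[OF inD[OF y]] inner_commute)
  qed
  ultimately have "fst (snd v) = fst (snd w)" by simp
  then show "v = w" using f by (simp add: prod_eq_iff)
qed

end

section \<open>Consequences of a parallel tractor\<close>

context schouten_form
begin

lemma parallel_h_const:
  assumes V: "smooth_on D V" and par: "\<And>a y. y \<in> D \<Longrightarrow> cov (tform G (schouten G)) a V y = 0" and x: "x \<in> D"
  shows "pd a (\<lambda>x. h x (V x) (V x)) x = 0"
  using compat[OF V V x, of a] par[OF x, of a] by (simp only: linear_0[OF linear_h(1)[OF x]] linear_0[OF linear_h(2)[OF x]] add_0)

text \<open>Along a hypersurface in the zero set of \<open>\<sigma>\<close>, the normal tractor is a constant multiple of the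
  parallel tractor \<open>V\<close>; its last slot is the mean curvature.\<close>

lemma hypersurface_of_parallel:
  fixes E :: "(real^'m::finite) set"
  assumes emb: "embedded D G E \<phi> \<nu>" and V: "smooth_on D V"
    and par: "\<And>a y. y \<in> D \<Longrightarrow> cov (tform G (schouten G)) a V y = 0"
    and \<sigma>: "\<And>y. y \<in> E \<Longrightarrow> fst (V (\<phi> y)) = 0"
    and pos_h: "\<And>y. y \<in> E \<Longrightarrow> h (\<phi> y) (V (\<phi> y)) (V (\<phi> y)) > 0"
    and dm: "3 \<le> CARD('m)"
    and weyl: "\<And>y a b c d. y \<in> E \<Longrightarrow> weyl G (\<phi> y) a b c d = 0"
  shows "hypersurface D G E \<phi> \<nu>
    (\<lambda>y. - (snd (snd (V (\<phi> y))) / (fst (snd (V (\<phi> y))) \<bullet> (Ginv G (\<phi> y) *v \<nu> y))))"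
proof -
  interpret embedded D G E \<phi> \<nu> by fact
  let ?S = "pull \<phi> (tform G (schouten G))"
  interpret P: connection E ?S by (rule connection_pull[OF open_E smooth_\<phi> image])
  define m where "m y = fst (snd (V (\<phi> y))) \<bullet> (Ginv G (\<phi> y) *v \<nu> y)" for y
  let ?H = "\<lambda>y. - (snd (snd (V (\<phi> y))) / m y)"
  have sV: "smooth_on E (\<lambda>y. V (\<phi> y))" by (rule smooth_compose[OF open_D open_E V smooth_\<phi> image])
  have s\<mu>: "smooth_on E (\<lambda>y. fst (snd (V (\<phi> y))))" and s\<rho>: "smooth_on E (\<lambda>y. snd (snd (V (\<phi> y))))"
    by (rule smooth_fst[OF open_E smooth_snd[OF open_E sV]] smooth_snd[OF open_E smooth_snd[OF open_E sV]])+
  have sm: "smooth_on E m"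
    unfolding m_def[abs_def]
    by (intro smooth_inner[OF open_E] s\<mu> smooth_matrix_vector_mult[OF open_E] smooth_\<nu>
        smooth_compose[OF open_D open_E smooth_Ginv smooth_\<phi> image])
  \<comment> \<open>The first slot of the parallel equation says d\<sigma> = \<mu>, and \<sigma> is
    constant along the hypersurface.\<close>
  have \<mu>J: "fst (snd (V (\<phi> y))) \<bullet> pd \<alpha> \<phi> y = 0" if y: "y \<in> E" for y \<alpha>
  proof -
    note x = inD[OF y]
    have "pd a (\<lambda>y. fst (V y)) (\<phi> y) = fst (snd (V (\<phi> y))) $ a" for a
      using par[OF x, of a] by (simp add: cov_components[OF V x] zero_prod_def)
    then have "pd \<alpha> (\<lambda>y. fst (V (\<phi> y))) y = (\<Sum>a\<in>UNIV. (pd \<alpha> \<phi> y $ a) *\<^sub>R fst (snd (V (\<phi> y))) $ a)"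
      using pd_compose[OF smooth_on_differentiable[OF smooth_\<phi> open_E y]
          smooth_on_differentiable[OF smooth_fst[OF open_D V] open_D x], of \<alpha>] by simp
    moreover have "pd \<alpha> (\<lambda>y. fst (V (\<phi> y))) y = pd \<alpha> (\<lambda>y. 0) y"
      by (rule pd_cong[OF open_E y \<sigma>])
    ultimately show ?thesis by (simp add: inner_vec_def mult.commute)
  qed
  have \<mu>: "fst (snd (V (\<phi> y))) = m y *\<^sub>R \<nu> y" if y: "y \<in> E" for y
    unfolding m_def by (rule conormal_unique[OF y \<mu>J[OF y]])
  have hV: "h (\<phi> y) (V (\<phi> y)) (V (\<phi> y)) = m y * m y" if y: "y \<in> E" for y
    by (simp add: tractor_h_eq \<sigma>[OF y] Ginv_def[symmetric] \<mu>[OF y] matrix_vector_mult_scaleR unit[OF y])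
  have m0: "m y \<noteq> 0" if "y \<in> E" for y
    using pos_h[OF that] hV[OF that] by auto
  \<comment> \<open>The square of m is the constant length of the parallel tractor, so m is locally
    constant. Its sign depends on the choice of conormal and is left open.\<close>
  have dm0: "pd \<alpha> m y = 0" if y: "y \<in> E" for y \<alpha>
  proof -
    note x = inD[OF y]
    have "pd \<alpha> (\<lambda>y. h (\<phi> y) (V (\<phi> y)) (V (\<phi> y))) y
        = (\<Sum>a\<in>UNIV. (pd \<alpha> \<phi> y $ a) *\<^sub>R pd a (\<lambda>x. h x (V x) (V x)) (\<phi> y))"
      by (rule pd_compose[OF smooth_on_differentiable[OF smooth_\<phi> open_E y]
            smooth_on_differentiable[OF h[OF V V] open_D x]])
    also have "\<dots> = 0" by (simp add: parallel_h_const[OF V par x])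
    finally have "pd \<alpha> (\<lambda>y. h (\<phi> y) (V (\<phi> y)) (V (\<phi> y))) y = 0" .
    moreover have "pd \<alpha> (\<lambda>y. h (\<phi> y) (V (\<phi> y)) (V (\<phi> y))) y = pd \<alpha> (\<lambda>y. m y * m y) y"
      by (rule pd_cong[OF open_E y hV])
    ultimately have "pd \<alpha> (\<lambda>y. m y * m y) y = 0" by simp
    then show ?thesis
      using m0[OF y] smooth_on_differentiable[OF sm open_E y]
      by (simp add: pd_bilinear[OF bounded_bilinear_mult])
  qed
  have sim: "smooth_on E (\<lambda>y. inverse (m y))" by (rule smooth_inverse[OF open_E sm m0])
  have dim0: "pd \<alpha> (\<lambda>y. inverse (m y)) y = 0" if y: "y \<in> E" for y \<alpha>
  proof -
    have "pd \<alpha> (\<lambda>y. m y * inverse (m y)) y = pd \<alpha> (\<lambda>y. 1) y"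
      by (rule pd_cong[OF open_E y]) (use m0 in auto)
    then show ?thesis
      using m0[OF y] dm0[OF y, of \<alpha>]
      by (simp add: pd_bilinear[OF bounded_bilinear_mult smooth_on_differentiable[OF sm open_E y]
            smooth_on_differentiable[OF sim open_E y]])
  qed
  have covV: "cov ?S \<alpha> (\<lambda>y. V (\<phi> y)) y = 0" if y: "y \<in> E" for y \<alpha>
    by (simp add: cov_pull[OF open_E smooth_\<phi> image V y] par[OF inD[OF y]])
  have "hypersurface D G E \<phi> \<nu> ?H"
  proof unfold_locales
    show "3 \<le> CARD('m)" by fact
    show "smooth_on E ?H"
      by (intro smooth_minus[OF open_E] smooth_divide[OF open_E] s\<rho> sm m0)
    show "weyl G (\<phi> y) a b c d = 0" if "y \<in> E" for y a b c d
      by (rule weyl[OF that])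
    show "cov ?S \<alpha> (\<lambda>y. (0, \<nu> y, - ?H y)) y = 0" if y: "y \<in> E" for y \<alpha>
    proof -
      have "cov ?S \<alpha> (\<lambda>y. (0, \<nu> y, - ?H y)) y = cov ?S \<alpha> (\<lambda>y. inverse (m y) *\<^sub>R V (\<phi> y)) y"
        by (rule P.cov_cong[OF y]) (simp add: prod_eq_iff \<sigma> \<mu> m0 divide_inverse)
      then show ?thesis
        by (simp add: P.cov_scaleR[OF sim sV y] covV[OF y] dim0[OF y])
    qed
  qed
  then show ?thesis by (simp add: m_def)
qed

text \<open>If the divergence is nonzero at x, it is nonzero on a neighbourhood U, where
  \<open>YM_zero_off_singular\<close> forces \<sigma> = 0. The parallel equation then gives \<mu> =
  d\<sigma> = 0 on U and \<rho> g = 0 at x, contradicting that V has no zeros.\<close>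

lemma YM_zero:
  assumes four: "CARD('n) = 4" and V: "smooth_on D V"
    and par: "\<And>a y. y \<in> D \<Longrightarrow> cov (tform G (schouten G)) a V y = 0"
    and nz: "\<And>y. y \<in> D \<Longrightarrow> V y \<noteq> 0" and x: "x \<in> D"
  shows "YM b x w = 0"
proof (rule ccontr)
  assume ne: "YM b x w \<noteq> 0"
  define U where "U = {y \<in> D. YM b y w \<noteq> 0}"
  have "open U"
  proof -
    have "open (D \<inter> (\<lambda>y. YM b y w) -` (- {0}))"
      by (rule continuous_open_preimage[OF smooth_on_continuous_on[OF smooth_YM] open_D open_Compl[OF closed_singleton]])
    moreover have "U = D \<inter> (\<lambda>y. YM b y w) -` (- {0})" by (auto simp: U_def)
    ultimately show ?thesis by simp
  qed
  have xU: "x \<in> U" using ne x by (simp add: U_def)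
  have \<sigma>: "fst (V y) = 0" if "y \<in> U" for y
  proof (rule ccontr)
    assume "fst (V y) \<noteq> 0"
    moreover have "y \<in> D" using that by (simp add: U_def)
    moreover have "YM b y (V y) = 0" if "y \<in> D"
      unfolding YM_def by (simp add: nab_parallel[OF V par that])
    ultimately show False using YM_zero_off_singular[of y b "V y" w] that four by (simp add: U_def)
  qed
  have \<mu>: "fst (snd (V y)) = 0" if y: "y \<in> U" for y
  proof -
    have yD: "y \<in> D" using y by (simp add: U_def)
    have "pd a (\<lambda>y. fst (V y)) y = pd a (\<lambda>y. 0) y" for a
      by (rule pd_cong[OF \<open>open U\<close> y \<sigma>])
    then show ?thesis
      using par[OF yD] by (simp add: cov_components[OF V yD] zero_prod_def vec_eq_iff)
  qed
  have "pd a (\<lambda>y. fst (snd (V y))) x = pd a (\<lambda>y. 0) x" for a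
    by (rule pd_cong[OF \<open>open U\<close> xU \<mu>])
  then have "snd (snd (V x)) *\<^sub>R (G x $ a) = 0" for a
    using par[OF x, of a] by (simp add: cov_components[OF V x] zero_prod_def \<sigma>[OF xU] \<mu>[OF xU])
  moreover have "\<exists>a. G x $ a \<noteq> 0"
  proof (rule ccontr)
    assume "\<not> ?thesis"
    then have "G x *v axis undefined 1 = 0" by (simp add: vec_eq_iff matrix_vector_mult_def)
    then show False using pos[OF x, of "axis undefined 1"] by (simp add: axis_eq_0_iff)
  qed
  ultimately have "snd (snd (V x)) = 0" by (metis scaleR_eq_0_iff)
  then show False using nz[OF x] \<sigma>[OF xU] \<mu>[OF xU] by (simp add: prod_eq_iff)
qed

end

text \<open>With \<sigma> = 0 and \<Omega> X = 0, the equation \<Omega> V = 0 concerns the Z part of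
  V alone, and the squared length of V is that of its middle slot \<mu>.\<close>

lemma weyl_zero_at_zero:
  fixes G :: "real^4 \<Rightarrow> real^4^4"
  assumes "schouten_form D G" and V: "smooth_on D V"
    and par: "\<And>a y. y \<in> D \<Longrightarrow> cov (tform G (schouten G)) a V y = 0"
    and x: "x \<in> D" and \<sigma>: "fst (V x) = 0" and pos_h: "tractor_h (G x) (V x) (V x) > 0"
  shows "weyl G x a b c d = 0"
proof -
  interpret schouten_form D G by fact
  have "\<Omega> a b x (tZ (fst (snd (V x)))) = 0" for a b
  proof -
    have "0 = \<Omega> a b x (fst (V x) *\<^sub>R tY + tZ (fst (snd (V x))) + snd (snd (V x)) *\<^sub>R tX)"
      using parallel_curv[OF V par x, of a b] tractor_decomp[of "V x"] by simp
    also have "\<dots> = \<Omega> a b x (tZ (fst (snd (V x))))"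
      by (simp only: linear_add[OF linear_curv[OF x]] linear_cmul[OF linear_curv[OF x]] \<sigma> curv_X[OF x]
          scaleR_zero_left scaleR_zero_right add_0 add_0_right)
    finally show ?thesis by simp
  qed
  moreover have "fst (snd (V x)) \<bullet> (Ginv G x *v fst (snd (V x))) > 0"
    using pos_h by (simp add: tractor_h_eq \<sigma> Ginv_def)
  ultimately show ?thesis by (intro weyl_zero_of_null_direction[OF assms(1) x])
qed

text \<open>The coordinate expression of the pullback metric is compared with the induced metric
  only over the overlap of an intrinsic and an ambient chart; curvature is local, so that
  suffices.\<close>

lemma tcurv_vec_cong:
  assumes "schouten_form E G" and eq: "\<And>y. y \<in> E \<Longrightarrow> G' y = G y" and y: "y \<in> E"
  shows "tcurv_vec G' y u v w = tcurv_vec G y u v w"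
proof -
  interpret schouten_form E G by fact
  note pc = pd_cong[OF open_D]
  have pdG: "pd i G' z = pd i G z" if "z \<in> E" for i z by (rule pc[OF that eq])
  have gi: "Ginv G' z = Ginv G z" if "z \<in> E" for z by (simp add: Ginv_def eq[OF that])
  have ch: "christoffel G' z k i j = christoffel G z k i j" if "z \<in> E" for z i j k
    by (simp add: christoffel_def gi[OF that] pdG[OF that])
  have ri: "riemann G' z a b c d = riemann G z a b c d" if "z \<in> E" for z a b c d
    by (simp add: riemann_def ch[OF that] pc[OF that ch])
  have sc: "schouten G' z = schouten G z" if "z \<in> E" for z
    by (simp add: schouten_def ricci_def schoutenJ_def gtrace_def ri[OF that] gi[OF that] eq[OF that])
  have tf: "tform G' (schouten G') a z w = tform G (schouten G) a z w" if "z \<in> E" for a z w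
    by (simp add: tform_def gam_def ch[OF that] sc[OF that] gi[OF that] eq[OF that])
  interpret G': schouten_form E G'
  proof
    show "smooth_on E G'" by (rule smooth_on_cong[OF open_D _ smooth_G]) (simp add: eq)
  qed (auto simp: eq open_D sym pos dim)
  have "curv (tform G' (schouten G')) a b y w = \<Omega> a b y w" for a b w
    by (simp add: curv_def tf[OF y] pc[OF y tf])
  then show ?thesis
    by (simp add: tcurv_vec_def G'.tcurv_eq[OF y] tcurv_eq[OF y])
qed

section \<open>Charts\<close>

lemma
  assumes "chart_on X c"
  shows chart_subset: "fst c \<subseteq> topspace X"
    and cinv_chart: "p \<in> fst c \<Longrightarrow> cinv c (snd c p) = p"
    and chart_cinv: "x \<in> cim c \<Longrightarrow> snd c (cinv c x) = x" "x \<in> cim c \<Longrightarrow> cinv c x \<in> fst c"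
    and open_chart_image: "openin X U \<Longrightarrow> open (snd c ` (fst c \<inter> U))"
    and openin_chart_preimage: "open W \<Longrightarrow> openin X {p \<in> fst c. snd c p \<in> W}"
proof -
  have o: "openin X (fst c)" "open (cim c)" and
    hm: "homeomorphic_map (subtopology X (fst c)) (top_of_set (cim c)) (snd c)"
    using assms by (auto simp: chart_on_def)
  show sub: "fst c \<subseteq> topspace X" using o(1) by (rule openin_subset)
  have top: "topspace (subtopology X (fst c)) = fst c" using sub by auto
  have inj: "inj_on (snd c) (fst c)"
    using homeomorphic_imp_injective_map[OF hm] top by simp
  show "p \<in> fst c \<Longrightarrow> cinv c (snd c p) = p" using inj by (simp add: cinv_def)
  show "x \<in> cim c \<Longrightarrow> snd c (cinv c x) = x" by (simp add: cinv_def cim_def f_inv_into_f)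
  show "x \<in> cim c \<Longrightarrow> cinv c x \<in> fst c" by (simp add: cinv_def cim_def inv_into_into)
  show "open (snd c ` (fst c \<inter> U))" if "openin X U"
  proof -
    have "openin (subtopology X (fst c)) (fst c \<inter> U)"
      using that by (auto simp: openin_subtopology)
    then have "openin (top_of_set (cim c)) (snd c ` (fst c \<inter> U))"
      using homeomorphic_imp_open_map[OF hm] by (simp add: open_map_def)
    then show ?thesis using o(2) openin_open_eq by blast
  qed
  show "openin X {p \<in> fst c. snd c p \<in> W}" if "open W"
  proof -
    have "openin (top_of_set (cim c)) (W \<inter> cim c)" using that by (auto simp: openin_open)
    then have "openin (subtopology X (fst c)) {p \<in> topspace (subtopology X (fst c)). snd c p \<in> W \<inter> cim c}"
      using homeomorphic_imp_continuous_map[OF hm] by (rule openin_continuous_map_preimage[rotated])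
    moreover have "{p \<in> topspace (subtopology X (fst c)). snd c p \<in> W \<inter> cim c} = {p \<in> fst c. snd c p \<in> W}"
      unfolding top by (auto simp: cim_def)
    ultimately show ?thesis using openin_trans_full o(1) by metis
  qed
qed

lemma jac_jacobian: "jac b c p = jacobian (snd c \<circ> cinv b) (snd b p)"
  by (simp add: jac_def matrix_def jacobian_def pd_def)

lemma rescale_riemannian:
  assumes M: "smooth_manifold X A" and g: "riemannian_metric A g" and \<omega>: "smooth_fun A (topspace X) \<omega>"
  shows "riemannian_metric A (rescale \<omega> g)"
proof -
  have ch: "chart_on X c" if "c \<in> A" for c using M that by (simp add: smooth_manifold_def)
  have sm: "smooth_on (cim c) (local_rep (rescale \<omega> g) c)" if c: "c \<in> A" for c
  proof -
    have o: "open (cim c)" using ch[OF c] by (simp add: chart_on_def)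
    have "fst c \<inter> topspace X = fst c" using chart_subset[OF ch[OF c]] by auto
    then have s\<omega>: "smooth_on (cim c) (\<omega> \<circ> cinv c)"
      using \<omega> c by (auto simp: smooth_fun_def cim_def)
    have lg: "smooth_on (cim c) (local_rep g c)"
      using g c unfolding riemannian_metric_def by blast
    have "smooth_on (cim c) (\<lambda>x. exp (2 * (\<omega> \<circ> cinv c) x) *\<^sub>R local_rep g c x)"
      by (rule smooth_scaleR[OF o smooth_exp[OF o smooth_mult[OF o smooth_const s\<omega>]] lg])
    then show ?thesis by (simp add: local_rep_def[abs_def] rescale_def)
  qed
  have B: "transpose B ** (k *\<^sub>R M) ** C = k *\<^sub>R (transpose B ** M ** C)" for k and B M C :: "real^'b^'b"
    by (simp add: bounded_bilinear.scaleR_left[OF bounded_bilinear_matrix_matrix_mult]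
        bounded_bilinear.scaleR_right[OF bounded_bilinear_matrix_matrix_mult])
  have t: "rescale \<omega> g p c = transpose (jac c c' p) ** rescale \<omega> g p c' ** jac c c' p"
    if "c \<in> A" "c' \<in> A" "p \<in> fst c \<inter> fst c'" for c c' p
  proof -
    have "g p c = transpose (jac c c' p) ** g p c' ** jac c c' p"
      using g that unfolding riemannian_metric_def by blast
    then show ?thesis unfolding rescale_def B by simp
  qed
  have s: "transpose (rescale \<omega> g p c) = rescale \<omega> g p c" and
    p: "v \<noteq> 0 \<Longrightarrow> v \<bullet> (rescale \<omega> g p c *v v) > 0" if "c \<in> A" "p \<in> fst c" for c p v
  proof -
    have "transpose (g p c) = g p c" and v: "v \<noteq> 0 \<Longrightarrow> v \<bullet> (g p c *v v) > 0"
      using g that unfolding riemannian_metric_def by blast+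
    then show "transpose (rescale \<omega> g p c) = rescale \<omega> g p c"
      by (simp add: rescale_def linear_cmul[OF bounded_linear.linear[OF bounded_linear_transpose]])
    show "v \<noteq> 0 \<Longrightarrow> v \<bullet> (rescale \<omega> g p c *v v) > 0"
      using v by (simp add: rescale_def scaleR_matrix_vector_assoc[symmetric])
  qed
  have z: "rescale \<omega> g p c = 0" if "c \<notin> A \<or> p \<notin> fst c" for p c
  proof -
    have "g p c = 0" using g that unfolding riemannian_metric_def by blast
    then show ?thesis by (simp add: rescale_def)
  qed
  show ?thesis
    unfolding riemannian_metric_def
    by (intro conjI allI ballI impI z t s p sm)
qed

section \<open>Almost Einstein manifolds\<close>

locale almost_einstein_4 =
  fixes X :: "'a topology" and A :: "('a, 4) chart set" and K :: "('a, 4) metric set" and I :: "('a, 4) tractor_field"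
  assumes M: "smooth_manifold X A" and conn: "connected_space X"
    and KK: "conformal_class X A K" and AE: "almost_einstein X A K I"
begin

lemma chart: "c \<in> A \<Longrightarrow> chart_on X c"
  using M by (simp add: smooth_manifold_def)

lemma chart_image: "c \<in> A \<Longrightarrow> snd c ` (fst c \<inter> topspace X) = cim c"
  using chart_subset[OF chart, of c] by (simp add: cim_def inf.absorb1)

lemma open_cim: "c \<in> A \<Longrightarrow> open (cim c)"
  using chart by (simp add: chart_on_def)

lemma covered: "p \<in> topspace X \<Longrightarrow> \<exists>c\<in>A. p \<in> fst c"
  using M by (auto simp: smooth_manifold_def)

lemma metric:
  assumes "g \<in> K"
  shows "riemannian_metric A g"
proof -
  obtain g0 \<omega> where "riemannian_metric A g0" "smooth_fun A (topspace X) \<omega>" "g = rescale \<omega> g0"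
    using KK assms by (auto simp: conformal_class_def)
  then show ?thesis using rescale_riemannian[OF M] by simp
qed

lemma rescale_ex:
  assumes "g \<in> K" "g' \<in> K"
  shows "\<exists>\<omega>. smooth_fun A (topspace X) \<omega> \<and> g' = rescale \<omega> g"
proof -
  obtain g0 \<omega> \<omega>' where g0: "smooth_fun A (topspace X) \<omega>" "g = rescale \<omega> g0"
      "smooth_fun A (topspace X) \<omega>'" "g' = rescale \<omega>' g0"
    using KK assms by (auto simp: conformal_class_def)
  have "smooth_fun A (topspace X) (\<lambda>p. \<omega>' p - \<omega> p)"
    unfolding smooth_fun_def
  proof
    fix c assume c: "c \<in> A"
    have "smooth_on (cim c) (\<omega>' \<circ> cinv c)" "smooth_on (cim c) (\<omega> \<circ> cinv c)"
      using g0(1,3) c chart_image[OF c] unfolding smooth_fun_def by metis+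
    from smooth_diff[OF open_cim[OF c] this]
    show "smooth_on (snd c ` (fst c \<inter> topspace X)) ((\<lambda>p. \<omega>' p - \<omega> p) \<circ> cinv c)"
      by (simp only: chart_image[OF c] o_def)
  qed
  moreover have "exp (2 * \<omega>' p - 2 * \<omega> p) * exp (2 * \<omega> p) = exp (2 * \<omega>' p)" for p
    by (simp add: exp_diff)
  then have "g' = rescale (\<lambda>p. \<omega>' p - \<omega> p) g"
    using g0(2,4) by (simp add: rescale_def[abs_def] right_diff_distrib)
  ultimately show ?thesis by blast
qed

lemma schouten_form:
  assumes g: "g \<in> K" and c: "c \<in> A"
  shows "schouten_form (cim c) (local_rep g c)"
proof
  show "open (cim c)" by (rule open_cim[OF c])
  show "smooth_on (cim c) (local_rep g c)"
    using metric[OF g] c unfolding riemannian_metric_def by blast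
  fix x assume x: "x \<in> cim c"
  have p: "cinv c x \<in> fst c" by (rule chart_cinv(2)[OF chart[OF c] x])
  show "transpose (local_rep g c x) = local_rep g c x"
    using metric[OF g] c p unfolding riemannian_metric_def local_rep_def by blast
  show "v \<bullet> (local_rep g c x *v v) > 0" if "v \<noteq> 0" for v
    using metric[OF g] c p that unfolding riemannian_metric_def local_rep_def by blast
qed simp

lemma section_cases:
  assumes "g \<in> K"
  obtains \<sigma> \<mu> \<rho> where "I g = (\<sigma>, \<mu>, \<rho>)" "density_on A K (topspace X) 1 \<sigma>"
    "codensity_on A K (topspace X) 1 \<mu>" "density_on A K (topspace X) (-1) \<rho>"
  using AE assms by (cases "I g") (auto simp: almost_einstein_def tractor_section_def)

abbreviation V :: "('a, 4) metric \<Rightarrow> ('a, 4) chart \<Rightarrow> real^4 \<Rightarrow> 4 tractor" where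
  "V g c y \<equiv> triv I g c (cinv c y)"

lemma smooth_V:
  assumes g: "g \<in> K" and c: "c \<in> A"
  shows "smooth_on (cim c) (V g c)"
proof -
  obtain \<sigma> \<mu> \<rho> where I: "I g = (\<sigma>, \<mu>, \<rho>)" "density_on A K (topspace X) 1 \<sigma>"
    "codensity_on A K (topspace X) 1 \<mu>" "density_on A K (topspace X) (-1) \<rho>"
    using section_cases[OF g] .
  have d: "smooth_on (cim c) (\<lambda>y. f (cinv c y) (g (cinv c y)))" if "density_on A K (topspace X) w f" for w f
    using that g c unfolding density_on_def smooth_fun_def by (auto simp: chart_image o_def)
  have m: "smooth_on (cim c) (\<lambda>y. \<mu> (cinv c y) (g (cinv c y)) c)"
    using I(3) g c unfolding codensity_on_def by (auto simp: chart_image)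
  show ?thesis
    unfolding triv_def I(1) by (simp add: smooth_Pair[OF open_cim[OF c]] d[OF I(2)] d[OF I(4)] m)
qed

lemma parallel_V: "g \<in> K \<Longrightarrow> c \<in> A \<Longrightarrow> x \<in> cim c \<Longrightarrow> cov (tform (local_rep g c) (schouten (local_rep g c))) a (V g c) x = 0"
  using AE unfolding almost_einstein_def parallel_tractor_def tconn_eq_cov by blast

lemma triv_zero_chart:
  assumes g: "g \<in> K" and "c \<in> A" "c' \<in> A" "p \<in> fst c" "p \<in> fst c'" and z: "triv I g c' p = 0"
  shows "triv I g c p = 0"
proof -
  obtain \<sigma> \<mu> \<rho> where I: "I g = (\<sigma>, \<mu>, \<rho>)" "codensity_on A K (topspace X) 1 \<mu>"
    using section_cases[OF g] .
  have "p \<in> topspace X" using chart_subset[OF chart] assms by blast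
  then have "\<mu> p (g p) c = \<mu> p (g p) c' v* jac c c' p"
    using I(2) assms(1-5) unfolding codensity_on_def by blast
  then show ?thesis
    using z by (simp add: triv_def I(1) zero_prod_def vector_matrix_mult_def vec_eq_iff)
qed

text \<open>The change of scale is triangular: if the transformed triple vanishes, so do \<sigma>,
  then \<mu>, then \<rho>. Both triples are compared at the same point \<open>g p\<close> of the
  bundle of metrics, and homogeneity moves between \<open>g p\<close> and
  \<open>g' p\<close>.\<close>

lemma triv_zero_scale:
  assumes g: "g \<in> K" "g' \<in> K" and c: "c \<in> A" and p: "p \<in> fst c" and z: "triv I g' c p = 0"
  shows "triv I g c p = 0"
proof -
  obtain \<omega> where \<omega>: "smooth_fun A (topspace X) \<omega>" "g' = rescale \<omega> g"
    using rescale_ex[OF g] by blast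
  obtain \<sigma> \<mu> \<rho> where I: "I g = (\<sigma>, \<mu>, \<rho>)"
    using section_cases[OF g(1)] .
  obtain \<sigma>' \<mu>' \<rho>' where I': "I g' = (\<sigma>', \<mu>', \<rho>')" "density_on A K (topspace X) 1 \<sigma>'"
    "codensity_on A K (topspace X) 1 \<mu>'" "density_on A K (topspace X) (-1) \<rho>'"
    using section_cases[OF g(2)] .
  have pX: "p \<in> topspace X" using chart_subset[OF chart[OF c]] p by blast
  let ?m = "g p"
  have T: "\<sigma>' p ?m = \<sigma> p ?m" "\<mu>' p ?m c = \<mu> p ?m c + \<sigma> p ?m *\<^sub>R differential c \<omega> p"
    "\<rho>' p ?m = \<rho> p ?m - differential c \<omega> p \<bullet> (matrix_inv (?m c) *v \<mu> p ?m c)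
       - (1/2) * \<sigma> p ?m * (differential c \<omega> p \<bullet> (matrix_inv (?m c) *v differential c \<omega> p))"
  proof -
    have "tractor_section X A K I" using AE by (simp add: almost_einstein_def)
    then have "\<forall>c\<in>A. \<forall>p\<in>fst c. \<forall>m\<in>{k p |k. k \<in> K}. let \<Upsilon> = differential c \<omega> p in
             \<sigma>' p m = \<sigma> p m \<and> \<mu>' p m c = \<mu> p m c + \<sigma> p m *\<^sub>R \<Upsilon> \<and>
             \<rho>' p m = \<rho> p m - \<Upsilon> \<bullet> (matrix_inv (m c) *v \<mu> p m c)
                       - (1/2) * \<sigma> p m * (\<Upsilon> \<bullet> (matrix_inv (m c) *v \<Upsilon>))"
      using g(1) \<omega>(1) I I'(1) unfolding tractor_section_def \<omega>(2) by fastforce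
    moreover have "?m \<in> {k p |k. k \<in> K}" using g(1) by blast
    ultimately have "let \<Upsilon> = differential c \<omega> p in
             \<sigma>' p ?m = \<sigma> p ?m \<and> \<mu>' p ?m c = \<mu> p ?m c + \<sigma> p ?m *\<^sub>R \<Upsilon> \<and>
             \<rho>' p ?m = \<rho> p ?m - \<Upsilon> \<bullet> (matrix_inv (?m c) *v \<mu> p ?m c)
                       - (1/2) * \<sigma> p ?m * (\<Upsilon> \<bullet> (matrix_inv (?m c) *v \<Upsilon>))"
      using c p by blast
    then show "\<sigma>' p ?m = \<sigma> p ?m" "\<mu>' p ?m c = \<mu> p ?m c + \<sigma> p ?m *\<^sub>R differential c \<omega> p"
    "\<rho>' p ?m = \<rho> p ?m - differential c \<omega> p \<bullet> (matrix_inv (?m c) *v \<mu> p ?m c)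
       - (1/2) * \<sigma> p ?m * (differential c \<omega> p \<bullet> (matrix_inv (?m c) *v differential c \<omega> p))"
      unfolding Let_def by blast+
  qed
  define s where "s = exp (\<omega> p)"
  have s: "s > 0" by (simp add: s_def)
  have "s\<^sup>2 = exp (2 * \<omega> p)" by (simp add: s_def power2_eq_square exp_add[symmetric])
  then have gp: "g' p = (\<lambda>c. s\<^sup>2 *\<^sub>R g p c)" by (simp add: \<omega>(2) rescale_def[abs_def])
  have w: "\<sigma>' p (g' p) = s powr 1 * \<sigma>' p ?m" "\<rho>' p (g' p) = s powr (-1) * \<rho>' p ?m"
    using I'(2,4) g(1) pX s unfolding density_on_def gp by blast+
  have w': "\<mu>' p (g' p) c = s powr 1 *\<^sub>R \<mu>' p ?m c"
    using I'(3) g(1) c p pX s unfolding codensity_on_def gp by blast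
  have "\<sigma>' p (g' p) = 0" "\<mu>' p (g' p) c = 0" "\<rho>' p (g' p) = 0"
    using z by (simp_all add: triv_def I'(1) zero_prod_def)
  then have "\<sigma>' p ?m = 0" "\<mu>' p ?m c = 0" "\<rho>' p ?m = 0"
    using w w' s by simp_all
  then have "\<sigma> p ?m = 0" "\<mu> p ?m c = 0" "\<rho> p ?m = 0" using T by simp_all
  then show ?thesis by (simp add: triv_def I zero_prod_def)
qed

text \<open>The zero set is open by \<open>parallel_unique\<close> and closed by continuity. It is
  not the whole connected space, because a nonzero value in some scale remains nonzero in the given
  one.\<close>

lemma triv_nonzero:
  assumes g: "g \<in> K" and c: "c \<in> A" and p: "p \<in> fst c"
  shows "triv I g c p \<noteq> 0"
proof -
  define Z where "Z = {p \<in> topspace X. \<exists>c\<in>A. p \<in> fst c \<and> triv I g c p = 0}"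
  have Z: "p \<in> Z \<longleftrightarrow> triv I g c p = 0" if "c \<in> A" "p \<in> fst c" for p c
    using that chart_subset[OF chart] triv_zero_chart[OF g that(1) _ that(2)] unfolding Z_def by blast
  have "\<exists>T. openin X T \<and> q \<in> T \<and> T \<subseteq> Z" if q: "q \<in> Z" for q
  proof -
    obtain c where c: "c \<in> A" "q \<in> fst c" "triv I g c q = 0" using q by (auto simp: Z_def)
    interpret schouten_form "cim c" "local_rep g c" by (rule schouten_form[OF g c(1)])
    have "snd c q \<in> cim c" using c by (simp add: cim_def)
    then obtain \<delta> where \<delta>: "\<delta> > 0" "\<forall>y\<in>ball (snd c q) \<delta>. V g c y = 0"
      using parallel_unique[OF smooth_V[OF g c(1)] parallel_V[OF g c(1)], of "snd c q"] c
      by (auto simp: cinv_chart[OF chart])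
    let ?T = "{p \<in> fst c. snd c p \<in> ball (snd c q) \<delta>}"
    have "openin X ?T" by (rule openin_chart_preimage[OF chart[OF c(1)] open_ball])
    moreover have "q \<in> ?T" using c \<delta>(1) by simp
    moreover have "?T \<subseteq> Z"
    proof
      fix r assume r: "r \<in> ?T"
      then have "V g c (snd c r) = 0" using \<delta>(2) by blast
      then have "triv I g c r = 0" using r cinv_chart[OF chart[OF c(1)], of r] by simp
      then show "r \<in> Z" using Z[OF c(1)] r by blast
    qed
    ultimately show ?thesis by blast
  qed
  then have o1: "openin X Z" by (subst openin_subopen) blast
  have "\<exists>T. openin X T \<and> q \<in> T \<and> T \<subseteq> topspace X - Z" if q: "q \<in> topspace X - Z" for q
  proof -
    obtain c where c: "c \<in> A" "q \<in> fst c" using covered q by blast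
    have ne: "triv I g c q \<noteq> 0" using Z[OF c] q by blast
    define W where "W = {y \<in> cim c. V g c y \<noteq> 0}"
    have "open (cim c \<inter> V g c -` (- {0}))"
      by (rule continuous_open_preimage[OF smooth_on_continuous_on[OF smooth_V[OF g c(1)]] open_cim[OF c(1)]
            open_Compl[OF closed_singleton]])
    moreover have "W = cim c \<inter> V g c -` (- {0})" by (auto simp: W_def)
    ultimately have "open W" by simp
    then have "openin X {p \<in> fst c. snd c p \<in> W}" by (rule openin_chart_preimage[OF chart[OF c(1)]])
    moreover have "q \<in> {p \<in> fst c. snd c p \<in> W}"
      using c ne by (auto simp: W_def cim_def cinv_chart[OF chart])
    moreover have "{p \<in> fst c. snd c p \<in> W} \<subseteq> topspace X - Z"
      using Z[OF c(1)] chart_subset[OF chart[OF c(1)]] by (auto simp: W_def cinv_chart[OF chart[OF c(1)]])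
    ultimately show ?thesis by blast
  qed
  then have o2: "openin X (topspace X - Z)" by (subst openin_subopen) blast
  have "closedin X Z" using o2 by (auto simp: closedin_def Z_def)
  then have "Z = {} \<or> Z = topspace X"
    using conn o1 by (simp add: connected_space_clopen_in)
  moreover have "Z \<noteq> topspace X"
  proof -
    obtain g1 c1 p1 where n: "g1 \<in> K" "c1 \<in> A" "p1 \<in> fst c1" "triv I g1 c1 p1 \<noteq> 0"
      using AE by (auto simp: almost_einstein_def)
    then have "triv I g c1 p1 \<noteq> 0" using triv_zero_scale[OF n(1) g n(2,3)] by blast
    then have "p1 \<notin> Z" using Z n by blast
    moreover have "p1 \<in> topspace X" using chart_subset[OF chart] n by blast
    ultimately show ?thesis by blast
  qed
  ultimately have "Z = {}" by blast
  then show ?thesis using Z[OF c p] by blast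
qed

lemma yang_mills:
  assumes g: "g \<in> K" and c: "c \<in> A" and x: "x \<in> cim c"
  shows "yang_mills_at (local_rep g c) x"
proof -
  interpret schouten_form "cim c" "local_rep g c" by (rule schouten_form[OF g c])
  have "V g c y \<noteq> 0" if "y \<in> cim c" for y
    by (rule triv_nonzero[OF g c chart_cinv(2)[OF chart[OF c] that]])
  then have "YM b x w = 0" for b w
    using YM_zero[OF _ smooth_V[OF g c] parallel_V[OF g c] _ x] by simp
  then show ?thesis by (rule yang_mills_of_YM[OF x])
qed

abbreviation Sing where "Sing \<equiv> scale_singularity_set X A K I"

lemma singular_fst: "g \<in> K \<Longrightarrow> c \<in> A \<Longrightarrow> p \<in> fst c \<Longrightarrow> p \<in> Sing \<Longrightarrow> fst (triv I g c p) = 0"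
proof -
  assume "g \<in> K" "c \<in> A" "p \<in> fst c" "p \<in> Sing"
  then have "tractor_h (g p c) (0, 0, 1) (triv I g c p) = 0"
    unfolding scale_singularity_set_def by blast
  then show ?thesis by (cases "triv I g c p") simp
qed

lemma weyl_zero:
  assumes neg: "scalar_negative A K I" and g: "g \<in> K" and c: "c \<in> A" and p: "p \<in> fst c" "p \<in> Sing"
  shows "weyl (local_rep g c) (snd c p) i j k l = 0"
proof (rule weyl_zero_at_zero[OF schouten_form[OF g c] smooth_V[OF g c] parallel_V[OF g c]])
  show "snd c p \<in> cim c" using p by (simp add: cim_def)
  show "fst (V g c (snd c p)) = 0"
    using singular_fst[OF g c p] by (simp add: cinv_chart[OF chart[OF c] p(1)])
  show "0 < tractor_h (local_rep g c (snd c p)) (V g c (snd c p)) (V g c (snd c p))"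
    using neg g c p unfolding scalar_negative_def by (simp add: cinv_chart[OF chart[OF c] p(1)] local_rep_def)
qed

end

section \<open>Restricting the tractor curvature to the singularity hypersurface\<close>

lemma jac_compose:
  fixes b :: "('a, 'm::finite) chart" and c c' :: "('a, 'n::finite) chart"
  assumes b: "(snd c \<circ> cinv b) differentiable (at (snd b p))" and c: "(snd c' \<circ> cinv c) differentiable (at (snd c p))"
    and U: "open U" "snd b p \<in> U" "\<And>y. y \<in> U \<Longrightarrow> cinv c (snd c (cinv b y)) = cinv b y" and p: "cinv b (snd b p) = p"
  shows "jac b c' p = jac c c' p ** jac b c p"
proof -
  let ?f = "frechet_derivative (snd c \<circ> cinv b) (at (snd b p))"
  let ?g = "frechet_derivative (snd c' \<circ> cinv c) (at (snd c p))"
  have f: "((snd c \<circ> cinv b) has_derivative ?f) (at (snd b p))" using b by (rule frechet_derivative_works[THEN iffD1])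
  have g: "((snd c' \<circ> cinv c) has_derivative ?g) (at ((snd c \<circ> cinv b) (snd b p)))"
    using c by (simp add: p frechet_derivative_works[symmetric])
  have "((\<lambda>y. (snd c' \<circ> cinv c) ((snd c \<circ> cinv b) y)) has_derivative (\<lambda>v. ?g (?f v))) (at (snd b p))"
    by (rule has_derivative_compose[OF f g])
  then have "((snd c' \<circ> cinv b) has_derivative (\<lambda>v. ?g (?f v))) (at (snd b p))"
    by (rule has_derivative_transform_within_open[OF _ U(1,2)]) (simp add: U(3))
  then have "frechet_derivative (snd c' \<circ> cinv b) (at (snd b p)) = ?g \<circ> ?f"
    by (simp add: frechet_derivative_at[symmetric] o_def)
  then show ?thesis
    unfolding jac_def
    by (simp add: matrix_compose[OF has_derivative_linear[OF f] has_derivative_linear[OF g]])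
qed

context almost_einstein_4
begin

text \<open>The pullback metric is computed in an ambient chart picked by \<open>SOME\<close>,
  possibly different from c; the tensor law of g and the chain rule for Jacobians bring it into
  c.\<close>

lemma pullback_local_rep:
  fixes b :: "('a, 3) chart"
  assumes g: "g \<in> K" and c: "c \<in> A" and b: "b \<in> sub_atlas X A T" and y: "y \<in> snd b ` (fst b \<inter> fst c)"
  shows "local_rep (pullback_metric A (sub_atlas X A T) g) b y = induced_metric (local_rep g c) (snd c \<circ> cinv b) y"
proof -
  obtain p where p: "p \<in> fst b" "p \<in> fst c" "y = snd b p" using y by blast
  have bch: "chart_on (subtopology X T) b" using b by (simp add: sub_atlas_def)
  have bp: "cinv b y = p" using p cinv_chart[OF bch] by simp
  define c' where "c' = (SOME c. c \<in> A \<and> p \<in> fst c)"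
  have c': "c' \<in> A" "p \<in> fst c'"
    using someI[of "\<lambda>c. c \<in> A \<and> p \<in> fst c" c] c p unfolding c'_def by auto
  have op: "open (snd b ` (fst b \<inter> fst d))" if "d \<in> A" for d
  proof -
    have "fst b \<subseteq> T" using chart_subset[OF bch] by auto
    moreover have "openin (subtopology X T) (T \<inter> fst d)"
      using chart[OF that] by (auto simp: chart_on_def openin_subtopology)
    then have "open (snd b ` (fst b \<inter> (T \<inter> fst d)))" by (rule open_chart_image[OF bch])
    moreover have "fst b \<inter> (T \<inter> fst d) = fst b \<inter> fst d" using calculation(1) by blast
    ultimately show ?thesis by simp
  qed
  have d1: "(snd c \<circ> cinv b) differentiable (at (snd b p))"
    using b c p op[OF c] unfolding sub_atlas_def by (auto intro: smooth_on_differentiable)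
  have d2: "(snd c' \<circ> cinv c) differentiable (at (snd c p))"
  proof (rule smooth_on_differentiable)
    show "smooth_on (snd c ` (fst c \<inter> fst c')) (snd c' \<circ> cinv c)"
      using M c c' unfolding smooth_manifold_def by blast
    show "open (snd c ` (fst c \<inter> fst c'))"
      using chart[OF c'(1)] by (intro open_chart_image[OF chart[OF c]]) (simp add: chart_on_def)
  qed (use p c' in auto)
  have J: "jac b c' p = jac c c' p ** jac b c p"
  proof (rule jac_compose[OF d1 d2 op[OF c]])
    show "cinv c (snd c (cinv b z)) = cinv b z" if "z \<in> snd b ` (fst b \<inter> fst c)" for z
      using that cinv_chart[OF bch] cinv_chart[OF chart[OF c]] by auto
  qed (use p bp in auto)
  have "g p c = transpose (jac c c' p) ** g p c' ** jac c c' p"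
    using metric[OF g] c c' p unfolding riemannian_metric_def by blast
  then have "transpose (jac b c p) ** g p c ** jac b c p = transpose (jac b c' p) ** g p c' ** jac b c' p"
    by (simp add: J matrix_transpose_mul matrix_mul_assoc)
  moreover have "local_rep (pullback_metric A (sub_atlas X A T) g) b y = transpose (jac b c' p) ** g p c' ** jac b c' p"
    unfolding local_rep_def bp using b p(1) by (simp add: pullback_metric_def c'_def Let_def)
  moreover have "local_rep g c (snd c p) = g p c" using cinv_chart[OF chart[OF c]] p by (simp add: local_rep_def)
  ultimately show ?thesis
    by (simp add: induced_metric_def bp jac_jacobian[symmetric] p(3)[symmetric]) (simp add: jac_jacobian p(3))
qed

text \<open>Projecting w and identifying it with an intrinsic tractor is \<open>\<Psi>\<close>. The
  intrinsic curvature of \<open>\<Psi> y w\<close> is \<open>\<Psi>\<close> of the ambient curvature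
  of w, and since the latter is orthogonal to N, applying the inverse of the identification returns
  it unchanged.\<close>

lemma tractor_curvature_restricts:
  fixes b :: "('a, 3) chart" and n :: "('a, 4) codensity"
  defines "B \<equiv> (sub_atlas X A Sing :: ('a, 3) chart set)"
  assumes neg: "scalar_negative A K I" and n: "unit_conormal X A K Sing B n"
    and g: "g \<in> K" and c: "c \<in> A" and b: "b \<in> B" and p: "p \<in> fst c \<inter> fst b"
  shows "tcurv_vec (local_rep g c) (snd c p) (jac b c p *v u) (jac b c p *v v) w =
    extend_by_zero g n c b p (tcurv_vec (local_rep (pullback_metric A B g) b) (snd b p) u v) w"
proof -
  let ?G = "local_rep g c" and ?D = "cim c"
  define E where "E = snd b ` (fst b \<inter> fst c)"
  define \<phi> where "\<phi> = snd c \<circ> cinv b"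
  \<comment> \<open>\<open>nl\<close> is the given extension of the conormal to an ambient
    neighbourhood, which the mean curvature differentiates; \<nu> is its restriction in the
    coordinates of b.\<close>
  define nl where "nl x = n (cinv c x) (g (cinv c x)) c" for x
  define \<nu> where "\<nu> y = n (cinv b y) (g (cinv b y)) c" for y
  interpret schouten_form ?D ?G by (rule schouten_form[OF g c])
  have bch: "chart_on (subtopology X Sing) b" using b by (simp add: B_def sub_atlas_def)
  have bS: "fst b \<subseteq> Sing" using chart_subset[OF bch] by auto
  have pt: "\<exists>q. q \<in> fst b \<and> q \<in> fst c \<and> q \<in> Sing \<and> y = snd b q \<and> cinv b y = q \<and> \<phi> y = snd c q \<and> cinv c (\<phi> y) = q
      \<and> \<phi> y \<in> ?D \<and> ?G (\<phi> y) = g q c \<and> jacobian \<phi> y = jac b c q" if yE: "y \<in> E" for y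
  proof -
    obtain q where q: "q \<in> fst b" "q \<in> fst c" "y = snd b q" using yE unfolding E_def by blast
    moreover have bq: "cinv b y = q" using q cinv_chart[OF bch] by simp
    moreover have "\<phi> y = snd c q" by (simp add: \<phi>_def bq)
    moreover have "cinv c (\<phi> y) = q" using calculation cinv_chart[OF chart[OF c]] by simp
    ultimately show ?thesis using bS by (auto simp: cim_def local_rep_def jac_jacobian \<phi>_def)
  qed
  have open_E: "open E"
  proof -
    have "openin (subtopology X Sing) (Sing \<inter> fst c)"
      using chart[OF c] by (auto simp: chart_on_def openin_subtopology)
    then have "open (snd b ` (fst b \<inter> (Sing \<inter> fst c)))" by (rule open_chart_image[OF bch])
    moreover have "fst b \<inter> (Sing \<inter> fst c) = fst b \<inter> fst c" using bS by blast
    ultimately show ?thesis by (simp add: E_def)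
  qed
  have s\<phi>: "smooth_on E \<phi>" using b c by (auto simp: B_def sub_atlas_def E_def \<phi>_def)
  obtain W where W: "openin X W" "Sing \<subseteq> W" "codensity_on A K W 1 n"
    using n by (auto simp: unit_conormal_def)
  have oW: "open (snd c ` (fst c \<inter> W))" by (rule open_chart_image[OF chart[OF c] W(1)])
  have snl: "smooth_on (snd c ` (fst c \<inter> W)) nl"
    using W(3) g c unfolding codensity_on_def nl_def by blast
  have \<phi>W: "\<phi> ` E \<subseteq> snd c ` (fst c \<inter> W)"
  proof
    fix x assume "x \<in> \<phi> ` E"
    then obtain y where y: "y \<in> E" "x = \<phi> y" by blast
    from pt[OF y(1)] obtain q where "q \<in> fst c" "q \<in> Sing" "\<phi> y = snd c q" by blast
    then show "x \<in> snd c ` (fst c \<inter> W)" using y W(2) by blast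
  qed
  have \<nu>n: "\<nu> y = nl (\<phi> y)" if "y \<in> E" for y
    using pt[OF that] by (auto simp: \<nu>_def nl_def)
  have emb: "embedded ?D ?G E \<phi> \<nu>"
  proof
    show "open E" by (rule open_E)
    show "smooth_on E \<phi>" by (rule s\<phi>)
    show "\<phi> ` E \<subseteq> ?D" using pt by blast
    show "CARD(4) = Suc CARD(3)" by simp
    show "smooth_on E \<nu>"
      by (rule smooth_on_cong[OF open_E _ smooth_compose[OF oW open_E snl s\<phi> \<phi>W]]) (simp add: \<nu>n)
    fix y assume y: "y \<in> E"
    obtain q where q: "q \<in> fst b" "q \<in> fst c" "q \<in> Sing" "cinv b y = q" "?G (\<phi> y) = g q c" "jacobian \<phi> y = jac b c q"
      using pt[OF y] by blast
    show "inj (\<lambda>u. jacobian \<phi> y *v u)"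
      unfolding q(6) using b c q(1,2) by (auto simp: B_def sub_atlas_def)
    have u: "n q (g q) c \<bullet> (matrix_inv (g q c) *v n q (g q) c) = 1" "n q (g q) c v* jac b c q = 0"
      using n g c b q unfolding unit_conormal_def by blast+
    show "\<nu> y \<bullet> pd \<alpha> \<phi> y = 0" for \<alpha>
      using arg_cong[OF u(2), of "\<lambda>v. v $ \<alpha>"] unfolding q(6)[symmetric] vector_jacobian by (simp add: \<nu>_def q(4))
    show "\<nu> y \<bullet> (Ginv ?G (\<phi> y) *v \<nu> y) = 1"
      using u(1) by (simp add: \<nu>_def q(4) Ginv_def q(5))
  qed
  have sing: "fst (V g c (\<phi> y)) = 0" "0 < tractor_h (?G (\<phi> y)) (V g c (\<phi> y)) (V g c (\<phi> y))"
    "weyl ?G (\<phi> y) i j k l = 0" if y: "y \<in> E" for y i j k l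
  proof -
    obtain q where q: "q \<in> fst c" "q \<in> Sing" "\<phi> y = snd c q" "cinv c (\<phi> y) = q" "?G (\<phi> y) = g q c"
      using pt[OF y] by blast
    show "fst (V g c (\<phi> y)) = 0" unfolding q(4) by (rule singular_fst[OF g c q(1,2)])
    show "0 < tractor_h (?G (\<phi> y)) (V g c (\<phi> y)) (V g c (\<phi> y))"
      using neg g c q(1) unfolding q(4,5) scalar_negative_def by fastforce
    show "weyl ?G (\<phi> y) i j k l = 0" unfolding q(3) by (rule weyl_zero[OF neg g c q(1,2)])
  qed
  \<comment> \<open>Dividing V by its length factor along \<nu> makes it (0, \<nu>, -H), so H is
    minus the quotient of the last slot by that factor.\<close>
  define H where "H y = - (snd (snd (V g c (\<phi> y))) / (fst (snd (V g c (\<phi> y))) \<bullet> (Ginv ?G (\<phi> y) *v \<nu> y)))" for y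
  have "hypersurface ?D ?G E \<phi> \<nu> H"
    unfolding H_def by (rule hypersurface_of_parallel[OF emb smooth_V[OF g c] parallel_V[OF g c] sing(1,2) _ sing(3)]) simp_all
  then interpret hypersurface ?D ?G E \<phi> \<nu> H .
  define y where "y = snd b p"
  have y: "y \<in> E" using p by (auto simp: y_def E_def)
  have q: "cinv b y = p" "\<phi> y = snd c p" "cinv c (\<phi> y) = p" "?G (\<phi> y) = g p c" "jacobian \<phi> y = jac b c p"
  proof -
    have "cinv b y = p" using p cinv_chart[OF bch] by (simp add: y_def)
    then show "cinv b y = p" "\<phi> y = snd c p" "cinv c (\<phi> y) = p" "?G (\<phi> y) = g p c" "jacobian \<phi> y = jac b c p"
      using pt[OF y] by auto
  qed
  have "nl differentiable (at (\<phi> y))"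
    by (rule smooth_on_differentiable[OF snl oW]) (use \<phi>W y in blast)
  from mean_curv_eq[OF y this \<nu>n] have H: "mean_curv g n c p = H y"
    unfolding mean_curv_def nl_def q(2) .
  have N: "normal_tractor g n c p = (0, \<nu> y, - H y)"
    by (simp add: normal_tractor_def H \<nu>_def q(1))
  have i: "to_intrinsic g n c b p z = intrinsic y z" for z
    by (cases z) (simp add: intrinsic_def H q(5) \<nu>_def q(1) Let_def)
  have perp: "normal_perp g n c p = {z. h (\<phi> y) (N y) z = 0}"
    unfolding normal_perp_def N q(4) ..
  let ?Z = "tcurv_vec ?G (\<phi> y) (jacobian \<phi> y *v u) (jacobian \<phi> y *v v) w"
  have "tcurv_vec (local_rep (pullback_metric A B g) b) y u v (intrinsic y (w - h (\<phi> y) (N y) w *\<^sub>R N y))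
      = tcurv_vec \<gamma> y u v (\<Psi> y w)"
    unfolding intrinsic_projection[OF y]
  proof (rule tcurv_vec_cong[OF SigmaP.schouten_form_axioms])
    show "local_rep (pullback_metric A B g) b z = \<gamma> z" if "z \<in> E" for z
      using pullback_local_rep[OF g c b[unfolded B_def]] that by (simp add: B_def E_def \<phi>_def)
  qed (rule y)
  also have "\<dots> = \<Psi> y ?Z" by (rule tcurv_induced[OF y])
  also have "\<dots> = intrinsic y ?Z" by (rule intrinsic_perp[OF y tcurv_perp[OF y], symmetric])
  finally have e: "tcurv_vec (local_rep (pullback_metric A B g) b) y u v (intrinsic y (w - h (\<phi> y) (N y) w *\<^sub>R N y))
      = intrinsic y ?Z" .
  have "extend_by_zero g n c b p (tcurv_vec (local_rep (pullback_metric A B g) b) (snd b p) u v) w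
      = inv_into {z. h (\<phi> y) (N y) z = 0} (intrinsic y) (intrinsic y ?Z)"
    unfolding extend_by_zero_def Let_def perp N i[abs_def] e[symmetric] y_def[symmetric] q(4)[symmetric] i ..
  also have "\<dots> = ?Z"
    by (rule inv_into_f_f[OF inj_intrinsic[OF y]]) (simp only: mem_Collect_eq tcurv_perp[OF y])
  finally show ?thesis by (simp only: q(2,5))
qed

end

theorem proposition4p6:
  fixes X :: "'a topology" and A :: "('a, 4) chart set" and K :: "('a, 4) metric set"
    and I :: "('a, 4) tractor_field"
  assumes "smooth_manifold X A" and "connected_space X"
    and "conformal_class X A K" and "almost_einstein X A K I"
  shows "(\<forall>g\<in>K. \<forall>c\<in>A. \<forall>x\<in>cim c. yang_mills_at (local_rep g c) x) \<and>
    (scalar_negative A K I \<longrightarrow>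
      (let S = scale_singularity_set X A K I; B = (sub_atlas X A S :: ('a, 3) chart set) in
        (\<forall>g\<in>K. \<forall>c\<in>A. \<forall>p\<in>fst c \<inter> S. \<forall>i j k l. weyl (local_rep g c) (snd c p) i j k l = 0) \<and>
        (\<forall>n. unit_conormal X A K S B n \<longrightarrow>
          (\<forall>g\<in>K. \<forall>c\<in>A. \<forall>b\<in>B. \<forall>p\<in>fst c \<inter> fst b. \<forall>u v V.
            tcurv_vec (local_rep g c) (snd c p) (jac b c p *v u) (jac b c p *v v) V =
            extend_by_zero g n c b p
              (tcurv_vec (local_rep (pullback_metric A B g) b) (snd b p) u v) V))))"
proof -
  interpret almost_einstein_4 X A K I using assms by unfold_locales
  show ?thesis
    unfolding Let_def
    by (intro conjI ballI impI allI yang_mills tractor_curvature_restricts) (auto intro: weyl_zero)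
qed

end
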